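(* Assume (2.2) and (2.3), assume (2.9) holds with an exponent $p\in(2,6]$, and assume (2.8) holds with an exponent $q$ satisfying $2<q<p$. Suppose there is $\Delta_0\in(0,\Delta^*]$ such that for all $\Delta\le\Delta_0$, $$h(\Delta)\ge \left(L_{h(\Delta)}^{2q}\Delta^{q/2}\right)^{-\frac{1}{p-q}}.\qquad (2.10)$$ Then for every $T>0$ there are constants $C(T,q)$, $C_{q,T}$ independent of $\Delta$ such that for all sufficiently small $\Delta$, $$\mathbb{E}|x(T)-x_\Delta(T)|^q\le C(T,q)L_{h(\Delta)}^{2q}\Delta^{q/2}\quad\text{and}\quad \mathbb{E}|x(T)-\bar x_\Delta(T)|^q\le C_{q,T}L_{h(\Delta)}^{2q}\Delta^{q/2}.$$
   Context: Let $(\Omega,\mathcal F,(\mathcal F_t)_{t\ge0},P)$ be a complete filtered probability space satisfying the usual conditions, $B$ an $m$-dimensional standard $\mathcal F_t$-Brownian motion, $f:\mathbb{R}^d\to\mathbb{R}^d$ and $g:\mathbb{R}^d\to\mathbb{R}^{d\times m}$ measurable, $x_0\in\mathbb{R}^d$, and $x(t)$ the solution of the SDE $dx(t)=f(x(t))dt+g(x(t))dB(t)$, $x(0)=x_0$. $|\cdot|$ is the Euclidean norm for vectors and the trace norm $|A|=\sqrt{\mathrm{trace}(A^TA)}$ for matrices. Condition (2.2): for every $R>0$ there is $L_R>0$ with $|f(x)-f(\bar x)|\vee|g(x)-g(\bar x)|\le L_R|x-\bar x|$ whenever $|x|\vee|\bar x|\le R$; $L_R$ is nondecreasing in $R$ with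 $L_R\uparrow\infty$. Condition (2.3): $\Delta^*>0$ and $h:(0,\Delta^*]\to(0,\infty)$ is strictly positive, decreasing, $\lim_{\Delta\to0}h(\Delta)=\infty$ and $\lim_{\Delta\to0}L_{h(\Delta)}^4\Delta=0$. Modified truncated functions: $f_\Delta(x)=f(x)$ if $|x|\le h(\Delta)$, $f_\Delta(x)=\frac{|x|}{h(\Delta)}f(h(\Delta)\frac{x}{|x|})$ if $|x|>h(\Delta)$; $g_\Delta$ likewise. MTEM scheme: $X_0^\Delta=x_0$, $X_{k+1}^\Delta=X_k^\Delta+f_\Delta(X_k^\Delta)\Delta+g_\Delta(X_k^\Delta)\Delta B_k$ with $\Delta B_k=B((k+1)\Delta)-B(k\Delta)$. Step process $\bar x_\Delta(t)=\sum_{k\ge0}X_k^\Delta 1_{[k\Delta,(k+1)\Delta)}(t)$; continuous process $x_\Delta(t)=x_0+\int_0^t f_\Delta(\bar x_\Delta(s))ds+\int_0^t g_\Delta(\bar x_\Delta(s))dB(s)$. Condition (2.8) with exponent $q\ge2$: there is $H>0$ with $\langle x-y,f(x)-f(y)\rangle+\frac{q-1}{2}|g(x)-g(y)|^2\le H|x-y|^2$ for all $x,y\in\mathbb{R}^d$. Condition (2.9) with exponent $p>2$: there is $K>0$ with $\langle x,f(x)\rangle+\frac{p-1}{2}|g(x)|^2\le K(1+|x|^2)$ for all $x\in\mathbb{R}^d$. *)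

theory Defs
  imports "HOL-Probability.Probability"
begin

definition usual_filtration :: "'a measure \<Rightarrow> (real \<Rightarrow> 'a measure) \<Rightarrow> bool" where
  "usual_filtration M F \<longleftrightarrow>
     (\<forall>t\<ge>0. space (F t) = space M \<and> sets (F t) \<subseteq> sets M) \<and>
     (\<forall>s t. 0 \<le> s \<and> s \<le> t \<longrightarrow> sets (F s) \<subseteq> sets (F t)) \<and>
     (\<forall>t\<ge>0. sets (F t) = (\<Inter>s\<in>{t<..}. sets (F s))) \<and>
     (\<forall>N\<in>null_sets M. \<forall>A. A \<subseteq> N \<longrightarrow> A \<in> sets (F 0))"

text \<open>Standard m-dimensional F_t-Brownian motion (m = CARD('m)). The Gaussian law
  N(0,(t-s)I) of an increment is expressed via all nonzero linear functionals
  (Cramer--Wold): u . (B t - B s) ~ N(0, |u|^2 (t-s)).\<close>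
definition std_brownian_motion ::
  "'a measure \<Rightarrow> (real \<Rightarrow> 'a measure) \<Rightarrow> (real \<Rightarrow> 'a \<Rightarrow> real^'m) \<Rightarrow> bool" where
  "std_brownian_motion M F B \<longleftrightarrow>
     (\<forall>\<omega>\<in>space M. B 0 \<omega> = 0) \<and>
     (\<forall>\<omega>\<in>space M. continuous_on {0..} (\<lambda>t. B t \<omega>)) \<and>
     (\<forall>t\<ge>0. B t \<in> borel_measurable (F t)) \<and>
     (\<forall>s t. 0 \<le> s \<and> s < t \<longrightarrow>
        (\<forall>u::real^'m. u \<noteq> 0 \<longrightarrow>
           distributed M lborel (\<lambda>\<omega>. u \<bullet> (B t \<omega> - B s \<omega>))
             (\<lambda>y. ennreal (normal_density 0 (norm u * sqrt (t - s)) y))) \<and>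
        (\<forall>A\<in>sets (F s). \<forall>E\<in>sets borel.
           measure M (A \<inter> {\<omega>\<in>space M. B t \<omega> - B s \<omega> \<in> E})
             = measure M A * measure M {\<omega>\<in>space M. B t \<omega> - B s \<omega> \<in> E}))"

text \<open>Strong solution of dx = f(x)dt + g(x)dB, x(0)=x0, on [0,oo): a continuous
  adapted process such that for every t, x(t) - x0 - int_0^t f(x(s))ds equals the
  Ito integral int_0^t g(x(s))dB(s), the latter being (for the continuous adapted
  integrand g(x(.))) the limit in probability of the left-point Riemann sums
  along the uniform partitions of [0,t].\<close>
definition sde_solution ::
  "'a measure \<Rightarrow> (real \<Rightarrow> 'a measure) \<Rightarrow> (real \<Rightarrow> 'a \<Rightarrow> real^'m)
   \<Rightarrow> (real^'d \<Rightarrow> real^'d) \<Rightarrow> (real^'d \<Rightarrow> real^'m^'d) \<Rightarrow> real^'d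
   \<Rightarrow> (real \<Rightarrow> 'a \<Rightarrow> real^'d) \<Rightarrow> bool" where
  "sde_solution M F B f g x0 x \<longleftrightarrow>
     (\<forall>t\<ge>0. x t \<in> borel_measurable (F t)) \<and>
     (\<forall>\<omega>\<in>space M. x 0 \<omega> = x0 \<and> continuous_on {0..} (\<lambda>t. x t \<omega>)) \<and>
     (\<forall>t\<ge>0. \<forall>\<epsilon>>0.
        (\<lambda>n::nat. measure M {\<omega>\<in>space M.
            norm (x t \<omega> - x0 - integral {0..t} (\<lambda>s. f (x s \<omega>))
                  - (\<Sum>k<n. g (x (real k * t / real n) \<omega>) *v
                        (B (real (Suc k) * t / real n) \<omega> - B (real k * t / real n) \<omega>)))
            > \<epsilon>}) \<longlonglongrightarrow> 0)"

definition mtrunc :: "real \<Rightarrow> ('v::real_normed_vector \<Rightarrow> 'w::real_normed_vector) \<Rightarrow> 'v \<Rightarrow> 'w" where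
  "mtrunc H \<phi> x = (if norm x \<le> H then \<phi> x else (norm x / H) *\<^sub>R \<phi> ((H / norm x) *\<^sub>R x))"

primrec mtem ::
  "(real^'d \<Rightarrow> real^'d) \<Rightarrow> (real^'d \<Rightarrow> real^'m^'d) \<Rightarrow> real \<Rightarrow> real \<Rightarrow> real^'d
   \<Rightarrow> (real \<Rightarrow> 'a \<Rightarrow> real^'m) \<Rightarrow> nat \<Rightarrow> 'a \<Rightarrow> real^'d" where
  "mtem f g H \<Delta> x0 B 0 \<omega> = x0"
| "mtem f g H \<Delta> x0 B (Suc k) \<omega> =
     mtem f g H \<Delta> x0 B k \<omega> + \<Delta> *\<^sub>R mtrunc H f (mtem f g H \<Delta> x0 B k \<omega>)
     + mtrunc H g (mtem f g H \<Delta> x0 B k \<omega>) *v (B (real (Suc k) * \<Delta>) \<omega> - B (real k * \<Delta>) \<omega>)"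

definition mtem_step ::
  "(real^'d \<Rightarrow> real^'d) \<Rightarrow> (real^'d \<Rightarrow> real^'m^'d) \<Rightarrow> real \<Rightarrow> real \<Rightarrow> real^'d
   \<Rightarrow> (real \<Rightarrow> 'a \<Rightarrow> real^'m) \<Rightarrow> real \<Rightarrow> 'a \<Rightarrow> real^'d" where
  "mtem_step f g H \<Delta> x0 B t \<omega> = mtem f g H \<Delta> x0 B (nat \<lfloor>t / \<Delta>\<rfloor>) \<omega>"

text \<open>Continuous process x_Delta(t); since the integrands are constant on
  [k Delta, t], the integrals evaluate to this closed form.\<close>
definition mtem_cont ::
  "(real^'d \<Rightarrow> real^'d) \<Rightarrow> (real^'d \<Rightarrow> real^'m^'d) \<Rightarrow> real \<Rightarrow> real \<Rightarrow> real^'d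
   \<Rightarrow> (real \<Rightarrow> 'a \<Rightarrow> real^'m) \<Rightarrow> real \<Rightarrow> 'a \<Rightarrow> real^'d" where
  "mtem_cont f g H \<Delta> x0 B t \<omega> =
     (let k = nat \<lfloor>t / \<Delta>\<rfloor>; X = mtem f g H \<Delta> x0 B k \<omega>
      in X + (t - real k * \<Delta>) *\<^sub>R mtrunc H f X + mtrunc H g X *v (B t \<omega> - B (real k * \<Delta>) \<omega>))"

end

theory Submission
  imports Defs
begin

text \<open>
  No stochastic calculus is needed: everything is done for discrete chains
  y(i+1) = y(i) + \<delta> a(i) + b(i) \<Delta>B(i) with F-adapted coefficients. A second-order expansion of
  (\<eta> + |y|^2)^r with 1 \<le> r \<le> 3 and a cubic remainder turns the one-sided drift condition
  2 <y,a> + (2r-1) |b|^2 \<le> c (\<eta> + |y|^2) + \<zeta> into a Gronwall bound for the chain stopped when a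
  prescribed adapted condition first fails; the restriction p \<le> 6 is what makes the cubic remainder
  suffice. This is applied four times. With r = 1 and the difference of the Euler sums of the
  solution on a grid and on a refinement, it shows that these sums converge to x uniformly on the
  grid in probability (the definition of a solution gives only convergence at fixed times). With
  r = p/2 it yields the p-th moments of x and of the scheme, and, through stopping, the bound
  C / R^p for the probability of leaving the ball of radius R. With r = q/2 and
  \<eta> = L(h)^4 \<Delta> it bounds the gap between the Euler sum and the continuous scheme on a grid
  refining the multiples of \<Delta>, stopped when x or the scheme leaves the ball of radius h(\<Delta>).
  The complement of the good event has probability of order h(\<Delta>)^(-p), and condition (2.10) makes
  its contribution of the required order by Young's inequality.
\<close>

section \<open>One-step Taylor estimates\<close>

text \<open>The obstacle is that \<open>x\<close> offers neither an Ito formula nor a maximal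
  inequality. The substitute is \<open>euler\<close>, which evaluates the coefficients along the
  true solution: it has an exact one-step recursion, and its distance from \<open>x\<close> vanishes
  under refinement. Expanding over a step \<delta> leaves a remainder of order \<delta>^(3/2), so on
  refined grids the size bounds on the coefficients drop out of the limiting Gronwall exponent
  (\<open>growth_rate_tendsto\<close>), even if they blow up with the truncation radius. The scheme
  cannot be refined, since its step is \<Delta>. Its remainder must be at most a constant times
  \<Delta>, which works because coercivity bounds the truncated diffusion by sqrt(L(h)) instead of
  L(h). The exponent 2q of L(h) has two sources: one factor L(h)^q is the size of an increment of
  the scheme, the other the price of moving the one-sided condition from the step process to the
  continuous process.\<close>

lemma one_plus_powr_le_cubic:
  fixes r z :: real
  assumes r: "1 \<le> r" "r \<le> 3" and z: "-1 \<le> z"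
  shows "(1 + z) powr r \<le> 1 + r * z + r * (r - 1) / 2 * z\<^sup>2 + 43 * \<bar>z\<bar> ^ 3"
proof -
  have nn: "0 \<le> r * (r - 1) / 2 * z\<^sup>2" using r by simp
  \<comment> \<open>Taylor's formula is used only for |z| <= 1/2, because the third derivative r
    (r-1) (r-2) t^(r-3) may be unbounded near z = -1. Away from 0 the cubic term alone pays: 12
    |z|^3 covers the linear term for z < -1/2, and r <= 3 gives (1+z)^r <= (3z)^3 for z > 1/2. The
    constant 43 is a generous common bound.\<close>
  consider "z < -1/2" | "z > 1/2" | "z = 0" | "-1/2 \<le> z" "z \<le> 1/2" "z \<noteq> 0" by linarith
  then show ?thesis
  proof cases
    case 1
    have "(1 + z) powr r \<le> 1" using z 1 r by (intro powr_le1) auto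
    moreover have "\<bar>z\<bar> * (1/2)^2 \<le> \<bar>z\<bar> * \<bar>z\<bar>^2" using 1
      by (intro mult_left_mono power_mono) auto
    then have "3 * \<bar>z\<bar> \<le> 12 * \<bar>z\<bar> ^ 3" by (simp add: power3_eq_cube power2_eq_square)
    moreover have "- (r * z) \<le> 3 * \<bar>z\<bar>" using 1 r mult_right_mono[of r 3 "-z"] by simp
    moreover have "0 \<le> \<bar>z\<bar>^3" by simp
    ultimately show ?thesis using nn by linarith
  next
    case 2
    have "(1 + z) powr r \<le> (3 * z) powr r" using 2 r by (intro powr_mono2) auto
    also have "\<dots> \<le> (3 * z) powr 3" using 2 r by (intro powr_mono) auto
    also have "\<dots> = 27 * \<bar>z\<bar> ^ 3" using 2 by (simp add: powr_numeral power_mult_distrib)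
    finally have "(1 + z) powr r \<le> 27 * \<bar>z\<bar> ^ 3" .
    moreover have "0 \<le> r * z" "0 \<le> \<bar>z\<bar>^3" using 2 r by auto
    ultimately show ?thesis using nn by linarith
  next
    case 3 then show ?thesis by simp
  next
    case 4
    define d where "d = (\<lambda>m::nat. \<lambda>t::real. if m = 0 then t powr r else if m = 1 then r * t powr (r - 1)
       else if m = 2 then r * (r - 1) * t powr (r - 2) else r * (r - 1) * (r - 2) * t powr (r - 3))"
    have "\<exists>t. (if 1 + z < 1 then 1 + z < t \<and> t < 1 else 1 < t \<and> t < 1 + z) \<and>
       (1 + z) powr r = (\<Sum>m<3. d m 1 / fact m * (1 + z - 1)^m) + d 3 t / fact 3 * (1 + z - 1)^3"
    proof (rule Taylor[where a = "1/2" and b = "3/2"])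
      show "\<forall>m t. m < 3 \<and> 1/2 \<le> t \<and> t \<le> 3/2 \<longrightarrow> DERIV (d m) t :> d (Suc m) t"
      proof (intro allI impI)
        fix m :: nat and t :: real assume a: "m < 3 \<and> 1/2 \<le> t \<and> t \<le> 3/2"
        then have "m = 0 \<or> m = 1 \<or> m = 2" by auto
        then show "DERIV (d m) t :> d (Suc m) t"
        proof (elim disjE)
          assume "m = 0"
          then show ?thesis using a unfolding d_def by (auto intro!: derivative_eq_intros)
        next
          assume "m = 1"
          then show ?thesis using a unfolding d_def by (auto intro!: derivative_eq_intros simp: algebra_simps)
        next
          assume "m = 2"
          then show ?thesis using a unfolding d_def by (auto intro!: derivative_eq_intros simp: algebra_simps)
        qed
      qed
    qed (use 4 in \<open>auto simp: d_def\<close>)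
    then obtain t where t: "if 1 + z < 1 then 1 + z < t \<and> t < 1 else 1 < t \<and> t < 1 + z"
      and eq: "(1 + z) powr r = (\<Sum>m<3. d m 1 / fact m * z^m) + d 3 t / fact 3 * z^3" by auto
    have t2: "1/2 \<le> t" using t 4 by (auto split: if_splits)
    have "t powr (r - 3) \<le> (1/2) powr (r - 3)"
      using t2 r by (intro powr_mono2') auto
    also have "\<dots> = 2 powr (3 - r)" by (simp add: powr_divide powr_minus_divide[symmetric])
    also have "\<dots> \<le> 2 powr 2" using r by (intro powr_mono) auto
    finally have t4: "t powr (r - 3) \<le> 4" by simp
    have c: "\<bar>r * (r - 1) * (r - 2)\<bar> \<le> 3 * 2 * 1"
      unfolding abs_mult using r by (intro mult_mono) auto
    have "d 3 t / fact 3 * z^3 \<le> \<bar>d 3 t / fact 3 * z^3\<bar>" by (rule abs_ge_self)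
    also have "\<dots> = \<bar>r * (r - 1) * (r - 2)\<bar> * t powr (r - 3) / 6 * \<bar>z\<bar>^3"
      by (simp add: d_def abs_mult power_abs fact_numeral)
    also have "\<dots> \<le> 6 * 4 / 6 * \<bar>z\<bar>^3"
      using c t4 by (intro mult_right_mono divide_right_mono mult_mono) auto
    finally have "d 3 t / fact 3 * z^3 \<le> 4 * \<bar>z\<bar>^3" by simp
    moreover have "(\<Sum>m<3. d m 1 / fact m * z^m) = 1 + r * z + r * (r - 1) / 2 * z\<^sup>2"
      by (simp add: d_def numeral_3_eq_3 fact_numeral power2_eq_square)
    moreover have "0 \<le> \<bar>z\<bar>^3" by simp
    ultimately show ?thesis using eq by linarith
  qed
qed

lemma add_powr_le_cubic:
  fixes r u w :: real
  assumes r: "1 \<le> r" "r \<le> 3" and u: "0 < u" "0 \<le> u + w"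
  shows "(u + w) powr r \<le> u powr r + r * u powr (r - 1) * w + r * (r - 1) / 2 * u powr (r - 2) * w\<^sup>2
           + 43 * u powr (r - 3) * \<bar>w\<bar> ^ 3"
proof -
  have "-1 \<le> w / u" using u by (simp add: field_simps)
  note z = one_plus_powr_le_cubic[OF r this]
  have "(u + w) powr r = u powr r * (1 + w / u) powr r"
  proof -
    have "u * (1 + w / u) = u + w" using u by (simp add: field_simps)
    then show ?thesis using u \<open>-1 \<le> w / u\<close> powr_mult[of u "1 + w / u" r] by simp
  qed
  also have "\<dots> \<le> u powr r * (1 + r * (w/u) + r * (r - 1) / 2 * (w/u)\<^sup>2 + 43 * \<bar>w/u\<bar> ^ 3)"
    by (intro mult_left_mono z) auto
  also have "\<dots> = u powr r + r * (u powr r / u) * w + r * (r - 1) / 2 * (u powr r / u^2) * w\<^sup>2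
           + 43 * (u powr r / u ^ 3) * \<bar>w\<bar> ^ 3"
    using u by (simp add: field_simps power_divide abs_divide)
  also have "u powr r / u = u powr (r - 1)" using u by (simp add: powr_diff)
  also have "u powr r / u^2 = u powr (r - 2)" using u by (simp add: powr_diff powr_numeral)
  also have "u powr r / u^3 = u powr (r - 3)" using u by (simp add: powr_diff powr_numeral)
  finally show ?thesis .
qed

text \<open>Designed for a drift part \<open>a\<close> of relative size \<open>A\<close> (order
  \<delta>) and a noise part \<open>m\<close> of relative size \<open>P\<close> (order sqrt
  \<delta>). The coefficient 2r - 1 joins |m|^2 from the first-order term with 4 <y,m>^2 <= 4 u
  |m|^2 from the second-order term: r + 2r(r-1) = r(2r-1), and r = p/2 makes it the p - 1 of the
  coercivity condition. The inner product with \<open>m\<close> is kept exactly because its mean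
  will vanish. In the remainder the product A \<rho> must keep its factor \<open>A\<close>: \<rho>^2
  would be of order \<delta> and would survive summation over the grid.\<close>

lemma norm_sq_powr_step:
  fixes y a m :: "'v::real_inner" and \<eta> r A P :: real
  defines "u \<equiv> \<eta> + (norm y)\<^sup>2" and "\<rho> \<equiv> A + P"
  assumes r: "1 \<le> r" "r \<le> 3" and eta: "0 < \<eta>" and A: "0 \<le> A" "norm a \<le> A * sqrt u"
    and P: "0 \<le> P" "norm m \<le> P * sqrt u"
  shows "(\<eta> + (norm (y + a + m))\<^sup>2) powr r \<le>
     u powr r + r * u powr (r - 1) * (2 * inner y a + 2 * inner (y + a) m + (2 * r - 1) * (norm m)\<^sup>2)
     + 1200 * u powr r * (A * \<rho> + \<rho> ^ 3 + \<rho> ^ 6)"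
proof -
  have u: "0 < u" using eta by (simp add: u_def add_pos_nonneg)
  have yu: "norm y \<le> sqrt u" using eta unfolding u_def by (intro real_le_rsqrt) simp
  have rho: "0 \<le> \<rho>" "A \<le> \<rho>" "P \<le> \<rho>" using A P by (auto simp: \<rho>_def)
  have su: "sqrt u * sqrt u = u" using u by simp
  define w1 where "w1 = 2 * inner y a + (norm (a + m))\<^sup>2"
  define w where "w = 2 * inner y m + w1"
  have exp: "\<eta> + (norm (y + a + m))\<^sup>2 = u + w"
    unfolding w_def w1_def u_def power2_norm_eq_inner by (simp add: inner_simps inner_commute)
  have uw: "0 \<le> u + w" unfolding exp[symmetric] using eta by (simp add: add_nonneg_nonneg)
  have ya: "\<bar>inner y a\<bar> \<le> A * u"
  proof -
    have "\<bar>inner y a\<bar> \<le> norm y * norm a" by (rule Cauchy_Schwarz_ineq2)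
    also have "\<dots> \<le> sqrt u * (A * sqrt u)" using A yu u by (intro mult_mono) auto
    finally show ?thesis using su by (simp add: mult_ac)
  qed
  have ym: "\<bar>inner y m\<bar> \<le> P * u"
  proof -
    have "\<bar>inner y m\<bar> \<le> norm y * norm m" by (rule Cauchy_Schwarz_ineq2)
    also have "\<dots> \<le> sqrt u * (P * sqrt u)" using P yu u by (intro mult_mono) auto
    finally show ?thesis using su by (simp add: mult_ac)
  qed
  have ym2: "(inner y m)\<^sup>2 \<le> u * (norm m)\<^sup>2"
  proof -
    have "\<bar>inner y m\<bar> \<le> sqrt u * norm m"
      using Cauchy_Schwarz_ineq2[of y m] mult_right_mono[OF yu, of "norm m"] by simp
    then have "\<bar>inner y m\<bar>\<^sup>2 \<le> (sqrt u * norm m)\<^sup>2" by (intro power_mono) auto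
    then show ?thesis using u by (simp add: power_mult_distrib)
  qed
  have am: "(norm (a + m))\<^sup>2 \<le> \<rho>\<^sup>2 * u"
  proof -
    have "norm (a + m) \<le> \<rho> * sqrt u" using norm_triangle_ineq[of a m] A P by (simp add: \<rho>_def algebra_simps)
    then have "(norm (a + m))\<^sup>2 \<le> (\<rho> * sqrt u)\<^sup>2" by (intro power_mono) auto
    then show ?thesis using u by (simp add: power_mult_distrib)
  qed
  have a2: "(norm a)\<^sup>2 \<le> A * \<rho> * u"
  proof -
    have "(norm a)\<^sup>2 \<le> (A * sqrt u)\<^sup>2" using A by (intro power_mono) auto
    also have "\<dots> = A * A * u" using u by (simp add: power_mult_distrib power2_eq_square)
    also have "\<dots> \<le> A * \<rho> * u" using A rho u by (intro mult_right_mono mult_left_mono) auto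
    finally show ?thesis .
  qed
  have w1: "\<bar>w1\<bar> \<le> u * (2 * A + \<rho>\<^sup>2)"
  proof -
    have "\<bar>w1\<bar> \<le> 2 * \<bar>inner y a\<bar> + (norm (a + m))\<^sup>2" unfolding w1_def using zero_le_power2[of "norm (a + m)"] by linarith
    then show ?thesis using ya am by (simp add: algebra_simps)
  qed
  have Ar: "A * A \<le> A * \<rho>" "P * A \<le> A * \<rho>" "P * \<rho>\<^sup>2 \<le> \<rho>^3" "A * \<rho>\<^sup>2 \<le> \<rho>^3"
    using mult_left_mono[of A \<rho> A] mult_right_mono[of P \<rho> A] mult_right_mono[of P \<rho> "\<rho>\<^sup>2"] mult_right_mono[of A \<rho> "\<rho>\<^sup>2"] A P rho
    by (auto simp: power3_eq_cube power2_eq_square mult.commute)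
  have r45: "\<rho>^4 \<le> \<rho>^3 + \<rho>^6" "\<rho>^5 \<le> \<rho>^3 + \<rho>^6"
  proof -
    have "\<rho>^k \<le> \<rho>^3 + \<rho>^6" if "3 \<le> k" "k \<le> 6" for k
    proof (cases "\<rho> \<le> 1")
      case True
      then have "\<rho>^k \<le> \<rho>^3" using rho that by (intro power_decreasing) auto
      then show ?thesis using zero_le_power[OF rho(1), of 6] by linarith
    next
      case False
      then have "\<rho>^k \<le> \<rho>^6" using rho that by (intro power_increasing) auto
      then show ?thesis using zero_le_power[OF rho(1), of 3] by linarith
    qed
    then show "\<rho>^4 \<le> \<rho>^3 + \<rho>^6" "\<rho>^5 \<le> \<rho>^3 + \<rho>^6" by auto
  qed
  have w2: "w\<^sup>2 \<le> 4 * u * (norm m)\<^sup>2 + u\<^sup>2 * (12 * (A * \<rho>) + 9 * \<rho>^3 + \<rho>^6)"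
  proof -
    have "w\<^sup>2 = 4 * (inner y m)\<^sup>2 + 4 * (inner y m * w1) + w1\<^sup>2"
      unfolding w_def by (simp add: power2_eq_square algebra_simps)
    also have "inner y m * w1 \<le> \<bar>inner y m\<bar> * \<bar>w1\<bar>" by (simp add: abs_mult[symmetric])
    also have "\<bar>inner y m\<bar> * \<bar>w1\<bar> \<le> (P * u) * (u * (2 * A + \<rho>\<^sup>2))" using ym w1 P u by (intro mult_mono) auto
    also have "w1\<^sup>2 \<le> (u * (2 * A + \<rho>\<^sup>2))\<^sup>2" using w1 by (simp add: abs_le_square_iff[symmetric])
    finally have "w\<^sup>2 \<le> 4 * (inner y m)\<^sup>2 + 4 * ((P * u) * (u * (2 * A + \<rho>\<^sup>2))) + (u * (2 * A + \<rho>\<^sup>2))\<^sup>2" by linarith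
    also have "\<dots> = 4 * (inner y m)\<^sup>2 + u\<^sup>2 * (8 * (P * A) + 4 * (P * \<rho>\<^sup>2) + 4 * (A * A) + 4 * (A * \<rho>\<^sup>2) + \<rho>^4)"
      by (simp add: power2_eq_square algebra_simps power4_eq_xxxx)
    also have "\<dots> \<le> 4 * (u * (norm m)\<^sup>2) + u\<^sup>2 * (12 * (A * \<rho>) + 9 * \<rho>^3 + \<rho>^6)"
    proof (rule add_mono[OF mult_left_mono mult_left_mono])
      show "8 * (P * A) + 4 * (P * \<rho>\<^sup>2) + 4 * (A * A) + 4 * (A * \<rho>\<^sup>2) + \<rho>^4 \<le> 12 * (A * \<rho>) + 9 * \<rho>^3 + \<rho>^6"
        using Ar r45 by linarith
    qed (use ym2 in auto)
    finally show ?thesis by simp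
  qed
  have w3: "\<bar>w\<bar>^3 \<le> u^3 * (27 * (\<rho>^3 + \<rho>^6))"
  proof -
    have "\<bar>w\<bar> \<le> 2 * \<bar>inner y m\<bar> + \<bar>w1\<bar>" unfolding w_def by linarith
    also have "\<dots> \<le> u * (2 * \<rho> + \<rho>\<^sup>2)" using ym w1 by (simp add: \<rho>_def algebra_simps)
    finally have "\<bar>w\<bar>^3 \<le> (u * (2 * \<rho> + \<rho>\<^sup>2))^3" by (intro power_mono) auto
    also have "\<dots> = u^3 * (8 * \<rho>^3 + 12 * \<rho>^4 + 6 * \<rho>^5 + \<rho>^6)"
      by (simp add: power_mult_distrib eval_nat_numeral algebra_simps)
    also have "\<dots> \<le> u^3 * (27 * (\<rho>^3 + \<rho>^6))"
    proof (intro mult_left_mono)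
      show "8 * \<rho>^3 + 12 * \<rho>^4 + 6 * \<rho>^5 + \<rho>^6 \<le> 27 * (\<rho>^3 + \<rho>^6)"
        using r45 zero_le_power[OF rho(1), of 3] zero_le_power[OF rho(1), of 6] unfolding distrib_left by linarith
    qed (use u in auto)
    finally show ?thesis .
  qed
  have wl: "w \<le> 2 * inner y a + 2 * inner (y + a) m + (norm m)\<^sup>2 + A * \<rho> * u"
    using a2 unfolding w_def w1_def power2_norm_eq_inner by (simp add: inner_simps inner_commute)
  have p2: "u powr (r - 2) * u = u powr (r - 1)" "u powr (r - 1) * u = u powr r"
    "u powr (r - 2) * u\<^sup>2 = u powr r" "u powr (r - 3) * u^3 = u powr r"
    using u by (simp_all add: powr_diff powr_numeral power2_eq_square power3_eq_cube)
  have "(u + w) powr r \<le> u powr r + r * u powr (r - 1) * w + r * (r - 1) / 2 * u powr (r - 2) * w\<^sup>2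
           + 43 * u powr (r - 3) * \<bar>w\<bar> ^ 3"
    by (rule add_powr_le_cubic[OF r u uw])
  also have "\<dots> \<le> u powr r + r * u powr (r - 1) * (2 * inner y a + 2 * inner (y + a) m + (norm m)\<^sup>2 + A * \<rho> * u)
      + r * (r - 1) / 2 * u powr (r - 2) * (4 * u * (norm m)\<^sup>2 + u\<^sup>2 * (12 * (A * \<rho>) + 9 * \<rho>^3 + \<rho>^6))
           + 43 * u powr (r - 3) * (u^3 * (27 * (\<rho>^3 + \<rho>^6)))"
    using r wl w2 w3 by (intro add_mono mult_left_mono order_refl) auto
  also have "\<dots> = u powr r + r * u powr (r - 1) * (2 * inner y a + 2 * inner (y + a) m + (norm m)\<^sup>2)
      + r * (u powr (r - 1) * u) * (A * \<rho>)
      + r * (r - 1) * 2 * (u powr (r - 2) * u) * (norm m)\<^sup>2 + r * (r - 1) / 2 * (u powr (r - 2) * u\<^sup>2) * (12 * (A * \<rho>) + 9 * \<rho>^3 + \<rho>^6)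
           + 1161 * (u powr (r - 3) * u^3) * (\<rho>^3 + \<rho>^6)"
    by (simp add: field_simps)
  also have "\<dots> = u powr r + r * u powr (r - 1) * (2 * inner y a + 2 * inner (y + a) m + (2 * r - 1) * (norm m)\<^sup>2)
      + u powr r * (r * (A * \<rho>) + r * (r - 1) / 2 * (12 * (A * \<rho>) + 9 * \<rho>^3 + \<rho>^6) + 1161 * (\<rho>^3 + \<rho>^6))"
    unfolding p2 by (simp add: algebra_simps)
  also have "\<dots> \<le> u powr r + r * u powr (r - 1) * (2 * inner y a + 2 * inner (y + a) m + (2 * r - 1) * (norm m)\<^sup>2)
      + u powr r * (1200 * (A * \<rho> + \<rho> ^ 3 + \<rho> ^ 6))"
  proof (intro add_left_mono mult_left_mono)
    have rr: "r * (r - 1) / 2 \<le> 3" using r mult_mono[of r 3 "r - 1" 2] by simp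
    have z: "0 \<le> A * \<rho>" "0 \<le> \<rho>^3" "0 \<le> \<rho>^6" using A rho by auto
    have "r * (A * \<rho>) \<le> 3 * (A * \<rho>)" using r z by (intro mult_right_mono)
    moreover have "r * (r - 1) / 2 * (12 * (A * \<rho>) + 9 * \<rho>^3 + \<rho>^6) \<le> 3 * (12 * (A * \<rho>) + 9 * \<rho>^3 + \<rho>^6)"
      using z rr by (intro mult_right_mono) auto
    moreover have "X + Y + 1161 * (b + c) \<le> 1200 * (a + b + c)"
      if "X \<le> 3 * a" "Y \<le> 3 * (12 * a + 9 * b + c)" "0 \<le> a" "0 \<le> b" "0 \<le> c" for X Y a b c :: real
      using that by argo
    ultimately show "r * (A * \<rho>) + r * (r - 1) / 2 * (12 * (A * \<rho>) + 9 * \<rho>^3 + \<rho>^6) + 1161 * (\<rho>^3 + \<rho>^6)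
      \<le> 1200 * (A * \<rho> + \<rho> ^ 3 + \<rho> ^ 6)" using z by blast
  qed auto
  finally show ?thesis unfolding exp by (simp add: mult_ac)
qed

section \<open>Brownian increments\<close>

lemma norm_pow6_le: "norm (w :: real^'m) ^ 6 \<le> real CARD('m) ^ 6 * (\<Sum>i\<in>UNIV. (w $ i) ^ 6)"
proof -
  have "Max (range (\<lambda>i. \<bar>w $ i\<bar>)) \<in> range (\<lambda>i. \<bar>w $ i\<bar>)" by (intro Max_in) auto
  then obtain k where "Max (range (\<lambda>i. \<bar>w $ i\<bar>)) = \<bar>w $ k\<bar>" by (rule imageE)
  then have k: "\<bar>w $ i\<bar> \<le> \<bar>w $ k\<bar>" for i by (metis Max_ge finite finite_imageI rangeI)
  have "norm w \<le> (\<Sum>i\<in>UNIV. \<bar>w $ i\<bar>)" by (rule norm_le_l1_cart)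
  also have "\<dots> \<le> real CARD('m) * \<bar>w $ k\<bar>" by (intro sum_bounded_above k)
  finally have "norm w ^ 6 \<le> (real CARD('m) * \<bar>w $ k\<bar>) ^ 6" by (intro power_mono) auto
  also have "\<dots> = real CARD('m) ^ 6 * (w $ k) ^ 6" by (simp add: power_mult_distrib power_even_abs)
  also have "\<dots> \<le> real CARD('m) ^ 6 * (\<Sum>i\<in>UNIV. (w $ i) ^ 6)"
    by (intro mult_left_mono member_le_sum) auto
  finally show ?thesis .
qed

lemma norm_matrix_vector_sq: "(norm ((A :: real^'m^'d) *v w))\<^sup>2 = (\<Sum>i\<in>UNIV. (inner (A $ i) w)\<^sup>2)"
  unfolding power2_norm_eq_inner
  by (simp add: inner_vec_def[of "A *v w"] matrix_vector_mult_def inner_vec_def power2_eq_square)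

lemma norm_matrix_sq: "(norm (A :: real^'m^'d))\<^sup>2 = (\<Sum>i\<in>UNIV. (norm (A $ i))\<^sup>2)"
  unfolding power2_norm_eq_inner by (simp add: inner_vec_def[of A])

lemma norm_matrix_vector_le: "norm ((A :: real^'m^'d) *v w) \<le> norm A * norm w"
proof (rule power2_le_imp_le)
  have "(norm (A *v w))\<^sup>2 \<le> (\<Sum>i\<in>UNIV. (norm (A $ i) * norm w)\<^sup>2)"
    unfolding norm_matrix_vector_sq by (intro sum_mono) (metis Cauchy_Schwarz_ineq2 abs_ge_zero power2_abs power_mono)
  then show "(norm (A *v w))\<^sup>2 \<le> (norm A * norm w)\<^sup>2"
    by (simp add: power_mult_distrib norm_matrix_sq sum_distrib_right)
qed auto

lemma norm_sq_powr_half: "((norm v)\<^sup>2) powr (r / 2) = norm v powr r"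
  by (cases "norm v = 0") (auto simp: powr_powr simp flip: powr_numeral)

lemma add_power_le: "0 \<le> x \<Longrightarrow> 0 \<le> y \<Longrightarrow> (x + y) ^ k \<le> 2 ^ k * (x ^ k + y ^ k)" for x y :: real
proof -
  assume a: "0 \<le> x" "0 \<le> y"
  have "(x + y) ^ k \<le> (2 * max x y) ^ k" using a by (intro power_mono) auto
  also have "\<dots> = 2 ^ k * (max x y) ^ k" by (simp add: power_mult_distrib)
  also have "(max x y) ^ k \<le> x ^ k + y ^ k" using a by (auto simp: max_def)
  finally show ?thesis by simp
qed

lemma borel_measurable_matrix_vector_mult [measurable (raw)]:
  fixes A :: "'a \<Rightarrow> real^'m^'d"
  assumes "A \<in> borel_measurable N" "v \<in> borel_measurable N"
  shows "(\<lambda>x. A x *v v x) \<in> borel_measurable N"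
proof -
  have "continuous_on UNIV (\<lambda>p. fst p *v snd p :: real^'d)" for p :: "(real^'m^'d) \<times> (real^'m)"
    unfolding matrix_vector_mult_def by (intro continuous_intros continuous_on_vec_lambda)
  from borel_measurable_continuous_Pair[OF assms this] show ?thesis by simp
qed

lemma usual_filtration_space: "usual_filtration M F \<Longrightarrow> 0 \<le> t \<Longrightarrow> space (F t) = space M \<and> sets (F t) \<subseteq> sets M"
  unfolding usual_filtration_def by (elim conjE) metis

lemma usual_filtration_mono: "usual_filtration M F \<Longrightarrow> 0 \<le> s \<Longrightarrow> s \<le> t \<Longrightarrow> sets (F s) \<subseteq> sets (F t)"
  unfolding usual_filtration_def by (elim conjE) metis

section \<open>Independence and moments of Brownian increments\<close>

locale brownian = prob_space M for M :: "'a measure" +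
  fixes F :: "real \<Rightarrow> 'a measure" and B :: "real \<Rightarrow> 'a \<Rightarrow> real^'m"
  assumes filt: "usual_filtration M F" and BM: "std_brownian_motion M F B"
begin

lemma space_F: "0 \<le> t \<Longrightarrow> space (F t) = space M"
  using usual_filtration_space[OF filt] by blast

lemma sets_F_M: "0 \<le> t \<Longrightarrow> A \<in> sets (F t) \<Longrightarrow> A \<in> sets M"
  using usual_filtration_space[OF filt] by blast

lemma sets_F_mono: "0 \<le> s \<Longrightarrow> s \<le> t \<Longrightarrow> A \<in> sets (F s) \<Longrightarrow> A \<in> sets (F t)"
  using usual_filtration_mono[OF filt] by blast

lemma subalg: "0 \<le> t \<Longrightarrow> subalgebra M (F t)"
  unfolding subalgebra_def using space_F sets_F_M by blast

lemma measurable_F_mono: "f \<in> measurable (F s) N \<Longrightarrow> 0 \<le> s \<Longrightarrow> s \<le> t \<Longrightarrow> f \<in> measurable (F t) N"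
  using measurable_from_subalg[of "F t" "F s" f N] sets_F_mono[of s t] space_F[of s] space_F[of t]
  unfolding subalgebra_def by auto

lemma measurable_F_M: "f \<in> measurable (F t) N \<Longrightarrow> 0 \<le> t \<Longrightarrow> f \<in> measurable M N"
  by (rule measurable_from_subalg[OF subalg])

lemma B_F: "0 \<le> t \<Longrightarrow> B t \<in> borel_measurable (F t)"
  using BM unfolding std_brownian_motion_def by blast

lemma B_M: "0 \<le> t \<Longrightarrow> B t \<in> borel_measurable M"
  using B_F measurable_F_M by blast

lemma B_cont: "\<omega> \<in> space M \<Longrightarrow> continuous_on {0..} (\<lambda>t. B t \<omega>)"
  using BM unfolding std_brownian_motion_def by blast

definition law :: "real \<Rightarrow> real \<Rightarrow> (real^'m) measure" where
  "law s t = distr M borel (\<lambda>\<omega>. B t \<omega> - B s \<omega>)"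

lemma incr_M: "0 \<le> s \<Longrightarrow> s \<le> t \<Longrightarrow> (\<lambda>\<omega>. B t \<omega> - B s \<omega>) \<in> borel_measurable M"
  using B_M[of s] B_M[of t] by simp

lemma prob_space_law: "0 \<le> s \<Longrightarrow> s \<le> t \<Longrightarrow> prob_space (law s t)"
  unfolding law_def by (rule prob_space_distr[OF incr_M])

lemma space_law [simp]: "space (law s t) = UNIV" and sets_law [simp, measurable_cong]: "sets (law s t) = sets borel"
  by (auto simp: law_def)

text \<open>This replaces conditional expectation given \<open>F s\<close>. The definition of
  Brownian motion supplies the product formula for a set of \<open>F s\<close> and a Borel set of
  increments. These rectangles determine the joint law of \<omega> and the increment on
  \<open>F s\<close> times Borel, which is therefore a product measure, and Tonelli's theorem does
  the rest.\<close>

lemma nn_integral_indep: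
  assumes st: "0 \<le> s" "s < t"
    and Phi: "(\<lambda>p. \<Phi> (fst p) (snd p)) \<in> borel_measurable (F s \<Otimes>\<^sub>M (borel :: (real^'m) measure))"
  shows "(\<integral>\<^sup>+\<omega>. \<Phi> \<omega> (B t \<omega> - B s \<omega>) \<partial>M) = (\<integral>\<^sup>+\<omega>. \<integral>\<^sup>+w. \<Phi> \<omega> w \<partial>law s t \<partial>M)"
proof -
  let ?N = "restr_to_subalg M (F s)" and ?W = "\<lambda>\<omega>. B t \<omega> - B s \<omega>"
  have sub: "subalgebra M (F s)" using st subalg by simp
  have W: "?W \<in> borel_measurable M" using st by (intro incr_M) auto
  have id: "(\<lambda>\<omega>. \<omega>) \<in> measurable M (F s)" by (rule measurable_from_subalg[OF sub measurable_ident_sets[OF refl]])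
  have pair: "(\<lambda>\<omega>. (\<omega>, ?W \<omega>)) \<in> measurable M (F s \<Otimes>\<^sub>M borel)" using id W by measurable
  interpret law: prob_space "law s t" using st by (intro prob_space_law) auto
  interpret N: prob_space ?N by (rule prob_space_restr_to_subalg[OF sub]) unfold_locales
  have eq: "?N \<Otimes>\<^sub>M law s t = distr M (F s \<Otimes>\<^sub>M borel) (\<lambda>\<omega>. (\<omega>, ?W \<omega>))"
  proof (rule pair_measure_eqI)
    fix A E assume A: "A \<in> sets ?N" and E: "E \<in> sets (law s t)"
    have A': "A \<in> sets (F s)" using A by (simp add: sets_restr_to_subalg[OF sub])
    have AM: "A \<in> sets M" using A' sets_F_M st by simp
    have "{\<omega> \<in> space M. ?W \<omega> \<in> E} \<in> sets M" using W E by measurable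
    moreover have "measure M (A \<inter> {\<omega>\<in>space M. ?W \<omega> \<in> E}) = measure M A * measure M {\<omega>\<in>space M. ?W \<omega> \<in> E}"
      using BM st A' E unfolding std_brownian_motion_def by auto
    moreover have "(\<lambda>\<omega>. (\<omega>, ?W \<omega>)) -` (A \<times> E) \<inter> space M = A \<inter> {\<omega>\<in>space M. ?W \<omega> \<in> E}"
      by auto
    moreover have "?W -` E \<inter> space M = {\<omega>\<in>space M. ?W \<omega> \<in> E}" by auto
    ultimately show "emeasure ?N A * emeasure (law s t) E
        = emeasure (distr M (F s \<Otimes>\<^sub>M borel) (\<lambda>\<omega>. (\<omega>, ?W \<omega>))) (A \<times> E)"
      using A' E AM W pair
      by (simp add: emeasure_restr_to_subalg[OF sub A'] law_def emeasure_distr emeasure_eq_measure ennreal_mult)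
  next
    show "sets (?N \<Otimes>\<^sub>M law s t) = sets (distr M (F s \<Otimes>\<^sub>M borel) (\<lambda>\<omega>. (\<omega>, ?W \<omega>)))"
      by (simp, rule sets_pair_measure_cong) (simp_all add: sets_restr_to_subalg[OF sub])
  qed (unfold_locales)
  have Phi': "(\<lambda>p. \<Phi> (fst p) (snd p)) \<in> borel_measurable (?N \<Otimes>\<^sub>M law s t)"
    using Phi by (simp add: eq)
  have "(\<integral>\<^sup>+\<omega>. \<Phi> \<omega> (?W \<omega>) \<partial>M) = (\<integral>\<^sup>+p. \<Phi> (fst p) (snd p) \<partial>distr M (F s \<Otimes>\<^sub>M borel) (\<lambda>\<omega>. (\<omega>, ?W \<omega>)))"
    using Phi pair by (subst nn_integral_distr) auto
  also have "\<dots> = (\<integral>\<^sup>+\<omega>. \<integral>\<^sup>+w. \<Phi> \<omega> w \<partial>law s t \<partial>?N)"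
    unfolding eq[symmetric] using law.nn_integral_fst[OF Phi'] by simp
  finally have 1: "(\<integral>\<^sup>+\<omega>. \<Phi> \<omega> (?W \<omega>) \<partial>M) = (\<integral>\<^sup>+\<omega>. \<integral>\<^sup>+w. \<Phi> \<omega> w \<partial>law s t \<partial>?N)" .
  have "(\<lambda>\<omega>. \<integral>\<^sup>+w. \<Phi> \<omega> w \<partial>law s t) \<in> borel_measurable ?N"
    using law.borel_measurable_nn_integral_fst[OF Phi'] by simp
  then have m: "(\<lambda>\<omega>. \<integral>\<^sup>+w. \<Phi> \<omega> w \<partial>law s t) \<in> borel_measurable (F s)"
    using measurable_cong_sets[OF sets_restr_to_subalg[OF sub] refl] by blast
  show "(\<integral>\<^sup>+\<omega>. \<Phi> \<omega> (?W \<omega>) \<partial>M) = (\<integral>\<^sup>+\<omega>. \<integral>\<^sup>+w. \<Phi> \<omega> w \<partial>law s t \<partial>M)"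
    unfolding 1 by (rule nn_integral_subalgebra2[OF sub m])
qed

text \<open>The law of an increment is given only through its nonzero linear functionals, so all
  moments are read off the one-dimensional normal distribution, and c = 0 is settled separately. The
  factor 15 is 6! / (2^3 3!).\<close>

lemma inner_moments:
  assumes st: "0 \<le> s" "s < t"
  shows "integrable (law s t) (\<lambda>w. inner c w ^ k)"
    and "(\<integral>w. inner c w \<partial>law s t) = 0"
    and "(\<integral>w. (inner c w)\<^sup>2 \<partial>law s t) = (norm c)\<^sup>2 * (t - s)"
    and "(\<integral>w. inner c w ^ 6 \<partial>law s t) = 15 * norm c ^ 6 * (t - s) ^ 3"
proof -
  let ?W = "\<lambda>\<omega>. B t \<omega> - B s \<omega>"
  interpret law: prob_space "law s t" using st by (intro prob_space_law) auto
  have W: "?W \<in> borel_measurable M" using st by (intro incr_M) auto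
  have dist: "integrable (law s t) (\<lambda>w. inner c w ^ k) \<and>
    (\<integral>w. inner c w ^ k \<partial>law s t) = (\<integral>x. normal_density 0 (norm c * sqrt (t - s)) x * (x - 0) ^ k \<partial>lborel)"
    if c: "c \<noteq> 0" for k
  proof -
    let ?\<sigma> = "norm c * sqrt (t - s)"
    have \<sigma>: "0 < ?\<sigma>" using c st by simp
    have d: "distributed M lborel (\<lambda>\<omega>. inner c (?W \<omega>)) (\<lambda>y. ennreal (normal_density 0 ?\<sigma> y))"
      using BM st c unfolding std_brownian_motion_def by blast
    have i: "integrable lborel (\<lambda>x. normal_density 0 ?\<sigma> x * (x - 0) ^ k)"
      by (rule integrable_normal_moment[OF \<sigma>])
    have "integrable M (\<lambda>\<omega>. inner c (?W \<omega>) ^ k)"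
      using distributed_integrable[OF d, of "\<lambda>x. x ^ k"] i by simp
    moreover have "(\<integral>\<omega>. inner c (?W \<omega>) ^ k \<partial>M) = (\<integral>x. normal_density 0 ?\<sigma> x * (x - 0) ^ k \<partial>lborel)"
      using distributed_integral[OF d, of "\<lambda>x. x ^ k"] by simp
    ultimately show ?thesis unfolding law_def using W by (simp add: integrable_distr_eq integral_distr)
  qed
  show "integrable (law s t) (\<lambda>w. inner c w ^ k)"
    using dist by (cases "c = 0") (auto simp: power_0_left)
  have s: "c \<noteq> 0 \<Longrightarrow> 0 < norm c * sqrt (t - s)" using st by simp
  show "(\<integral>w. inner c w \<partial>law s t) = 0"
    using dist[of 1] integral_normal_moment_odd[OF s, of 0 0] by (cases "c = 0") auto
  show "(\<integral>w. (inner c w)\<^sup>2 \<partial>law s t) = (norm c)\<^sup>2 * (t - s)"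
    using dist[of 2] integral_normal_moment_even[OF s, of 0 1] st
    by (cases "c = 0") (auto simp: power_mult_distrib fact_numeral)
  have fact_eq: "fact (2 * 3) / ((2 / x\<^sup>2) ^ 3 * fact 3) = 15 * x ^ 6" if "0 < x" for x :: real
    using that by (simp add: fact_numeral power_divide field_simps flip: power_mult)
  have "(sqrt (t - s)) ^ 6 = ((sqrt (t - s))\<^sup>2) ^ 3" by (simp flip: power_mult)
  then have "(sqrt (t - s)) ^ 6 = (t - s) ^ 3" using st by simp
  then show "(\<integral>w. inner c w ^ 6 \<partial>law s t) = 15 * norm c ^ 6 * (t - s) ^ 3"
    using dist[of 6] integral_normal_moment_even[OF s, of 0 3] fact_eq[OF s]
    by (cases "c = 0") (auto simp: power_mult_distrib)
qed

text \<open>The number 15 m^7 is m^6 from \<open>norm_pow6_le\<close> times m coordinates of sixth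
  moment 15; the added 1 comes from bounding x^z by 1 + x^6.\<close>

definition gk :: real where "gk = 15 * real CARD('m) ^ 7 + 1"

lemma gk_ge_1: "1 \<le> gk" by (simp add: gk_def)

text \<open>The inequality x^z <= 1 + x^6 is applied to x = |w| / sqrt(t - s), that is, after
  scaling to unit variance. One constant thus serves all exponents z <= 6 and every step
  length.\<close>

lemma norm_moment:
  assumes st: "0 \<le> s" "s < t" and z: "0 \<le> z" "z \<le> 6"
  shows "integrable (law s t) (\<lambda>w. norm w powr z)"
    and "(\<integral>w. norm w powr z \<partial>law s t) \<le> gk * sqrt (t - s) powr z"
proof -
  interpret law: prob_space "law s t" using st by (intro prob_space_law) auto
  let ?\<sigma> = "sqrt (t - s)"
  have \<sigma>: "0 < ?\<sigma>" using st by simp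
  have s6: "?\<sigma> ^ 6 = (t - s) ^ 3"
  proof -
    have "?\<sigma> ^ 6 = (?\<sigma>\<^sup>2) ^ 3" by (simp flip: power_mult)
    then show ?thesis using st by simp
  qed
  define S where "S = (\<lambda>w::real^'m. real CARD('m) ^ 6 * (\<Sum>i\<in>UNIV. (inner (axis i 1) w) ^ 6))"
  have Si: "integrable (law s t) S" unfolding S_def
    by (intro integrable_mult_right Bochner_Integration.integrable_sum inner_moments(1)[OF st])
  have SI: "(\<integral>w. S w \<partial>law s t) = 15 * real CARD('m) ^ 7 * (t - s) ^ 3"
  proof -
    have c7: "real CARD('m) ^ 7 = real CARD('m) ^ 6 * real CARD('m)" by (simp add: eval_nat_numeral)
    show ?thesis unfolding S_def c7 by (simp add: inner_moments st integral_sum)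
  qed
  let ?R = "\<lambda>w. ?\<sigma> powr z * (1 + S w / ?\<sigma> ^ 6)"
  have Ri: "integrable (law s t) ?R" using Si by auto
  have le: "norm w powr z \<le> ?R w" for w :: "real^'m"
  proof -
    have S: "norm w ^ 6 \<le> S w" unfolding S_def using norm_pow6_le[of w] by (simp add: inner_axis')
    let ?a = "norm w / ?\<sigma>"
    have "?a powr z \<le> 1 + ?a ^ 6"
    proof (cases "?a \<le> 1")
      case True
      then have "?a powr z \<le> 1" using z \<sigma> by (intro powr_le1) auto
      moreover have "0 \<le> ?a ^ 6" by simp
      ultimately show ?thesis by linarith
    next
      case False
      then have "?a powr z \<le> ?a powr 6" using z by (intro powr_mono) auto
      then show ?thesis using False \<sigma> by (simp add: powr_numeral)
    qed
    also have "\<dots> \<le> 1 + S w / ?\<sigma> ^ 6"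
      using S \<sigma> by (simp add: power_divide divide_right_mono)
    finally have "?\<sigma> powr z * ?a powr z \<le> ?R w" by (intro mult_left_mono) auto
    moreover have "?\<sigma> powr z * ?a powr z = norm w powr z" using \<sigma> powr_mult[of "?\<sigma>" ?a z] by simp
    ultimately show ?thesis by simp
  qed
  show i: "integrable (law s t) (\<lambda>w. norm w powr z)"
    by (rule Bochner_Integration.integrable_bound[OF Ri]) (use le in \<open>auto intro: order_trans[OF _ abs_ge_self]\<close>)
  have "(\<integral>w. norm w powr z \<partial>law s t) \<le> (\<integral>w. ?R w \<partial>law s t)"
    by (rule integral_mono[OF i Ri le])
  also have "\<dots> = ?\<sigma> powr z * (1 + 15 * real CARD('m) ^ 7 * (t - s) ^ 3 / ?\<sigma> ^ 6)"
    using Si SI law.prob_space by simp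
  also have "\<dots> = gk * ?\<sigma> powr z" using st by (simp add: s6 gk_def)
  finally show "(\<integral>w. norm w powr z \<partial>law s t) \<le> gk * ?\<sigma> powr z" .
qed

lemma norm_moment_nat:
  assumes st: "0 \<le> s" "s < t" and k: "0 < k" "k \<le> 6"
  shows "integrable (law s t) (\<lambda>w. norm w ^ k)"
    and "(\<integral>w. norm w ^ k \<partial>law s t) \<le> gk * sqrt (t - s) ^ k"
proof -
  \<comment> \<open>At w = 0 the exponent must be positive: \<open>0 powr 0\<close> is 0, whereas
    \<open>0 ^ 0\<close> is 1.\<close>
  have "norm w powr real k = norm w ^ k" for w :: "real^'m"
    using k by (cases "w = 0") (auto simp: powr_realpow)
  then show "integrable (law s t) (\<lambda>w. norm w ^ k)" "(\<integral>w. norm w ^ k \<partial>law s t) \<le> gk * sqrt (t - s) ^ k"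
    using norm_moment[OF st, of "real k"] k st by (auto simp: powr_realpow)
qed

text \<open>Averages \<open>norm_sq_powr_step\<close> over the increment with y, a, b held fixed:
  the linear term has mean zero, and |b w|^2 has mean |b|^2 \<delta> in the trace norm. The constant
  is 153600 = 1200 * 128.\<close>

lemma one_step:
  fixes y a :: "real^'d" and b :: "real^'m^'d" and \<eta> r \<alpha> \<beta> :: real
  assumes st: "0 \<le> s" "s < t" and r: "1 \<le> r" "r \<le> 3" and eta: "0 < \<eta>"
  defines "u \<equiv> \<eta> + (norm y)\<^sup>2" and "\<delta> \<equiv> t - s" and "\<theta> \<equiv> \<alpha> * (t - s) + \<beta> * sqrt (t - s)"
  assumes al: "0 \<le> \<alpha>" "norm a \<le> \<alpha> * sqrt u" and be: "0 \<le> \<beta>" "norm b \<le> \<beta> * sqrt u"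
  shows "(\<integral>\<^sup>+w. ennreal ((\<eta> + (norm (y + \<delta> *\<^sub>R a + b *v w))\<^sup>2) powr r) \<partial>law s t) \<le>
     ennreal (u powr r + r * u powr (r - 1) * ((2 * inner y a + (2 * r - 1) * (norm b)\<^sup>2) * \<delta>)
       + 153600 * gk * u powr r * (\<alpha> * \<delta> * \<theta> + \<theta> ^ 3 + \<theta> ^ 6))"
proof -
  interpret law: prob_space "law s t" using st by (intro prob_space_law) auto
  have d: "0 < \<delta>" using st by (simp add: \<delta>_def)
  have u: "0 < u" using eta by (simp add: u_def add_pos_nonneg)
  define A where "A = \<alpha> * \<delta>"
  have A0: "0 \<le> A" using al d by (simp add: A_def)
  define \<rho> where "\<rho> = (\<lambda>w::real^'m. A + \<beta> * norm w)"
  define Rw where "Rw = (\<lambda>w::real^'m. A * \<rho> w + \<rho> w ^ 3 + \<rho> w ^ 6)"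
  define G where "G = (\<lambda>w. u powr r + r * u powr (r - 1) * (2 * inner y (\<delta> *\<^sub>R a)
      + 2 * inner (y + \<delta> *\<^sub>R a) (b *v w) + (2 * r - 1) * (norm (b *v w))\<^sup>2) + 1200 * u powr r * Rw w)"
  have le: "(\<eta> + (norm (y + \<delta> *\<^sub>R a + b *v w))\<^sup>2) powr r \<le> G w" for w
    unfolding G_def Rw_def \<rho>_def u_def
  proof (rule norm_sq_powr_step[OF r eta])
    show "norm (\<delta> *\<^sub>R a) \<le> A * sqrt (\<eta> + (norm y)\<^sup>2)"
      using mult_left_mono[OF al(2), of \<delta>] d by (simp add: A_def u_def mult_ac)
    show "norm (b *v w) \<le> \<beta> * norm w * sqrt (\<eta> + (norm y)\<^sup>2)"
      using norm_matrix_vector_le[of b w] mult_right_mono[OF be(2), of "norm w"] by (simp add: u_def mult_ac)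
  qed (use A0 be in auto)
  have lin: "inner (y + \<delta> *\<^sub>R a) (b *v w) = inner ((y + \<delta> *\<^sub>R a) v* b) w" for w
    by (simp add: dot_lmul_matrix)
  have li: "integrable (law s t) (\<lambda>w. inner c w)" for c using inner_moments(1)[OF st, of c 1] by simp
  have l1: "integrable (law s t) (\<lambda>w. inner (y + \<delta> *\<^sub>R a) (b *v w))"
    "(\<integral>w. inner (y + \<delta> *\<^sub>R a) (b *v w) \<partial>law s t) = 0"
    unfolding lin by (auto intro: li inner_moments st)
  have l2: "integrable (law s t) (\<lambda>w. (norm (b *v w))\<^sup>2)"
    "(\<integral>w. (norm (b *v w))\<^sup>2 \<partial>law s t) = (norm b)\<^sup>2 * \<delta>"
    unfolding norm_matrix_vector_sq
    by (auto simp: inner_moments[OF st] integral_sum norm_matrix_sq sum_distrib_right \<delta>_def)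
  have sd: "A \<le> \<theta>" "\<beta> * sqrt \<delta> \<le> \<theta>" using al be d by (auto simp: A_def \<theta>_def \<delta>_def)
  have th: "0 \<le> \<theta>" using A0 sd by linarith
  \<comment> \<open>Here 128 = 2^6 * 2: the first factor splits the power of a sum, the second
    merges the deterministic and the random part, both at most
    \<open>gk * \<theta> ^ k\<close>.\<close>
  have pk: "integrable (law s t) (\<lambda>w. \<rho> w ^ k) \<and> (\<integral>w. \<rho> w ^ k \<partial>law s t) \<le> 128 * gk * \<theta> ^ k"
    if k: "0 < k" "k \<le> 6" for k
  proof -
    have rn: "0 \<le> \<rho> w" for w using A0 be by (simp add: \<rho>_def)
    let ?R = "\<lambda>w::real^'m. 2 ^ k * (A ^ k + \<beta> ^ k * norm w ^ k)"
    have Ri: "integrable (law s t) ?R" using norm_moment_nat[OF st k] by auto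
    have le: "\<rho> w ^ k \<le> ?R w" for w
      using add_power_le[of A "\<beta> * norm w" k] A0 be by (simp add: \<rho>_def power_mult_distrib)
    have i: "integrable (law s t) (\<lambda>w. \<rho> w ^ k)"
      by (rule Bochner_Integration.integrable_bound[OF Ri])
        (use le rn in \<open>auto simp: \<rho>_def intro: order_trans[OF _ abs_ge_self]\<close>)
    have "\<beta> ^ k * (\<integral>w. norm w ^ k \<partial>law s t) \<le> \<beta> ^ k * (gk * sqrt \<delta> ^ k)"
      using norm_moment_nat(2)[OF st k] be by (intro mult_left_mono) (auto simp: \<delta>_def)
    also have "\<dots> = gk * (\<beta> * sqrt \<delta>) ^ k" by (simp add: power_mult_distrib)
    also have "\<dots> \<le> gk * \<theta> ^ k" using sd gk_ge_1 be d by (intro mult_left_mono power_mono) auto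
    finally have bI: "\<beta> ^ k * (\<integral>w. norm w ^ k \<partial>law s t) \<le> gk * \<theta> ^ k" .
    have "(\<integral>w. \<rho> w ^ k \<partial>law s t) \<le> (\<integral>w. ?R w \<partial>law s t)" by (rule integral_mono[OF i Ri le])
    also have "\<dots> = 2 ^ k * (A ^ k + \<beta> ^ k * (\<integral>w. norm w ^ k \<partial>law s t))"
      using norm_moment_nat(1)[OF st k] law.prob_space by simp
    also have "\<dots> \<le> 2 ^ 6 * (\<theta> ^ k + gk * \<theta> ^ k)"
      by (rule mult_mono[OF power_increasing add_mono[OF _ bI]])
        (use k sd A0 be th in \<open>auto intro!: power_mono add_nonneg_nonneg mult_nonneg_nonneg integral_nonneg_AE\<close>)
    also have "\<dots> \<le> 2 ^ 6 * (gk * \<theta> ^ k + gk * \<theta> ^ k)"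
      using gk_ge_1 th mult_right_mono[of 1 gk "\<theta> ^ k"] by simp
    finally show ?thesis using i by simp
  qed
  have Rwi: "integrable (law s t) Rw" "(\<integral>w. Rw w \<partial>law s t) \<le> 128 * gk * (A * \<theta> + \<theta> ^ 3 + \<theta> ^ 6)"
  proof -
    show "integrable (law s t) Rw" unfolding Rw_def using pk[of 1] pk[of 3] pk[of 6] by auto
    have "(\<integral>w. Rw w \<partial>law s t) = A * (\<integral>w. \<rho> w ^ 1 \<partial>law s t) + (\<integral>w. \<rho> w ^ 3 \<partial>law s t) + (\<integral>w. \<rho> w ^ 6 \<partial>law s t)"
      unfolding Rw_def using pk[of 1] pk[of 3] pk[of 6] by simp
    also have "\<dots> \<le> A * (128 * gk * \<theta> ^ 1) + 128 * gk * \<theta> ^ 3 + 128 * gk * \<theta> ^ 6"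
      using pk[of 1] pk[of 3] pk[of 6] A0 by (intro add_mono mult_left_mono) auto
    finally show "(\<integral>w. Rw w \<partial>law s t) \<le> 128 * gk * (A * \<theta> + \<theta> ^ 3 + \<theta> ^ 6)" by (simp add: algebra_simps)
  qed
  have Gi: "integrable (law s t) G" unfolding G_def using l1 l2 Rwi by auto
  have G0: "0 \<le> G w" for w by (rule order_trans[OF _ le]) simp
  have "(\<integral>\<^sup>+w. ennreal ((\<eta> + (norm (y + \<delta> *\<^sub>R a + b *v w))\<^sup>2) powr r) \<partial>law s t) \<le> (\<integral>\<^sup>+w. ennreal (G w) \<partial>law s t)"
    by (intro nn_integral_mono ennreal_leI le)
  also have "\<dots> = ennreal (\<integral>w. G w \<partial>law s t)" by (rule nn_integral_eq_integral[OF Gi]) (use G0 in auto)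
  also have "(\<integral>w. G w \<partial>law s t) = u powr r + r * u powr (r - 1) * (2 * inner y (\<delta> *\<^sub>R a) + (2 * r - 1) * ((norm b)\<^sup>2 * \<delta>))
     + 1200 * u powr r * (\<integral>w. Rw w \<partial>law s t)"
    unfolding G_def using l1 l2 Rwi law.prob_space by simp
  also have "\<dots> \<le> u powr r + r * u powr (r - 1) * (2 * inner y (\<delta> *\<^sub>R a) + (2 * r - 1) * ((norm b)\<^sup>2 * \<delta>))
     + 1200 * u powr r * (128 * gk * (A * \<theta> + \<theta> ^ 3 + \<theta> ^ 6))"
    using Rwi by (intro add_left_mono mult_left_mono) auto
  also have "\<dots> = u powr r + r * u powr (r - 1) * ((2 * inner y a + (2 * r - 1) * (norm b)\<^sup>2) * \<delta>)
       + 153600 * gk * u powr r * (\<alpha> * \<delta> * \<theta> + \<theta> ^ 3 + \<theta> ^ 6)"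
    by (simp add: A_def algebra_simps)
  finally show ?thesis by (simp add: ennreal_leI)
qed

end

section \<open>Stopped Euler chains\<close>

primrec stopped :: "(nat \<Rightarrow> 'a \<Rightarrow> 'b) \<Rightarrow> (nat \<Rightarrow> 'a \<Rightarrow> bool) \<Rightarrow> nat \<Rightarrow> 'a \<Rightarrow> 'b" where
  "stopped y Q 0 \<omega> = y 0 \<omega>"
| "stopped y Q (Suc i) \<omega> = (if \<forall>j\<le>i. Q j \<omega> then y (Suc i) \<omega> else stopped y Q i \<omega>)"

lemma stopped_eq: "(\<And>j. j < n \<Longrightarrow> Q j \<omega>) \<Longrightarrow> stopped y Q n \<omega> = y n \<omega>"
  by (cases n) (auto simp: less_Suc_eq_le)

lemma stopped_cases:
  obtains j where "j \<le> n" "stopped y Q n \<omega> = y j \<omega>" "\<And>k. k < j \<Longrightarrow> Q k \<omega>" "j = n \<or> \<not> Q j \<omega>"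
proof -
  have "\<exists>j\<le>n. stopped y Q n \<omega> = y j \<omega> \<and> (\<forall>k<j. Q k \<omega>) \<and> (j = n \<or> \<not> Q j \<omega>)"
  proof (induction n)
    case (Suc n)
    show ?case
    proof (cases "\<forall>j\<le>n. Q j \<omega>")
      case True
      then show ?thesis by (intro exI[of _ "Suc n"]) auto
    next
      case False
      from Suc obtain j where j: "j \<le> n" "stopped y Q n \<omega> = y j \<omega>" "\<forall>k<j. Q k \<omega>" "j = n \<or> \<not> Q j \<omega>" by blast
      have "\<not> Q j \<omega>" using j False by (auto simp: le_less)
      then show ?thesis using j False by (intro exI[of _ j]) auto
    qed
  qed auto
  then show ?thesis using that by blast
qed

lemma stopped_measurable:
  assumes y: "\<And>j. y j \<in> borel_measurable M" and Q: "\<And>j. {\<omega>\<in>space M. Q j \<omega>} \<in> sets M"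
  shows "stopped y Q n \<in> borel_measurable M"
proof (induction n)
  case 0 then show ?case using y[of 0] by simp
next
  case (Suc k)
  have "{\<omega>\<in>space M. \<forall>j\<in>{..k}. Q j \<omega>} \<in> sets M" using Q by (intro sets.sets_Collect_finite_All) simp_all
  then have "{\<omega>\<in>space M. \<forall>j\<le>k. Q j \<omega>} \<in> sets M" unfolding Ball_def atMost_iff .
  then show ?case unfolding stopped.simps by (intro measurable_If y Suc)
qed

text \<open>A crude Young inequality without constants: the larger of the two numbers dominates the
  product.\<close>

lemma powr_times_le_add:
  fixes u v r :: real
  assumes "0 < u" "0 \<le> v" "1 \<le> r"
  shows "u powr (r - 1) * v \<le> u powr r + v powr r"
proof (cases "v \<le> u")
  case True
  then have "u powr (r - 1) * v \<le> u powr (r - 1) * u" by (intro mult_left_mono) auto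
  also have "\<dots> = u powr r" using assms by (simp add: powr_diff)
  finally show ?thesis using powr_ge_zero[of v r] by linarith
next
  case False
  then have "u powr (r - 1) * v \<le> v powr (r - 1) * v" using assms by (intro mult_right_mono powr_mono2) auto
  also have "\<dots> = v powr r" using assms False by (simp add: powr_diff)
  finally show ?thesis using powr_ge_zero[of u r] by linarith
qed

context brownian
begin

text \<open>The Gronwall rate of one step. The summand 1 in \<open>c + 1\<close> absorbs the
  inhomogeneous term through \<open>powr_times_le_add\<close>; the rest is the remainder of
  \<open>one_step\<close>, the only place where the size bounds \<alpha> and \<beta> occur.\<close>

definition growth_rate :: "real \<Rightarrow> real \<Rightarrow> real \<Rightarrow> real \<Rightarrow> real \<Rightarrow> real" where
  "growth_rate r c \<alpha> \<beta> \<delta> = r * (c + 1) * \<delta> + 153600 * gk *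
     (\<alpha> * \<delta> * (\<alpha> * \<delta> + \<beta> * sqrt \<delta>) + (\<alpha> * \<delta> + \<beta> * sqrt \<delta>) ^ 3 + (\<alpha> * \<delta> + \<beta> * sqrt \<delta>) ^ 6)"

lemma growth_rate_nonneg: "0 \<le> r \<Longrightarrow> 0 \<le> c \<Longrightarrow> 0 \<le> \<alpha> \<Longrightarrow> 0 \<le> \<beta> \<Longrightarrow> 0 \<le> \<delta> \<Longrightarrow> 0 \<le> growth_rate r c \<alpha> \<beta> \<delta>"
  unfolding growth_rate_def using gk_ge_1 by (intro add_nonneg_nonneg mult_nonneg_nonneg zero_le_power) auto

lemma stopped_moment_bound:
  fixes y a :: "nat \<Rightarrow> 'a \<Rightarrow> real^'d" and b :: "nat \<Rightarrow> 'a \<Rightarrow> real^'m^'d"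
    and \<eta> r \<alpha> \<beta> c \<delta> :: real
  assumes d: "0 < \<delta>" and r: "1 \<le> r" "r \<le> 3" and eta: "0 < \<eta>" and al: "0 \<le> \<alpha>" and be: "0 \<le> \<beta>" and c: "0 \<le> c"
    and y0: "\<And>\<omega>. \<omega> \<in> space M \<Longrightarrow> y 0 \<omega> = v0"
    and step: "\<And>i \<omega>. \<omega> \<in> space M \<Longrightarrow> y (Suc i) \<omega> = y i \<omega> + \<delta> *\<^sub>R a i \<omega>
        + b i \<omega> *v (B (real (Suc i) * \<delta>) \<omega> - B (real i * \<delta>) \<omega>)"
    and am: "\<And>i. a i \<in> borel_measurable (F (real i * \<delta>))"
    and bm: "\<And>i. b i \<in> borel_measurable (F (real i * \<delta>))"
    and Qm: "\<And>i. {\<omega>\<in>space M. Q i \<omega>} \<in> sets (F (real i * \<delta>))"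
    and zm: "\<And>i. \<zeta> i \<in> borel_measurable M" and z0: "\<And>i \<omega>. \<omega> \<in> space M \<Longrightarrow> 0 \<le> \<zeta> i \<omega>"
    and a_le: "\<And>i \<omega>. i < n \<Longrightarrow> \<omega> \<in> space M \<Longrightarrow> (\<And>j. j \<le> i \<Longrightarrow> Q j \<omega>) \<Longrightarrow> norm (a i \<omega>) \<le> \<alpha> * sqrt (\<eta> + (norm (y i \<omega>))\<^sup>2)"
    and b_le: "\<And>i \<omega>. i < n \<Longrightarrow> \<omega> \<in> space M \<Longrightarrow> (\<And>j. j \<le> i \<Longrightarrow> Q j \<omega>) \<Longrightarrow> norm (b i \<omega>) \<le> \<beta> * sqrt (\<eta> + (norm (y i \<omega>))\<^sup>2)"
    and drift: "\<And>i \<omega>. i < n \<Longrightarrow> \<omega> \<in> space M \<Longrightarrow> (\<And>j. j \<le> i \<Longrightarrow> Q j \<omega>) \<Longrightarrow>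
        2 * inner (y i \<omega>) (a i \<omega>) + (2 * r - 1) * (norm (b i \<omega>))\<^sup>2 \<le> c * (\<eta> + (norm (y i \<omega>))\<^sup>2) + \<zeta> i \<omega>"
  shows "(\<integral>\<^sup>+\<omega>. ennreal ((\<eta> + (norm (stopped y Q n \<omega>))\<^sup>2) powr r) \<partial>M)
    \<le> ennreal (exp (real n * growth_rate r c \<alpha> \<beta> \<delta>)) *
       (ennreal ((\<eta> + (norm v0)\<^sup>2) powr r) + (\<Sum>i<n. ennreal (\<delta> * r) * (\<integral>\<^sup>+\<omega>. ennreal (\<zeta> i \<omega> powr r) \<partial>M)))"
proof -
  define \<kappa> where "\<kappa> = growth_rate r c \<alpha> \<beta> \<delta>"
  have k0: "0 \<le> \<kappa>" unfolding \<kappa>_def using r c al be d by (intro growth_rate_nonneg) auto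
  let ?S = "stopped y Q" and ?t = "\<lambda>i. real i * \<delta>"
  let ?W = "\<lambda>i \<omega>. B (?t (Suc i)) \<omega> - B (?t i) \<omega>"
  define \<phi> where "\<phi> = (\<lambda>v::real^'d. (\<eta> + (norm v)\<^sup>2) powr r)"
  have phim: "\<phi> \<in> borel_measurable borel" unfolding \<phi>_def by measurable
  have t0: "0 \<le> ?t i" "?t i < ?t (Suc i)" for i using d by auto
  note up = measurable_F_mono[OF _ t0(1) less_imp_le[OF t0(2)]]
  have ym: "y i \<in> borel_measurable (F (?t i))" for i
  proof (induction i)
    case 0
    have "(\<lambda>_. v0) \<in> borel_measurable (F (?t 0))" by simp
    then show ?case by (rule measurable_cong[THEN iffD1, rotated]) (use y0 space_F in auto)
  next
    case (Suc i)
    let ?N = "F (?t (Suc i))"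
    have [measurable]: "y i \<in> borel_measurable ?N" "a i \<in> borel_measurable ?N" "b i \<in> borel_measurable ?N"
      "B (?t i) \<in> borel_measurable ?N" "B (?t (Suc i)) \<in> borel_measurable ?N"
      by (intro up Suc am bm B_F t0(1))+
    have "(\<lambda>\<omega>. y i \<omega> + \<delta> *\<^sub>R a i \<omega> + b i \<omega> *v ?W i \<omega>) \<in> borel_measurable ?N" by measurable
    then show ?case by (rule measurable_cong[THEN iffD1, rotated]) (simp only: step space_F[OF t0(1)])
  qed
  define G where "G = (\<lambda>i. {\<omega>\<in>space M. \<forall>j\<le>i. Q j \<omega>})"
  have Gm: "G i \<in> sets (F (?t i))" for i
  proof -
    have "{\<omega>\<in>space (F (?t i)). Q j \<omega>} \<in> sets (F (?t i))" if "j \<le> i" for j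
      unfolding space_F[OF t0(1)[of i]]
      by (rule sets_F_mono[OF t0(1) _ Qm]) (use that d in simp)
    then have "{\<omega>\<in>space (F (?t i)). \<forall>j\<in>{..i}. Q j \<omega>} \<in> sets (F (?t i))"
      by (intro sets.sets_Collect_finite_All) simp_all
    then show ?thesis unfolding G_def space_F[OF t0(1)[of i]] Ball_def atMost_iff .
  qed
  have Sm: "?S i \<in> borel_measurable (F (?t i))" for i
  proof (induction i)
    case 0
    show ?case using ym[of 0] by simp
  next
    case (Suc i)
    let ?N = "F (?t (Suc i))"
    have "?S i \<in> borel_measurable ?N" by (rule up[OF Suc])
    moreover have "G i \<in> sets ?N" by (rule sets_F_mono[OF t0(1) less_imp_le[OF t0(2)] Gm])
    then have "{\<omega>\<in>space ?N. \<forall>j\<le>i. Q j \<omega>} \<in> sets ?N"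
      unfolding G_def space_F[OF t0(1)[of "Suc i"]] .
    ultimately show ?case unfolding stopped.simps by (intro measurable_If ym)
  qed
  have main: "(\<integral>\<^sup>+\<omega>. ennreal (\<phi> (?S (Suc i) \<omega>)) \<partial>M) \<le>
     ennreal (exp \<kappa>) * (\<integral>\<^sup>+\<omega>. ennreal (\<phi> (?S i \<omega>)) \<partial>M) + ennreal (\<delta> * r) * (\<integral>\<^sup>+\<omega>. ennreal (\<zeta> i \<omega> powr r) \<partial>M)"
    if i: "i < n" for i
  proof -
    \<comment> \<open>The increment becomes a separate variable \<open>w\<close>, and everything
      else depends on \<open>F (?t i)\<close> only, so that \<open>nn_integral_indep\<close> can
      integrate over \<open>w\<close> first.\<close>
    define \<Phi> where "\<Phi> = (\<lambda>\<omega> w. if \<omega> \<in> G i then ennreal (\<phi> (y i \<omega> + \<delta> *\<^sub>R a i \<omega> + b i \<omega> *v w)) else ennreal (\<phi> (?S i \<omega>)))"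
    have Phim: "(\<lambda>p. \<Phi> (fst p) (snd p)) \<in> borel_measurable (F (?t i) \<Otimes>\<^sub>M (borel :: (real^'m) measure))"
      unfolding \<Phi>_def
    proof (rule measurable_If)
      note [measurable] = ym[of i] am[of i] bm[of i] Sm[of i] phim Gm[of i]
      show "(\<lambda>x. ennreal (\<phi> (y i (fst x) + \<delta> *\<^sub>R a i (fst x) + b i (fst x) *v snd x))) \<in> borel_measurable (F (?t i) \<Otimes>\<^sub>M borel)"
        by measurable
      show "(\<lambda>x. ennreal (\<phi> (?S i (fst x)))) \<in> borel_measurable (F (?t i) \<Otimes>\<^sub>M borel)" by measurable
      show "{x \<in> space (F (?t i) \<Otimes>\<^sub>M borel). fst x \<in> G i} \<in> sets (F (?t i) \<Otimes>\<^sub>M borel)" by measurable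
    qed
    have "(\<integral>\<^sup>+\<omega>. ennreal (\<phi> (?S (Suc i) \<omega>)) \<partial>M) = (\<integral>\<^sup>+\<omega>. \<Phi> \<omega> (?W i \<omega>) \<partial>M)"
      by (intro nn_integral_cong) (auto simp: \<Phi>_def G_def step)
    also have "\<dots> = (\<integral>\<^sup>+\<omega>. \<integral>\<^sup>+w. \<Phi> \<omega> w \<partial>law (?t i) (?t (Suc i)) \<partial>M)"
      by (rule nn_integral_indep[OF t0(1) t0(2) Phim])
    also have "\<dots> \<le> (\<integral>\<^sup>+\<omega>. ennreal (exp \<kappa>) * ennreal (\<phi> (?S i \<omega>)) + ennreal (\<delta> * r) * ennreal (\<zeta> i \<omega> powr r) \<partial>M)"
    proof (rule nn_integral_mono)
      fix \<omega> assume \<omega>: "\<omega> \<in> space M"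
      interpret law: prob_space "law (?t i) (?t (Suc i))" using t0[of i] by (intro prob_space_law) auto
      show "(\<integral>\<^sup>+w. \<Phi> \<omega> w \<partial>law (?t i) (?t (Suc i))) \<le> ennreal (exp \<kappa>) * ennreal (\<phi> (?S i \<omega>)) + ennreal (\<delta> * r) * ennreal (\<zeta> i \<omega> powr r)"
      proof (cases "\<omega> \<in> G i")
        case False
        have "(\<integral>\<^sup>+w. \<Phi> \<omega> w \<partial>law (?t i) (?t (Suc i))) = ennreal (\<phi> (?S i \<omega>))"
          using False law.emeasure_space_1 by (simp add: \<Phi>_def)
        also have "\<dots> \<le> ennreal (exp \<kappa>) * ennreal (\<phi> (?S i \<omega>))"
          using k0 mult_right_mono[of 1 "ennreal (exp \<kappa>)" "ennreal (\<phi> (?S i \<omega>))"] by simp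
        also have "\<dots> \<le> \<dots> + ennreal (\<delta> * r) * ennreal (\<zeta> i \<omega> powr r)" by (rule add_increasing2) auto
        finally show ?thesis .
      next
        case True
        then have Q: "Q j \<omega>" if "j \<le> i" for j using that by (auto simp: G_def)
        define u where "u = \<eta> + (norm (y i \<omega>))\<^sup>2"
        have u: "0 < u" using eta by (simp add: u_def add_pos_nonneg)
        have S: "?S i \<omega> = y i \<omega>" by (rule stopped_eq) (use Q in auto)
        have tt: "?t (Suc i) - ?t i = \<delta>" by (simp add: algebra_simps)
        define X where "X = 153600 * gk * (\<alpha> * \<delta> * (\<alpha> * \<delta> + \<beta> * sqrt \<delta>) + (\<alpha> * \<delta> + \<beta> * sqrt \<delta>) ^ 3 + (\<alpha> * \<delta> + \<beta> * sqrt \<delta>) ^ 6)"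
        have "(\<integral>\<^sup>+w. \<Phi> \<omega> w \<partial>law (?t i) (?t (Suc i))) =
          (\<integral>\<^sup>+w. ennreal ((\<eta> + (norm (y i \<omega> + \<delta> *\<^sub>R a i \<omega> + b i \<omega> *v w))\<^sup>2) powr r) \<partial>law (?t i) (?t (Suc i)))"
          using True by (simp add: \<Phi>_def \<phi>_def)
        also have "\<dots> \<le> ennreal (u powr r + r * u powr (r - 1) * ((2 * inner (y i \<omega>) (a i \<omega>) + (2 * r - 1) * (norm (b i \<omega>))\<^sup>2) * \<delta>)
            + u powr r * X)"
        proof -
          have X: "u powr r * X = 153600 * gk * u powr r * (\<alpha> * \<delta> * (\<alpha> * \<delta> + \<beta> * sqrt \<delta>) + (\<alpha> * \<delta> + \<beta> * sqrt \<delta>) ^ 3 + (\<alpha> * \<delta> + \<beta> * sqrt \<delta>) ^ 6)"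
            by (simp add: X_def)
          show ?thesis
            using one_step[OF t0(1)[of i] t0(2)[of i] r eta al a_le[OF i \<omega> Q] be b_le[OF i \<omega> Q]]
            unfolding tt u_def[symmetric] X .
        qed
        also have "\<dots> \<le> ennreal (exp \<kappa> * u powr r + \<delta> * r * \<zeta> i \<omega> powr r)"
        proof (rule ennreal_leI)
          have z: "0 \<le> \<zeta> i \<omega>" using z0 \<omega> by auto
          have "u powr (r - 1) * ((2 * inner (y i \<omega>) (a i \<omega>) + (2 * r - 1) * (norm (b i \<omega>))\<^sup>2) * \<delta>) \<le> u powr (r - 1) * ((c * u + \<zeta> i \<omega>) * \<delta>)"
            using drift[OF i \<omega> Q] d by (intro mult_left_mono mult_right_mono) (auto simp: u_def)
          also have "\<dots> = (c * (u powr (r - 1) * u) + u powr (r - 1) * \<zeta> i \<omega>) * \<delta>" by (simp add: algebra_simps)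
          also have "u powr (r - 1) * u = u powr r" using u by (simp add: powr_diff)
          also have "(c * u powr r + u powr (r - 1) * \<zeta> i \<omega>) * \<delta> \<le> (c * u powr r + (u powr r + \<zeta> i \<omega> powr r)) * \<delta>"
            using powr_times_le_add[OF u z r(1)] d by (intro mult_right_mono add_left_mono) auto
          finally have "r * (u powr (r - 1) * ((2 * inner (y i \<omega>) (a i \<omega>) + (2 * r - 1) * (norm (b i \<omega>))\<^sup>2) * \<delta>)) \<le> r * \<dots>"
            using r by (intro mult_left_mono) auto
          moreover have "u powr r * (1 + \<kappa>) \<le> u powr r * exp \<kappa>" by (intro mult_left_mono exp_ge_add_one_self) auto
          moreover have "\<kappa> = r * (c + 1) * \<delta> + X" unfolding \<kappa>_def growth_rate_def X_def ..
          ultimately show "u powr r + r * u powr (r - 1) * ((2 * inner (y i \<omega>) (a i \<omega>) + (2 * r - 1) * (norm (b i \<omega>))\<^sup>2) * \<delta>)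
            + u powr r * X \<le> exp \<kappa> * u powr r + \<delta> * r * \<zeta> i \<omega> powr r"
            by (simp add: algebra_simps)
        qed
        also have "\<dots> = ennreal (exp \<kappa>) * ennreal (\<phi> (?S i \<omega>)) + ennreal (\<delta> * r) * ennreal (\<zeta> i \<omega> powr r)"
          unfolding S \<phi>_def u_def[symmetric] using d r by (simp add: ennreal_mult' ennreal_plus)
        finally show ?thesis .
      qed
    qed
    also have "\<dots> = ennreal (exp \<kappa>) * (\<integral>\<^sup>+\<omega>. ennreal (\<phi> (?S i \<omega>)) \<partial>M) + ennreal (\<delta> * r) * (\<integral>\<^sup>+\<omega>. ennreal (\<zeta> i \<omega> powr r) \<partial>M)"
    proof -
      have [measurable]: "?S i \<in> borel_measurable M" "\<zeta> i \<in> borel_measurable M"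
        using measurable_F_M[OF Sm] d zm by auto
      note [measurable] = phim
      show ?thesis by (subst nn_integral_add) (auto simp: nn_integral_cmult)
    qed
    finally show ?thesis .
  qed
  have "(\<integral>\<^sup>+\<omega>. ennreal (\<phi> (?S k \<omega>)) \<partial>M) \<le> ennreal (exp (real k * \<kappa>)) *
       (ennreal (\<phi> v0) + (\<Sum>i<k. ennreal (\<delta> * r) * (\<integral>\<^sup>+\<omega>. ennreal (\<zeta> i \<omega> powr r) \<partial>M)))" if "k \<le> n" for k
    using that
  proof (induction k)
    case 0
    have "(\<integral>\<^sup>+\<omega>. ennreal (\<phi> (?S 0 \<omega>)) \<partial>M) = (\<integral>\<^sup>+\<omega>. ennreal (\<phi> v0) \<partial>M)"
      by (intro nn_integral_cong) (auto simp: y0)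
    then show ?case using emeasure_space_1 by simp
  next
    case (Suc k)
    let ?z = "\<lambda>i. ennreal (\<delta> * r) * (\<integral>\<^sup>+\<omega>. ennreal (\<zeta> i \<omega> powr r) \<partial>M)"
    have "(\<integral>\<^sup>+\<omega>. ennreal (\<phi> (?S (Suc k) \<omega>)) \<partial>M) \<le> ennreal (exp \<kappa>) * (\<integral>\<^sup>+\<omega>. ennreal (\<phi> (?S k \<omega>)) \<partial>M) + ?z k"
      using main[of k] Suc by simp
    also have "\<dots> \<le> ennreal (exp \<kappa>) * (ennreal (exp (real k * \<kappa>)) * (ennreal (\<phi> v0) + (\<Sum>i<k. ?z i))) + ennreal (exp (real (Suc k) * \<kappa>)) * ?z k"
    proof (intro add_mono mult_left_mono Suc.IH)
      have "1 \<le> ennreal (exp (real (Suc k) * \<kappa>))" using k0 by (simp add: ennreal_ge_1)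
      then show "?z k \<le> ennreal (exp (real (Suc k) * \<kappa>)) * ?z k"
        using mult_right_mono[of 1 "ennreal (exp (real (Suc k) * \<kappa>))" "?z k"] by simp
    qed (use Suc in auto)
    also have "\<dots> = ennreal (exp (real (Suc k) * \<kappa>)) * (ennreal (\<phi> v0) + (\<Sum>i<Suc k. ?z i))"
    proof -
      have "ennreal (exp \<kappa>) * ennreal (exp (real k * \<kappa>)) = ennreal (exp (real (Suc k) * \<kappa>))"
        by (simp add: ennreal_mult'[symmetric] exp_add[symmetric] algebra_simps)
      then show ?thesis by (simp add: mult.assoc[symmetric] distrib_left add.assoc)
    qed
    finally show ?case .
  qed
  from this[of n] show ?thesis by (simp add: \<phi>_def \<kappa>_def)
qed

end

section \<open>Euler sums along the solution\<close>

text \<open>Dominated convergence for indicators. Continuity and boundedness of paths enter the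
  estimates in this form.\<close>

lemma (in finite_measure) measure_tendsto_0_pointwise:
  assumes A: "\<And>n. A n \<in> sets M" and ev: "\<And>\<omega>. \<omega> \<in> space M \<Longrightarrow> eventually (\<lambda>n. \<omega> \<notin> A n) sequentially"
  shows "(\<lambda>n. measure M (A n)) \<longlonglongrightarrow> 0"
proof -
  have "(\<lambda>n. \<integral>\<omega>. indicat_real (A n) \<omega> \<partial>M) \<longlonglongrightarrow> (\<integral>\<omega>. 0 \<partial>M)"
  proof (rule integral_dominated_convergence[where w = "\<lambda>_. 1"])
    show "AE \<omega> in M. (\<lambda>n. indicat_real (A n) \<omega>) \<longlonglongrightarrow> 0"
    proof (rule AE_I2)
      fix \<omega> assume "\<omega> \<in> space M"
      from ev[OF this] show "(\<lambda>n. indicat_real (A n) \<omega>) \<longlonglongrightarrow> 0"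
        by (intro tendsto_eventually) (auto elim: eventually_mono)
    qed
  qed (use A in \<open>auto simp: indicator_def\<close>)
  moreover have "(\<integral>\<omega>. indicat_real (A n) \<omega> \<partial>M) = measure M (A n)" for n
    using A[of n] sets.sets_into_space[OF A[of n]] by (simp add: Int_absorb2)
  ultimately show ?thesis by simp
qed

lemma left_endpoint_error:
  fixes \<phi> :: "real \<Rightarrow> 'b::euclidean_space"
  assumes st: "s \<le> t" and cont: "continuous_on {s..t} \<phi>" and e: "\<And>v. v \<in> {s..t} \<Longrightarrow> norm (\<phi> v - \<phi> s) \<le> e"
  shows "norm (integral {s..t} \<phi> - (t - s) *\<^sub>R \<phi> s) \<le> (t - s) * e"
proof -
  have "integral {s..t} \<phi> - (t - s) *\<^sub>R \<phi> s = integral {s..t} (\<lambda>v. \<phi> v - \<phi> s)"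
    using Henstock_Kurzweil_Integration.integral_diff[OF integrable_continuous_interval[OF cont] integrable_const_ivl[of "\<phi> s"]] st
    by simp
  also have "norm \<dots> \<le> e * (t - s)"
    using st e by (intro integral_bound continuous_intros cont) auto
  finally show ?thesis by (simp add: mult.commute)
qed

lemma riemann_sum_error:
  fixes \<phi> :: "real \<Rightarrow> 'b::euclidean_space"
  assumes d: "0 \<le> \<delta>" and cont: "continuous_on {0..real n * \<delta>} \<phi>"
    and osc: "\<And>s t. 0 \<le> s \<Longrightarrow> s \<le> t \<Longrightarrow> t \<le> real n * \<delta> \<Longrightarrow> t - s \<le> \<delta> \<Longrightarrow> norm (\<phi> t - \<phi> s) \<le> e"
  shows "norm (integral {0..real n * \<delta>} \<phi> - (\<Sum>k<n. \<delta> *\<^sub>R \<phi> (real k * \<delta>))) \<le> real n * \<delta> * e"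
proof -
  have "norm (integral {0..real k * \<delta>} \<phi> - (\<Sum>j<k. \<delta> *\<^sub>R \<phi> (real j * \<delta>))) \<le> real k * \<delta> * e" if "k \<le> n" for k
    using that
  proof (induction k)
    case (Suc k)
    let ?s = "real k * \<delta>" and ?t = "real (Suc k) * \<delta>"
    have st: "0 \<le> ?s" "?s \<le> ?t" "?t \<le> real n * \<delta>" "?t - ?s = \<delta>"
      using d Suc.prems by (auto simp: algebra_simps intro!: mult_right_mono) (metis mult_right_mono of_nat_Suc of_nat_mono add.commute distrib_left mult.commute mult.right_neutral)
    have sub: "{?s..?t} \<subseteq> {0..real n * \<delta>}"
      by (rule subsetI, simp only: atLeastAtMost_iff) (meson order_trans st)
    have "\<phi> integrable_on {0..?t}"
      by (rule integrable_continuous_interval, rule continuous_on_subset[OF cont]) (use st(3) in auto)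
    from Henstock_Kurzweil_Integration.integral_combine[OF st(1,2) this]
    have sum: "integral {0..?t} \<phi> = integral {0..?s} \<phi> + integral {?s..?t} \<phi>" by simp
    have "norm (integral {?s..?t} \<phi> - (?t - ?s) *\<^sub>R \<phi> ?s) \<le> (?t - ?s) * e"
    proof (rule left_endpoint_error[OF st(2) continuous_on_subset[OF cont sub]])
      fix v assume v: "v \<in> {?s..?t}"
      show "norm (\<phi> v - \<phi> ?s) \<le> e"
        by (rule osc) (use v sub st in \<open>auto simp only: atLeastAtMost_iff subset_iff\<close>)
    qed
    then have "norm (integral {?s..?t} \<phi> - \<delta> *\<^sub>R \<phi> ?s) \<le> \<delta> * e" unfolding st(4) .
    moreover have "norm (integral {0..?s} \<phi> - (\<Sum>j<k. \<delta> *\<^sub>R \<phi> (real j * \<delta>))) \<le> real k * \<delta> * e" using Suc by simp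
    ultimately have "norm ((integral {0..?s} \<phi> - (\<Sum>j<k. \<delta> *\<^sub>R \<phi> (real j * \<delta>))) + (integral {?s..?t} \<phi> - \<delta> *\<^sub>R \<phi> ?s))
      \<le> real k * \<delta> * e + \<delta> * e" by (intro norm_triangle_le add_mono)
    then show ?case unfolding sum by (simp add: algebra_simps)
  qed auto
  then show ?thesis by simp
qed

lemma uniform_osc:
  fixes \<phi> :: "real \<Rightarrow> 'b::metric_space"
  assumes cont: "continuous_on {0..T} \<phi>" and e: "0 < e"
  obtains d where "0 < d" "\<And>s t. s \<in> {0..T} \<Longrightarrow> t \<in> {0..T} \<Longrightarrow> \<bar>t - s\<bar> < d \<Longrightarrow> dist (\<phi> t) (\<phi> s) < e"
  using compact_uniformly_continuous[OF cont compact_Icc] e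
  unfolding uniformly_continuous_on_def by (metis dist_real_def)

lemma step_small: "0 < d \<Longrightarrow> eventually (\<lambda>n. T / real n < d) sequentially"
  using order_tendstoD(2)[OF lim_const_over_n[of T]] by simp

lemma riemann_sum_tendsto:
  fixes \<phi> :: "real \<Rightarrow> 'b::euclidean_space"
  assumes T: "0 < T" and cont: "continuous_on {0..T} \<phi>"
  shows "(\<lambda>n. \<Sum>k<n. (T / real n) *\<^sub>R \<phi> (real k * (T / real n))) \<longlonglongrightarrow> integral {0..T} \<phi>"
proof (rule tendstoI)
  fix e :: real assume e: "0 < e"
  have "0 < e / (2 * T)" using e T by simp
  from uniform_osc[OF cont this] obtain d where d: "0 < d"
    "\<And>s t. s \<in> {0..T} \<Longrightarrow> t \<in> {0..T} \<Longrightarrow> \<bar>t - s\<bar> < d \<Longrightarrow> dist (\<phi> t) (\<phi> s) < e / (2 * T)" by blast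
  from step_small[OF d(1), of T] eventually_gt_at_top[of 0]
  show "\<forall>\<^sub>F n in sequentially. dist (\<Sum>k<n. (T / real n) *\<^sub>R \<phi> (real k * (T / real n))) (integral {0..T} \<phi>) < e"
  proof eventually_elim
    case (elim n)
    have nT: "real n * (T / real n) = T" using elim by simp
    have "norm (integral {0..real n * (T / real n)} \<phi> - (\<Sum>k<n. (T / real n) *\<^sub>R \<phi> (real k * (T / real n)))) \<le> real n * (T / real n) * (e / (2 * T))"
    proof (rule riemann_sum_error)
      show "norm (\<phi> t - \<phi> s) \<le> e / (2 * T)" if "0 \<le> s" "s \<le> t" "t \<le> real n * (T / real n)" "t - s \<le> T / real n" for s t
        using d(2)[of s t] that elim unfolding nT by (auto simp: dist_norm)
    qed (use T cont nT in auto)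
    also have "\<dots> < e" using T e nT by simp
    finally show ?case unfolding nT by (simp add: dist_norm norm_minus_commute)
  qed
qed

locale sde = brownian M F B for M :: "'a measure" and F and B :: "real \<Rightarrow> 'a \<Rightarrow> real^'m" +
  fixes f :: "real^'d \<Rightarrow> real^'d" and g :: "real^'d \<Rightarrow> real^'m^'d" and x0 and x :: "real \<Rightarrow> 'a \<Rightarrow> real^'d"
    and L :: "real \<Rightarrow> real"
  assumes sol: "sde_solution M F B f g x0 x"
    and L_pos: "0 < R \<Longrightarrow> 0 < L R"
    and f_lip: "norm y \<le> R \<Longrightarrow> norm z \<le> R \<Longrightarrow> 0 < R \<Longrightarrow> norm (f y - f z) \<le> L R * norm (y - z)"
    and g_lip: "norm y \<le> R \<Longrightarrow> norm z \<le> R \<Longrightarrow> 0 < R \<Longrightarrow> norm (g y - g z) \<le> L R * norm (y - z)"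
begin

lemma x_F: "0 \<le> t \<Longrightarrow> x t \<in> borel_measurable (F t)"
  using sol unfolding sde_solution_def by blast

lemma x_M: "0 \<le> t \<Longrightarrow> x t \<in> borel_measurable M"
  using x_F measurable_F_M by blast

lemma x_0: "\<omega> \<in> space M \<Longrightarrow> x 0 \<omega> = x0"
  using sol unfolding sde_solution_def by blast

lemma x_cont: "\<omega> \<in> space M \<Longrightarrow> continuous_on {0..} (\<lambda>t. x t \<omega>)"
  using sol unfolding sde_solution_def by blast

lemma sol_limit: "0 \<le> t \<Longrightarrow> 0 < \<epsilon> \<Longrightarrow> (\<lambda>n. measure M {\<omega>\<in>space M. \<epsilon> <
     norm (x t \<omega> - x0 - integral {0..t} (\<lambda>s. f (x s \<omega>)) - (\<Sum>k<n. g (x (real k * t / real n) \<omega>) *v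
        (B (real (Suc k) * t / real n) \<omega> - B (real k * t / real n) \<omega>)))}) \<longlonglongrightarrow> 0"
  using sol unfolding sde_solution_def by blast

lemma continuous_of_locally_lipschitz:
  fixes \<phi> :: "real^'d \<Rightarrow> 'b::real_normed_vector"
  assumes lip: "\<And>R y z. norm y \<le> R \<Longrightarrow> norm z \<le> R \<Longrightarrow> 0 < R \<Longrightarrow> norm (\<phi> y - \<phi> z) \<le> L R * norm (y - z)"
  shows "continuous_on UNIV \<phi>"
  unfolding continuous_on_iff
proof safe
  fix z :: "real^'d" and e :: real assume e: "0 < e"
  define R where "R = norm z + 1"
  have R: "0 < R" by (simp add: R_def add_nonneg_pos)
  show "\<exists>d>0. \<forall>y\<in>UNIV. dist y z < d \<longrightarrow> dist (\<phi> y) (\<phi> z) < e"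
  proof (intro exI[of _ "min 1 (e / L R)"] conjI ballI impI)
    show "0 < min 1 (e / L R)" using e L_pos[OF R] by simp
    fix y assume d: "dist y z < min 1 (e / L R)"
    have "norm y \<le> norm z + norm (y - z)" by (metis add.commute norm_triangle_sub)
    then have "norm y \<le> R" using d by (simp add: R_def dist_norm)
    then have "norm (\<phi> y - \<phi> z) \<le> L R * norm (y - z)" using R by (intro lip) (auto simp: R_def)
    also have "\<dots> < e" using d L_pos[OF R] by (simp add: dist_norm pos_less_divide_eq mult.commute)
    finally show "dist (\<phi> y) (\<phi> z) < e" by (simp add: dist_norm)
  qed
qed

lemma f_cont: "continuous_on UNIV f" and g_cont: "continuous_on UNIV g"
  by (rule continuous_of_locally_lipschitz, rule f_lip g_lip, assumption+)+

lemma f_borel [measurable]: "f \<in> borel_measurable borel" and g_borel [measurable]: "g \<in> borel_measurable borel"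
  using f_cont g_cont by (auto intro: borel_measurable_continuous_onI)

lemma f_bound: "norm y \<le> R \<Longrightarrow> 0 < R \<Longrightarrow> norm (f y) \<le> norm (f 0) + L R * R"
proof -
  assume a: "norm y \<le> R" "0 < R"
  have "norm (f y) \<le> norm (f 0) + norm (f y - f 0)" by (metis add.commute norm_triangle_sub)
  also have "norm (f y - f 0) \<le> L R * norm (y - 0)" using a by (intro f_lip) auto
  also have "\<dots> \<le> L R * R" using a L_pos[of R] by (intro mult_left_mono) auto
  finally show ?thesis by simp
qed

lemma g_bound: "norm y \<le> R \<Longrightarrow> 0 < R \<Longrightarrow> norm (g y) \<le> norm (g 0) + L R * R"
proof -
  assume a: "norm y \<le> R" "0 < R"
  have "norm (g y) \<le> norm (g 0) + norm (g y - g 0)" by (metis add.commute norm_triangle_sub)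
  also have "norm (g y - g 0) \<le> L R * norm (y - 0)" using a by (intro g_lip) auto
  also have "\<dots> \<le> L R * R" using a L_pos[of R] by (intro mult_left_mono) auto
  finally show ?thesis by simp
qed

text \<open>The coefficients are evaluated at the solution \<open>x\<close>, not at the sum itself:
  this is a Riemann sum of the integral equation, not the Euler-Maruyama scheme. It is a chain to
  which \<open>stopped_moment_bound\<close> applies, while \<open>x\<close> has no such
  recursion.\<close>

definition euler :: "real \<Rightarrow> nat \<Rightarrow> 'a \<Rightarrow> real^'d" where
  "euler \<delta> n \<omega> = x0 + (\<Sum>k<n. \<delta> *\<^sub>R f (x (real k * \<delta>) \<omega>)
      + g (x (real k * \<delta>) \<omega>) *v (B (real (Suc k) * \<delta>) \<omega> - B (real k * \<delta>) \<omega>))"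

lemma euler_M: "0 \<le> \<delta> \<Longrightarrow> euler \<delta> n \<in> borel_measurable M"
proof -
  assume d: "0 \<le> \<delta>"
  have [measurable]: "x (real k * \<delta>) \<in> borel_measurable M" "B (real k * \<delta>) \<in> borel_measurable M" for k
    using d by (auto intro!: x_M B_M)
  have [measurable]: "B (real (Suc k) * \<delta>) \<in> borel_measurable M" for k
    using d by (intro B_M mult_nonneg_nonneg) auto
  show ?thesis unfolding euler_def by measurable
qed

lemma grid_M: "0 \<le> \<delta> \<Longrightarrow> x (real k * \<delta>) \<in> borel_measurable M"
  by (auto intro!: x_M)

text \<open>The drift part is a Riemann sum that converges along every path by continuity; the noise
  part converges in probability by the definition of a solution. This is the only point where that
  limit enters.\<close>

lemma euler_tendsto_in_measure:
  assumes T: "0 < T" and e: "0 < e"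
  shows "(\<lambda>n. measure M {\<omega>\<in>space M. e < norm (euler (T / real n) n \<omega> - x T \<omega>)}) \<longlonglongrightarrow> 0"
proof -
  define I where "I = (\<lambda>\<omega>. integral {0..T} (\<lambda>s. f (x s \<omega>)))"
  define RS where "RS = (\<lambda>n \<omega>. \<Sum>k<n. (T / real n) *\<^sub>R f (x (real k * (T / real n)) \<omega>))"
  define IS where "IS = (\<lambda>n \<omega>. \<Sum>k<n. g (x (real k * T / real n) \<omega>) *v (B (real (Suc k) * T / real n) \<omega> - B (real k * T / real n) \<omega>))"
  have dn: "0 \<le> T / real n" for n using T by simp
  have [measurable]: "x (real k * (T / real n)) \<in> borel_measurable M" for k n using dn by (rule grid_M)
  have [measurable]: "x (real k * T / real n) \<in> borel_measurable M" "B (real k * T / real n) \<in> borel_measurable M" for k n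
    using T by (auto intro!: x_M B_M)
  have [measurable]: "B (real (Suc k) * T / real n) \<in> borel_measurable M" for k n
    using T by (intro B_M divide_nonneg_nonneg mult_nonneg_nonneg) auto
  have [measurable]: "x T \<in> borel_measurable M" using T by (intro x_M) auto
  have RSm [measurable]: "RS n \<in> borel_measurable M" for n unfolding RS_def by measurable
  have ISm [measurable]: "IS n \<in> borel_measurable M" for n unfolding IS_def by measurable
  have RSl: "(\<lambda>n. RS n \<omega>) \<longlonglongrightarrow> I \<omega>" if "\<omega> \<in> space M" for \<omega>
    unfolding RS_def I_def using T
  proof (rule riemann_sum_tendsto)
    show "continuous_on {0..T} (\<lambda>s. f (x s \<omega>))"
      using x_cont[OF that] by (intro continuous_on_compose2[OF f_cont]) (auto intro: continuous_on_subset)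
  qed
  \<comment> \<open>The time integral inherits measurability as a pointwise limit of the Riemann
    sums.\<close>
  have Im [measurable]: "I \<in> borel_measurable M"
    by (rule borel_measurable_LIMSEQ_metric[OF RSm RSl])
  have eu: "euler (T / real n) n \<omega> = x0 + RS n \<omega> + IS n \<omega>" for n \<omega>
    by (simp add: euler_def RS_def IS_def sum.distrib)
  have e2: "0 < e / 2" using e by simp
  have 1: "(\<lambda>n. measure M {\<omega>\<in>space M. e / 2 < norm (x T \<omega> - x0 - I \<omega> - IS n \<omega>)}) \<longlonglongrightarrow> 0"
    using sol_limit[OF less_imp_le[OF T] e2] unfolding I_def IS_def .
  have 2: "(\<lambda>n. measure M {\<omega>\<in>space M. e / 2 < norm (RS n \<omega> - I \<omega>)}) \<longlonglongrightarrow> 0"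
  proof (rule measure_tendsto_0_pointwise)
    fix \<omega> assume "\<omega> \<in> space M"
    from tendstoD[OF RSl[OF this] e2] show "\<forall>\<^sub>F n in sequentially. \<omega> \<notin> {\<omega> \<in> space M. e / 2 < norm (RS n \<omega> - I \<omega>)}"
      by eventually_elim (auto simp: dist_norm)
  qed measurable
  show ?thesis
  proof (rule tendsto_sandwich[OF _ _ tendsto_const tendsto_add_zero[OF 1 2]])
    show "\<forall>\<^sub>F n in sequentially. measure M {\<omega>\<in>space M. e < norm (euler (T / real n) n \<omega> - x T \<omega>)} \<le>
      measure M {\<omega>\<in>space M. e / 2 < norm (x T \<omega> - x0 - I \<omega> - IS n \<omega>)} + measure M {\<omega>\<in>space M. e / 2 < norm (RS n \<omega> - I \<omega>)}"
    proof (intro always_eventually allI)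
      fix n
      have sub: "{\<omega>\<in>space M. e < norm (euler (T / real n) n \<omega> - x T \<omega>)} \<subseteq>
        {\<omega>\<in>space M. e / 2 < norm (x T \<omega> - x0 - I \<omega> - IS n \<omega>)} \<union> {\<omega>\<in>space M. e / 2 < norm (RS n \<omega> - I \<omega>)}"
      proof safe
        fix \<omega> assume "e < norm (euler (T / real n) n \<omega> - x T \<omega>)" "\<not> e / 2 < norm (RS n \<omega> - I \<omega>)"
        moreover have "norm (euler (T / real n) n \<omega> - x T \<omega>) \<le> norm (RS n \<omega> - I \<omega>) + norm (x T \<omega> - x0 - I \<omega> - IS n \<omega>)"
          unfolding eu using norm_triangle_ineq4[of "RS n \<omega> - I \<omega>" "x T \<omega> - x0 - I \<omega> - IS n \<omega>"] by (simp add: algebra_simps)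
        ultimately show "e / 2 < norm (x T \<omega> - x0 - I \<omega> - IS n \<omega>)" by linarith
      qed
      show "measure M {\<omega>\<in>space M. e < norm (euler (T / real n) n \<omega> - x T \<omega>)} \<le>
        measure M {\<omega>\<in>space M. e / 2 < norm (x T \<omega> - x0 - I \<omega> - IS n \<omega>)} + measure M {\<omega>\<in>space M. e / 2 < norm (RS n \<omega> - I \<omega>)}"
        by (rule order_trans[OF finite_measure_mono[OF sub] measure_Un_le]) measurable
    qed
  qed auto
qed

end

text \<open>With s = sqrt(T/n) and \<theta> = \<alpha> s + \<beta>, the n-fold remainder is a
  combination of s \<theta>, s \<theta>^3 and s^4 \<theta>^6. It vanishes as n grows, and \<alpha>,
  \<beta> leave no trace in the limit.\<close>

lemma (in brownian) growth_rate_tendsto: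
  assumes T: "0 < T"
  shows "(\<lambda>n. real n * growth_rate r c \<alpha> \<beta> (T / real n)) \<longlonglongrightarrow> r * (c + 1) * T"
proof -
  define s where "s = (\<lambda>n. sqrt (T / real n))"
  have s: "s \<longlonglongrightarrow> 0" using tendsto_real_sqrt[OF lim_const_over_n[of T]] by (simp add: s_def)
  define \<theta> where "\<theta> = (\<lambda>n. \<alpha> * s n + \<beta>)"
  define G where "G = (\<lambda>n. r * (c + 1) * T + 153600 * gk * (\<alpha> * T * (\<theta> n * s n) + T * (\<theta> n ^ 3 * s n) + T * (\<theta> n ^ 6 * s n ^ 4)))"
  have th: "\<theta> \<longlonglongrightarrow> \<alpha> * 0 + \<beta>" unfolding \<theta>_def by (intro tendsto_intros s)
  have "G \<longlonglongrightarrow> r * (c + 1) * T + 153600 * gk * (\<alpha> * T * ((\<alpha> * 0 + \<beta>) * 0) + T * ((\<alpha> * 0 + \<beta>) ^ 3 * 0) + T * ((\<alpha> * 0 + \<beta>) ^ 6 * 0 ^ 4))"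
    unfolding G_def by (intro tendsto_intros s th)
  then have G: "G \<longlonglongrightarrow> r * (c + 1) * T" by simp
  have "\<forall>\<^sub>F n in sequentially. G n = real n * growth_rate r c \<alpha> \<beta> (T / real n)"
    using eventually_gt_at_top[of 0]
  proof eventually_elim
    case (elim n)
    have d: "T / real n = s n ^ 2" using T by (simp add: s_def)
    have T': "T = real n * s n ^ 2" using elim by (simp add: d[symmetric])
    have sq: "sqrt (s n ^ 2) = s n" using T by (simp add: s_def)
    show ?case unfolding growth_rate_def G_def d sq \<theta>_def
      by (subst T')+ (simp add: algebra_simps eval_nat_numeral)
  qed
  then show ?thesis using G by (rule Lim_transform_eventually[rotated])
qed

lemma sum_block: "(\<Sum>k<Suc i * r. h (k::nat)) = (\<Sum>k<i * r. h k) + (\<Sum>l<r. h (i * r + l) :: 'b::comm_monoid_add)"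
proof -
  have "{..<Suc i * r} = {..<i * r} \<union> {i * r..<i * r + r}" by auto
  then have "(\<Sum>k<Suc i * r. h k) = (\<Sum>k<i * r. h k) + (\<Sum>k\<in>{i * r..<i * r + r}. h k)"
    by (metis (no_types, lifting) finite_atLeastLessThan finite_lessThan ivl_disj_int_one(2) lessThan_atLeast0 sum.union_disjoint ivl_disj_int_two(3))
  also have "(\<Sum>k\<in>{i * r..<i * r + r}. h k) = (\<Sum>l<r. h (i * r + l))"
    by (rule sum.reindex_bij_witness[of _ "\<lambda>l. i * r + l" "\<lambda>k. k - i * r"]) auto
  finally show ?thesis .
qed

lemma (in finite_measure) measure_le_of_nn_integral:
  assumes A: "A \<in> sets M" and c: "0 < c" and C: "0 \<le> C" and int: "(\<integral>\<^sup>+\<omega>. \<phi> \<omega> \<partial>M) \<le> ennreal C"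
    and le: "\<And>\<omega>. \<omega> \<in> A \<Longrightarrow> ennreal c \<le> \<phi> \<omega>"
  shows "measure M A \<le> C / c"
proof -
  have "ennreal c * emeasure M A = (\<integral>\<^sup>+\<omega>. ennreal c * indicator A \<omega> \<partial>M)"
    using A by (simp add: nn_integral_cmult_indicator)
  also have "\<dots> \<le> (\<integral>\<^sup>+\<omega>. \<phi> \<omega> \<partial>M)"
    by (rule nn_integral_mono) (use le in \<open>auto split: split_indicator\<close>)
  also note int
  finally have "ennreal (c * measure M A) \<le> ennreal C"
    using c by (simp add: emeasure_eq_measure ennreal_mult)
  then have "c * measure M A \<le> C" using C by (simp add: ennreal_le_iff)
  then show ?thesis using c by (simp add: pos_le_divide_eq mult.commute)
qed

section \<open>Uniform convergence of Euler sums by comparison of nested grids\<close>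

context sde
begin

text \<open>A coarse Euler sum spread over the fine grid: the coefficients stay frozen over each
  block of \<open>r\<close> fine steps at the block start \<open>k div r * r\<close>, while the
  Brownian increments are the fine ones. Its difference from the fine Euler sum is again a chain on
  the fine grid.\<close>

definition coarse :: "real \<Rightarrow> nat \<Rightarrow> nat \<Rightarrow> 'a \<Rightarrow> real^'d" where
  "coarse \<delta> r n \<omega> = x0 + (\<Sum>k<n. \<delta> *\<^sub>R f (x (real (k div r * r) * \<delta>) \<omega>)
      + g (x (real (k div r * r) * \<delta>) \<omega>) *v (B (real (Suc k) * \<delta>) \<omega> - B (real k * \<delta>) \<omega>))"

text \<open>At block ends the fine Brownian increments of each block have telescoped to the coarse
  one.\<close>

lemma coarse_eq_euler:
  assumes r: "0 < r"
  shows "coarse \<delta> r (i * r) \<omega> = euler (real r * \<delta>) i \<omega>"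
proof (induction i)
  case 0 then show ?case by (simp add: coarse_def euler_def)
next
  case (Suc i)
  let ?h = "\<lambda>k. \<delta> *\<^sub>R f (x (real (k div r * r) * \<delta>) \<omega>)
      + g (x (real (k div r * r) * \<delta>) \<omega>) *v (B (real (Suc k) * \<delta>) \<omega> - B (real k * \<delta>) \<omega>)"
  let ?x = "x (real i * (real r * \<delta>)) \<omega>" and ?b = "\<lambda>k. B (real k * \<delta>) \<omega>"
  have h: "?h (i * r + l) = \<delta> *\<^sub>R f ?x + g ?x *v (?b (Suc (i * r + l)) - ?b (i * r + l))" if "l < r" for l
    using that by (simp add: mult.assoc)
  have tel: "(\<Sum>l<r. ?b (Suc (i * r + l)) - ?b (i * r + l)) = ?b (i * r + r) - ?b (i * r)"
    using sum_lessThan_telescope[of "\<lambda>l. ?b (i * r + l)" r] by simp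
  have "(\<Sum>l<r. ?h (i * r + l)) = (\<Sum>l<r. \<delta> *\<^sub>R f ?x + g ?x *v (?b (Suc (i * r + l)) - ?b (i * r + l)))"
    by (intro sum.cong) (use h in auto)
  also have "\<dots> = (real r * \<delta>) *\<^sub>R f ?x + g ?x *v (\<Sum>l<r. ?b (Suc (i * r + l)) - ?b (i * r + l))"
    by (simp add: sum.distrib linear_sum[OF matrix_vector_mul_linear] sum_constant_scaleR mult.commute del: sum_constant)
  also have "\<dots> = (real r * \<delta>) *\<^sub>R f ?x + g ?x *v (B (real (Suc i) * (real r * \<delta>)) \<omega> - B (real i * (real r * \<delta>)) \<omega>)"
    unfolding tel by (simp add: algebra_simps)
  finally show ?case using Suc unfolding coarse_def euler_def sum_block by (simp add: algebra_simps)
qed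

lemma coarse_M:
  assumes d: "0 \<le> \<delta>"
  shows "coarse \<delta> r n \<in> borel_measurable M"
proof -
  have [measurable]: "x (real (k div r * r) * \<delta>) \<in> borel_measurable M" "B (real k * \<delta>) \<in> borel_measurable M"
     "B (real (Suc k) * \<delta>) \<in> borel_measurable M" for k
    using d by (intro x_M B_M mult_nonneg_nonneg; simp)+
  show ?thesis unfolding coarse_def by measurable
qed

lemma refinement_estimate:
  assumes d: "0 < \<delta>" and r: "0 < r" and R: "0 < R" and e: "0 < \<epsilon>" and e': "0 \<le> \<epsilon>'" and eta: "0 < \<eta>"
  shows "measure M {\<omega>\<in>space M. (\<exists>j\<le>n. \<epsilon> < norm (euler \<delta> j \<omega> - coarse \<delta> r j \<omega>)) \<and>
       (\<forall>j\<le>n. norm (x (real j * \<delta>) \<omega>) \<le> R) \<and> (\<forall>j\<le>n. norm (x (real j * \<delta>) \<omega> - x (real (j div r * r) * \<delta>) \<omega>) \<le> \<epsilon>')}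
    \<le> exp (real n * growth_rate 1 1 (L R * \<epsilon>' / sqrt \<eta>) (L R * \<epsilon>' / sqrt \<eta>) \<delta>) * (\<eta> + real n * \<delta> * (2 * (L R * \<epsilon>')\<^sup>2)) / \<epsilon>\<^sup>2"
    (is "measure M ?A \<le> ?E * ?S / _")
proof -
  let ?t = "\<lambda>j. real j * \<delta>" and ?c = "\<lambda>j. real (j div r * r) * \<delta>"
  define y where "y = (\<lambda>j \<omega>. euler \<delta> j \<omega> - coarse \<delta> r j \<omega>)"
  define a where "a = (\<lambda>j \<omega>. f (x (?t j) \<omega>) - f (x (?c j) \<omega>))"
  define b where "b = (\<lambda>j \<omega>. g (x (?t j) \<omega>) - g (x (?c j) \<omega>))"
  define Q where "Q = (\<lambda>j \<omega>. norm (y j \<omega>) \<le> \<epsilon> \<and> norm (x (?t j) \<omega>) \<le> R \<and> norm (x (?t j) \<omega> - x (?c j) \<omega>) \<le> \<epsilon>')"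
  have cj: "0 \<le> ?c j" "?c j \<le> ?t j" "0 \<le> ?t j" for j
    using d by (auto intro!: mult_right_mono simp del: of_nat_mult)
  have xF: "x (?t j) \<in> borel_measurable (F (?t j))" "x (?c j) \<in> borel_measurable (F (?t j))" for j
    using x_F[OF cj(3)] measurable_F_mono[OF x_F[OF cj(1)] cj(1) cj(2)] by auto
  have step: "y (Suc i) \<omega> = y i \<omega> + \<delta> *\<^sub>R a i \<omega> + b i \<omega> *v (B (?t (Suc i)) \<omega> - B (?t i) \<omega>)" for i \<omega>
    unfolding y_def a_def b_def euler_def coarse_def by (simp add: algebra_simps)
  have yF: "y j \<in> borel_measurable (F (?t j))" for j
  proof (induction j)
    case 0 then show ?case by (simp add: y_def euler_def coarse_def)
  next
    case (Suc i)
    have ts: "?t i \<le> ?t (Suc i)" using d by simp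
    note up = measurable_F_mono[OF _ cj(3) ts]
    note [measurable] = up[OF Suc] up[OF xF(1)] up[OF xF(2)] up[OF B_F[OF cj(3)]] B_F[OF cj(3)[of "Suc i"]]
    show ?case unfolding step[abs_def] a_def b_def by measurable
  qed
  have yM: "y j \<in> borel_measurable M" for j using measurable_F_M[OF yF cj(3)] .
  have xM: "x (?t j) \<in> borel_measurable M" "x (?c j) \<in> borel_measurable M" for j using x_M cj by auto
  have ab: "norm (a i \<omega>) \<le> L R * \<epsilon>'" "norm (b i \<omega>) \<le> L R * \<epsilon>'" if Q: "\<And>j. j \<le> i \<Longrightarrow> Q j \<omega>" for i \<omega>
  proof -
    have "norm (x (?t i) \<omega>) \<le> R" "norm (x (?t i) \<omega> - x (?c i) \<omega>) \<le> \<epsilon>'" using Q[of i] by (auto simp: Q_def)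
    \<comment> \<open>The block start is an earlier index, so its bound comes from \<open>Q\<close>
      there; this uses that \<open>Q\<close> has held throughout.\<close>
    moreover have "norm (x (?c i) \<omega>) \<le> R" using Q[of "i div r * r"] by (auto simp: Q_def)
    ultimately show "norm (a i \<omega>) \<le> L R * \<epsilon>'" "norm (b i \<omega>) \<le> L R * \<epsilon>'"
      using f_lip[of "x (?t i) \<omega>" R "x (?c i) \<omega>"] g_lip[of "x (?t i) \<omega>" R "x (?c i) \<omega>"] R L_pos[OF R]
      unfolding a_def b_def by (auto elim!: order_trans intro!: mult_left_mono)
  qed
  define \<alpha> where "\<alpha> = L R * \<epsilon>' / sqrt \<eta>"
  have al0: "0 \<le> \<alpha>" using L_pos[OF R] e' eta by (simp add: \<alpha>_def)
  have al: "L R * \<epsilon>' \<le> \<alpha> * sqrt (\<eta> + (norm v)\<^sup>2)" for v :: "real^'d"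
  proof -
    have "L R * \<epsilon>' = \<alpha> * sqrt \<eta>" using eta by (simp add: \<alpha>_def)
    also have "\<dots> \<le> \<alpha> * sqrt (\<eta> + (norm v)\<^sup>2)" using al0 by (intro mult_left_mono) auto
    finally show ?thesis .
  qed
  have "(\<integral>\<^sup>+\<omega>. ennreal ((\<eta> + (norm (stopped y Q n \<omega>))\<^sup>2) powr 1) \<partial>M)
    \<le> ennreal (exp (real n * growth_rate 1 1 \<alpha> \<alpha> \<delta>)) *
       (ennreal ((\<eta> + (norm (0::real^'d))\<^sup>2) powr 1) + (\<Sum>i<n. ennreal (\<delta> * 1) * (\<integral>\<^sup>+\<omega>. ennreal ((2 * (L R * \<epsilon>')\<^sup>2) powr 1) \<partial>M)))"
  proof (rule stopped_moment_bound[OF d, where a = a and b = b])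
    show "{\<omega> \<in> space M. Q i \<omega>} \<in> sets (F (?t i))" for i
    proof -
      note [measurable] = yF[of i] xF[of i]
      have "{\<omega> \<in> space (F (?t i)). Q i \<omega>} \<in> sets (F (?t i))" unfolding Q_def by measurable
      then show ?thesis unfolding space_F[OF cj(3)[of i]] .
    qed
    show "a i \<in> borel_measurable (F (?t i))" "b i \<in> borel_measurable (F (?t i))" for i
      unfolding a_def b_def using xF[of i] by measurable
    show "norm (a i \<omega>) \<le> \<alpha> * sqrt (\<eta> + (norm (y i \<omega>))\<^sup>2)" if "\<And>j. j \<le> i \<Longrightarrow> Q j \<omega>" for i \<omega>
      using ab(1)[OF that] al order_trans by blast
    show "norm (b i \<omega>) \<le> \<alpha> * sqrt (\<eta> + (norm (y i \<omega>))\<^sup>2)" if "\<And>j. j \<le> i \<Longrightarrow> Q j \<omega>" for i \<omega>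
      using ab(2)[OF that] al order_trans by blast
    show "2 * inner (y i \<omega>) (a i \<omega>) + (2 * 1 - 1) * (norm (b i \<omega>))\<^sup>2 \<le> 1 * (\<eta> + (norm (y i \<omega>))\<^sup>2) + 2 * (L R * \<epsilon>')\<^sup>2"
      if "\<And>j. j \<le> i \<Longrightarrow> Q j \<omega>" for i \<omega>
    proof -
      have "0 \<le> (norm (y i \<omega> - a i \<omega>))\<^sup>2" by simp
      then have "2 * inner (y i \<omega>) (a i \<omega>) \<le> (norm (y i \<omega>))\<^sup>2 + (norm (a i \<omega>))\<^sup>2"
        unfolding power2_norm_eq_inner by (simp add: inner_diff_left inner_diff_right inner_commute)
      moreover have "(norm (a i \<omega>))\<^sup>2 \<le> (L R * \<epsilon>')\<^sup>2" "(norm (b i \<omega>))\<^sup>2 \<le> (L R * \<epsilon>')\<^sup>2"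
        using ab[OF that] by (auto intro!: power_mono)
      ultimately show ?thesis using eta by simp
    qed
  qed (use eta al0 step in \<open>auto simp: y_def euler_def coarse_def\<close>)
  also have "\<dots> = ennreal (?E * ?S)"
    using d eta emeasure_space_1
    by (simp add: \<alpha>_def ennreal_mult'[symmetric] ennreal_of_nat_eq_real_of_nat ennreal_plus[symmetric] mult_ac del: ennreal_plus)
  finally have bd: "(\<integral>\<^sup>+\<omega>. ennreal ((\<eta> + (norm (stopped y Q n \<omega>))\<^sup>2) powr 1) \<partial>M) \<le> ennreal (?E * ?S)" .
  note [measurable] = xM euler_M[OF less_imp_le[OF d]] coarse_M[OF less_imp_le[OF d]]
  have "?A \<in> sets M" by measurable
  then obtain A where A: "A = ?A" and AM: "A \<in> sets M" by blast
  have "measure M A \<le> ?E * ?S / \<epsilon>\<^sup>2"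
  proof (rule measure_le_of_nn_integral[OF AM _ _ bd])
    fix \<omega> assume True: "\<omega> \<in> A"
    obtain j where j: "j \<le> n" "stopped y Q n \<omega> = y j \<omega>" "\<And>k. k < j \<Longrightarrow> Q k \<omega>" "j = n \<or> \<not> Q j \<omega>"
      using stopped_cases[where n = n and y = y and Q = Q and \<omega> = \<omega>] by blast
    obtain k where k: "k \<le> n" "\<epsilon> < norm (y k \<omega>)" using True unfolding A y_def by blast
    have xj: "norm (x (?t j) \<omega>) \<le> R" "norm (x (?t j) \<omega> - x (?c j) \<omega>) \<le> \<epsilon>'"
      using True j(1) unfolding A by blast+
    have "\<not> Q k \<omega>" using k unfolding Q_def by linarith
    \<comment> \<open>\<open>Q\<close> fails at some k <= n, which cannot lie below j. If j = n this
      forces k = j; otherwise j is a failure by choice.\<close>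
    then have "\<not> Q j \<omega>" using j k by (metis le_less_trans le_neq_implies_less le_less)
    then have "\<epsilon> < norm (y j \<omega>)" using xj unfolding Q_def by linarith
    then have "\<epsilon>\<^sup>2 \<le> (norm (y j \<omega>))\<^sup>2" using e by (intro power_mono) auto
    then have "\<epsilon>\<^sup>2 \<le> (\<eta> + (norm (stopped y Q n \<omega>))\<^sup>2) powr 1" using j(2) eta by (simp add: add_nonneg_nonneg)
    then show "ennreal (\<epsilon>\<^sup>2) \<le> ennreal ((\<eta> + (norm (stopped y Q n \<omega>))\<^sup>2) powr 1)" by (rule ennreal_leI)
  qed (use e d eta in \<open>auto intro!: mult_nonneg_nonneg add_nonneg_nonneg\<close>)
  then show ?thesis unfolding A .
qed

text \<open>Convergence at a fixed time is spread to a whole grid by means of a finer one. For given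
  n, a large multiple n r makes the fine Euler sum close to \<open>x\<close> at each of the n + 1
  coarse times, which takes finitely many limits; \<open>refinement_estimate\<close> makes it close
  to the coarse sum as well. Since r depends on n, the exceptional sets for size (\<open>U\<close>)
  and oscillation (\<open>V\<close>) must cover all refinements at once.\<close>

lemma euler_uniformly_close:
  assumes T: "0 < T" and e: "0 < \<epsilon>"
  shows "(\<lambda>n. measure M {\<omega>\<in>space M. \<exists>i\<le>n. \<epsilon> < norm (euler (T / real n) i \<omega> - x (real i * (T / real n)) \<omega>)}) \<longlonglongrightarrow> 0"
proof (rule LIMSEQ_I)
  fix \<pi> :: real assume pi: "0 < \<pi>"
  have gridM: "x (real i * (T / real n)) \<in> borel_measurable M" for i n using T by (intro grid_M) auto
  have gridM2: "x (real (i div r * r) * (T / real n)) \<in> borel_measurable M" for i n r using gridM .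
  define U where "U = (\<lambda>R::nat. {\<omega>\<in>space M. \<exists>n. \<exists>j\<le>n. real R < norm (x (real j * (T / real n)) \<omega>)})"
  have UM: "U R \<in> sets M" for R
  proof -
    note [measurable] = gridM
    show ?thesis unfolding U_def by measurable
  qed
  have xT: "continuous_on {0..T} (\<lambda>s. x s \<omega>)" if "\<omega> \<in> space M" for \<omega>
    using x_cont[OF that] by (rule continuous_on_subset) auto
  have jT: "real j * (T / real n) \<in> {0..T}" if "j \<le> n" for j n
    using that T by (cases "n = 0") (auto simp: field_simps)
  have "(\<lambda>R. measure M (U R)) \<longlonglongrightarrow> 0"
  proof (rule measure_tendsto_0_pointwise[OF UM])
    fix \<omega> assume \<omega>: "\<omega> \<in> space M"
    have "bounded ((\<lambda>s. x s \<omega>) ` {0..T})"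
      by (intro compact_imp_bounded compact_continuous_image xT \<omega> compact_Icc)
    then obtain b where b: "\<And>s. s \<in> {0..T} \<Longrightarrow> norm (x s \<omega>) \<le> b" unfolding bounded_iff by blast
    have "\<omega> \<notin> U R" if "b \<le> real R" for R
      unfolding U_def using b[OF jT] that by (force simp: not_less[symmetric])
    moreover have "\<forall>\<^sub>F R in sequentially. b \<le> real R"
      using eventually_ge_at_top[of "nat \<lceil>b\<rceil>"] by eventually_elim linarith
    ultimately show "\<forall>\<^sub>F R in sequentially. \<omega> \<notin> U R" by (auto elim: eventually_mono)
  qed
  from order_tendstoD(2)[OF this, of "\<pi>/5"] pi have "\<forall>\<^sub>F R in sequentially. measure M (U R) < \<pi>/5" by simp
  then have "\<forall>\<^sub>F R in sequentially. measure M (U R) < \<pi>/5 \<and> 0 < R" using eventually_gt_at_top[of 0] by eventually_elim auto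
  then obtain R where R: "measure M (U R) < \<pi>/5" "0 < R" using eventually_happens' sequentially_bot by blast
  have LR: "0 < L R" using L_pos R by simp
  have e2: "0 < \<epsilon> / 2" using e by simp
  \<comment> \<open>The exponent is the limit 2T of the total growth rate for r = c = 1, with a
    slack of 1. Then \<eta> and \<epsilon>' are tuned so that each of the two terms of
    \<open>refinement_estimate\<close> contributes half of \<pi>/5.\<close>
  define Ex where "Ex = exp (2 * T + 1)"
  define \<eta> where "\<eta> = (\<epsilon>/2)\<^sup>2 * (\<pi>/5) / Ex / 2"
  have eta: "0 < \<eta>" using e pi by (simp add: \<eta>_def Ex_def)
  define \<epsilon>' where "\<epsilon>' = sqrt (\<eta> / (2 * T)) / L R"
  have e': "0 < \<epsilon>'" using eta T LR by (simp add: \<epsilon>'_def)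
  have small: "Ex * (\<eta> + T * (2 * (L R * \<epsilon>')\<^sup>2)) / (\<epsilon>/2)\<^sup>2 = \<pi>/5"
  proof -
    have "T * (2 * (L R * \<epsilon>')\<^sup>2) = \<eta>" using LR eta T by (simp add: \<epsilon>'_def)
    then show ?thesis using e by (simp add: \<eta>_def Ex_def)
  qed
  define V where "V = (\<lambda>n. {\<omega>\<in>space M. \<exists>r>0. \<exists>j\<le>n * r. \<epsilon>' < norm (x (real j * (T / real (n * r))) \<omega> - x (real (j div r * r) * (T / real (n * r))) \<omega>)})"
  have VM: "V n \<in> sets M" for n
  proof -
    note [measurable] = gridM gridM2
    show ?thesis unfolding V_def by measurable
  qed
  have "(\<lambda>n. measure M (V n)) \<longlonglongrightarrow> 0"
  proof (rule measure_tendsto_0_pointwise[OF VM])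
    fix \<omega> assume \<omega>: "\<omega> \<in> space M"
    from uniform_osc[OF xT[OF \<omega>] e'] obtain d where d: "0 < d"
      "\<And>s t. s \<in> {0..T} \<Longrightarrow> t \<in> {0..T} \<Longrightarrow> \<bar>t - s\<bar> < d \<Longrightarrow> dist (x t \<omega>) (x s \<omega>) < \<epsilon>'" by blast
    from step_small[OF d(1), of T] eventually_gt_at_top[of 0]
    show "\<forall>\<^sub>F n in sequentially. \<omega> \<notin> V n"
    proof eventually_elim
      case (elim n)
      have "norm (x (real j * (T / real (n * r))) \<omega> - x (real (j div r * r) * (T / real (n * r))) \<omega>) \<le> \<epsilon>'"
        if r: "0 < r" and j: "j \<le> n * r" for r j
      proof -
        let ?d = "T / real (n * r)"
        have d0: "0 < ?d" using T r elim by simp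
        have jr: "j div r * r \<le> j" by simp
        have "j = j div r * r + j mod r" by simp
        then have "real j = real (j div r * r) + real (j mod r)" by (metis of_nat_add)
        then have "real j * ?d - real (j div r * r) * ?d = real (j mod r) * ?d" by (simp add: algebra_simps del: of_nat_mult)
        moreover have "real (j mod r) * ?d \<le> real r * ?d" using d0 r by (intro mult_right_mono) (auto simp: less_imp_le)
        moreover have "real r * ?d = T / real n" using r by simp
        moreover have "0 \<le> real (j mod r) * ?d" by (rule mult_nonneg_nonneg[OF _ less_imp_le[OF d0]]) simp
        ultimately have "\<bar>real j * ?d - real (j div r * r) * ?d\<bar> < d" using elim by linarith
        from d(2)[OF jT[OF order_trans[OF jr j]] jT[OF j] this] show ?thesis by (simp add: dist_norm)
      qed
      then show ?case unfolding V_def by (auto simp: not_less)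
    qed
  qed
  from order_tendstoD(2)[OF this, of "\<pi>/5"] pi have "\<forall>\<^sub>F n in sequentially. measure M (V n) < \<pi>/5" by simp
  then obtain n0 where n0: "\<And>n. n0 \<le> n \<Longrightarrow> measure M (V n) < \<pi>/5" unfolding eventually_sequentially by blast
  show "\<exists>no. \<forall>n\<ge>no. norm (measure M {\<omega>\<in>space M. \<exists>i\<le>n. \<epsilon> < norm (euler (T / real n) i \<omega> - x (real i * (T / real n)) \<omega>)} - 0) < \<pi>"
  proof (intro exI[of _ "max 1 n0"] allI impI)
    fix n assume "max 1 n0 \<le> n"
    then have n: "0 < n" "n0 \<le> n" by auto
    let ?W = "{\<omega>\<in>space M. \<exists>i\<le>n. \<epsilon> < norm (euler (T / real n) i \<omega> - x (real i * (T / real n)) \<omega>)}"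
    define \<delta> where "\<delta> = (\<lambda>r. T / real (n * r))"
    have d0: "0 \<le> \<delta> r" for r using T by (simp add: \<delta>_def)
    have rd: "real r * \<delta> r = T / real n" if "0 < r" for r using that by (simp add: \<delta>_def)
    define P where "P = (\<lambda>i r. {\<omega>\<in>space M. \<epsilon> / 2 < norm (euler (\<delta> r) (i * r) \<omega> - x (real i * (T / real n)) \<omega>)})"
    have PM: "P i r \<in> sets M" for i r
    proof -
      note [measurable] = gridM euler_M[OF d0]
      show ?thesis unfolding P_def by measurable
    qed
    have "(\<lambda>r. measure M (P i r)) \<longlonglongrightarrow> 0" if i: "i \<le> n" for i
    proof (cases "i = 0")
      case True
      have "P 0 r = {}" for r using e2 by (auto simp: P_def euler_def x_0)
      then show ?thesis using True by simp
    next
      case False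
      have Ti: "0 < real i * (T / real n)" using False n T by simp
      \<comment> \<open>The time i T/n cut into i r steps has the same fine step as the whole
        interval cut into n r steps, so the fixed-time limit is taken along the subsequence i
        r.\<close>
      have sm: "filterlim (\<lambda>r. i * r) sequentially sequentially"
        using False by (intro filterlim_subseq strict_monoI) auto
      have "real i * (T / real n) / real (i * r) = \<delta> r" for r using False by (simp add: \<delta>_def)
      then show ?thesis using filterlim_compose[OF euler_tendsto_in_measure[OF Ti e2] sm] by (simp add: P_def)
    qed
    then have "(\<lambda>r. \<Sum>i\<le>n. measure M (P i r)) \<longlonglongrightarrow> (\<Sum>i\<le>n. 0)" by (intro tendsto_sum) auto
    then have "\<forall>\<^sub>F r in sequentially. (\<Sum>i\<le>n. measure M (P i r)) < \<pi>/5"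
      using order_tendstoD(2)[of "\<lambda>r. \<Sum>i\<le>n. measure M (P i r)" 0 sequentially "\<pi>/5"] pi by simp
    moreover have "\<forall>\<^sub>F r in sequentially. real (n * r) * growth_rate 1 1 (L R * \<epsilon>' / sqrt \<eta>) (L R * \<epsilon>' / sqrt \<eta>) (\<delta> r) < 2 * T + 1"
    proof -
      have sm: "filterlim (\<lambda>r. n * r) sequentially sequentially"
        using n by (intro filterlim_subseq strict_monoI) auto
      from filterlim_compose[OF growth_rate_tendsto[OF T, of 1 1 "L R * \<epsilon>' / sqrt \<eta>" "L R * \<epsilon>' / sqrt \<eta>"] sm]
      show ?thesis unfolding \<delta>_def by (rule order_tendstoD(2)) simp
    qed
    ultimately have "\<forall>\<^sub>F r in sequentially. (\<Sum>i\<le>n. measure M (P i r)) < \<pi>/5 \<and>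
        real (n * r) * growth_rate 1 1 (L R * \<epsilon>' / sqrt \<eta>) (L R * \<epsilon>' / sqrt \<eta>) (\<delta> r) < 2 * T + 1 \<and> 0 < r"
      using eventually_gt_at_top[of 0] by eventually_elim auto
    then obtain r where r: "(\<Sum>i\<le>n. measure M (P i r)) < \<pi>/5"
        "real (n * r) * growth_rate 1 1 (L R * \<epsilon>' / sqrt \<eta>) (L R * \<epsilon>' / sqrt \<eta>) (\<delta> r) < 2 * T + 1" "0 < r"
      using eventually_happens' sequentially_bot by blast
    have dp: "0 < \<delta> r" using T n r by (simp add: \<delta>_def)
    define Y where "Y = {\<omega>\<in>space M. (\<exists>j\<le>n * r. \<epsilon> / 2 < norm (euler (\<delta> r) j \<omega> - coarse (\<delta> r) r j \<omega>)) \<and>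
       (\<forall>j\<le>n * r. norm (x (real j * \<delta> r) \<omega>) \<le> real R) \<and> (\<forall>j\<le>n * r. norm (x (real j * \<delta> r) \<omega> - x (real (j div r * r) * \<delta> r) \<omega>) \<le> \<epsilon>')}"
    have YM: "Y \<in> sets M"
    proof -
      have [measurable]: "x (real j * \<delta> r) \<in> borel_measurable M" "x (real (j div r * r) * \<delta> r) \<in> borel_measurable M" for j
        unfolding \<delta>_def by (rule gridM gridM2)+
      note [measurable] = euler_M[OF d0] coarse_M[OF d0]
      show ?thesis unfolding Y_def by measurable
    qed
    have "measure M Y \<le> exp (real (n * r) * growth_rate 1 1 (L R * \<epsilon>' / sqrt \<eta>) (L R * \<epsilon>' / sqrt \<eta>) (\<delta> r)) *
        (\<eta> + real (n * r) * \<delta> r * (2 * (L R * \<epsilon>')\<^sup>2)) / (\<epsilon>/2)\<^sup>2"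
      unfolding Y_def by (rule refinement_estimate[OF dp r(3) _ e2 _ eta]) (use R e' in auto)
    also have "\<dots> \<le> Ex * (\<eta> + T * (2 * (L R * \<epsilon>')\<^sup>2)) / (\<epsilon>/2)\<^sup>2"
    proof -
      have nd: "real (n * r) * \<delta> r = T" using n r by (simp add: \<delta>_def)
      show ?thesis unfolding nd Ex_def
        by (intro divide_right_mono mult_right_mono) (use r(2) T eta in \<open>auto intro!: add_nonneg_nonneg simp del: of_nat_mult\<close>)
    qed
    finally have Y5: "measure M Y \<le> \<pi>/5" using small by simp
    have sub: "?W \<subseteq> U R \<union> (V n \<union> (Y \<union> (\<Union>i\<in>{..n}. P i r)))"
    proof
      fix \<omega> assume "\<omega> \<in> ?W"
      then obtain i where \<omega>: "\<omega> \<in> space M" and i: "i \<le> n" "\<epsilon> < norm (euler (T / real n) i \<omega> - x (real i * (T / real n)) \<omega>)" by blast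
      show "\<omega> \<in> U R \<union> (V n \<union> (Y \<union> (\<Union>i\<in>{..n}. P i r)))"
      proof (rule ccontr)
        assume "\<omega> \<notin> U R \<union> (V n \<union> (Y \<union> (\<Union>i\<in>{..n}. P i r)))"
        then have no: "\<omega> \<notin> U R" "\<omega> \<notin> V n" "\<omega> \<notin> Y" "\<omega> \<notin> P i r" using i(1) by blast+
        have 1: "norm (x (real j * \<delta> r) \<omega>) \<le> real R" if j: "j \<le> n * r" for j
        proof (rule ccontr)
          assume "\<not> norm (x (real j * \<delta> r) \<omega>) \<le> real R"
          then have "real R < norm (x (real j * \<delta> r) \<omega>)" by (rule not_le_imp_less)
          then have "\<omega> \<in> U R" unfolding U_def \<delta>_def using \<omega> j by blast
          then show False using no by blast
        qed
        have 2: "norm (x (real j * \<delta> r) \<omega> - x (real (j div r * r) * \<delta> r) \<omega>) \<le> \<epsilon>'" if j: "j \<le> n * r" for j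
        proof (rule ccontr)
          assume "\<not> norm (x (real j * \<delta> r) \<omega> - x (real (j div r * r) * \<delta> r) \<omega>) \<le> \<epsilon>'"
          then have "\<epsilon>' < norm (x (real j * \<delta> r) \<omega> - x (real (j div r * r) * \<delta> r) \<omega>)" by (rule not_le_imp_less)
          then have "\<omega> \<in> V n" unfolding V_def \<delta>_def using \<omega> j r(3) by blast
          then show False using no by blast
        qed
        have 3: "norm (euler (\<delta> r) j \<omega> - coarse (\<delta> r) r j \<omega>) \<le> \<epsilon> / 2" if j: "j \<le> n * r" for j
        proof (rule ccontr)
          assume "\<not> norm (euler (\<delta> r) j \<omega> - coarse (\<delta> r) r j \<omega>) \<le> \<epsilon> / 2"
          then have "\<epsilon> / 2 < norm (euler (\<delta> r) j \<omega> - coarse (\<delta> r) r j \<omega>)" by (rule not_le_imp_less)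
          then have "\<omega> \<in> Y" unfolding Y_def using \<omega> j 1 2 by blast
          then show False using no by blast
        qed
        have "norm (euler (\<delta> r) (i * r) \<omega> - euler (T / real n) i \<omega>) \<le> \<epsilon> / 2"
          using 3[of "i * r"] i coarse_eq_euler[OF r(3), of "\<delta> r" i \<omega>] rd[OF r(3)] by simp
        moreover have "norm (euler (\<delta> r) (i * r) \<omega> - x (real i * (T / real n)) \<omega>) \<le> \<epsilon> / 2"
          using no(4) \<omega> unfolding P_def by auto
        ultimately show False using i(2)
          norm_triangle_ineq4[of "euler (\<delta> r) (i * r) \<omega> - x (real i * (T / real n)) \<omega>" "euler (\<delta> r) (i * r) \<omega> - euler (T / real n) i \<omega>"] by simp
      qed
    qed
    have uP: "(\<Union>i\<in>{..n}. P i r) \<in> sets M" using PM by (intro sets.finite_UN) auto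
    have "measure M ?W \<le> measure M (U R \<union> (V n \<union> (Y \<union> (\<Union>i\<in>{..n}. P i r))))"
      using UM VM YM uP by (intro finite_measure_mono[OF sub]) auto
    also have "\<dots> \<le> measure M (U R) + (measure M (V n) + (measure M Y + measure M (\<Union>i\<in>{..n}. P i r)))"
      using UM VM YM uP by (intro order_trans[OF measure_Un_le] add_left_mono order_refl sets.Un)
    also have "measure M (\<Union>i\<in>{..n}. P i r) \<le> (\<Sum>i\<le>n. measure M (P i r))"
      using PM by (intro measure_UNION_le) auto
    finally have "measure M ?W < \<pi>" using R n0[OF n(2)] Y5 r(1) pi by linarith
    then show "norm (measure M ?W - 0) < \<pi>" unfolding diff_zero real_norm_def abs_of_nonneg[OF measure_nonneg] .
  qed
qed

end

section \<open>Moments of the solution\<close>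

locale coercive_sde = sde +
  fixes p K :: real
  assumes p: "2 < p" "p \<le> 6" and K: "0 < K"
    and coercive: "inner y (f y) + (p - 1) / 2 * (norm (g y))\<^sup>2 \<le> K * (1 + (norm y)\<^sup>2)"
begin

text \<open>Closeness of the Euler sum to \<open>x\<close> belongs to the condition because the
  coefficients of the sum are taken at \<open>x\<close>: coercivity controls <x, f(x)>, whereas the
  expansion produces <z, f(x)> with z the Euler sum.\<close>

definition good :: "real \<Rightarrow> real \<Rightarrow> real \<Rightarrow> nat \<Rightarrow> 'a \<Rightarrow> bool" where
  "good \<delta> R \<epsilon> i \<omega> \<longleftrightarrow> norm (x (real i * \<delta>) \<omega>) \<le> R \<and> norm (euler \<delta> i \<omega> - x (real i * \<delta>) \<omega>) \<le> \<epsilon>"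

lemma euler_F:
  assumes d: "0 < \<delta>"
  shows "euler \<delta> i \<in> borel_measurable (F (real i * \<delta>))"
proof (induction i)
  case 0 then show ?case by (simp add: euler_def)
next
  case (Suc i)
  have t0: "0 \<le> real j * \<delta>" for j using d by simp
  have ts: "real i * \<delta> \<le> real (Suc i) * \<delta>" using d by simp
  note up = measurable_F_mono[OF _ t0 ts]
  note [measurable] = up[OF Suc] up[OF x_F[OF t0]] up[OF B_F[OF t0]] B_F[OF t0[of "Suc i"]]
  have "euler \<delta> (Suc i) = (\<lambda>\<omega>. euler \<delta> i \<omega> + \<delta> *\<^sub>R f (x (real i * \<delta>) \<omega>)
      + g (x (real i * \<delta>) \<omega>) *v (B (real (Suc i) * \<delta>) \<omega> - B (real i * \<delta>) \<omega>))"
    unfolding euler_def by (auto simp: algebra_simps)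
  also have "\<dots> \<in> borel_measurable (F (real (Suc i) * \<delta>))" by measurable
  finally show ?case .
qed

lemma good_F: "0 < \<delta> \<Longrightarrow> {\<omega>\<in>space M. good \<delta> R \<epsilon> i \<omega>} \<in> sets (F (real i * \<delta>))"
proof -
  assume d: "0 < \<delta>"
  have t0: "0 \<le> real i * \<delta>" using d by simp
  note [measurable] = euler_F[OF d] x_F[OF t0]
  have "{\<omega>\<in>space (F (real i * \<delta>)). good \<delta> R \<epsilon> i \<omega>} \<in> sets (F (real i * \<delta>))"
    unfolding good_def by measurable
  then show ?thesis unfolding space_F[OF t0] .
qed

text \<open>The exponent is the limiting growth rate for r = p/2 and c = 4K plus a slack of 1;
  \<open>T0 * (p / 2)\<close> collects the source term 1 of every step. The stopping radius does not
  occur, which permits letting it grow.\<close>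

definition moment_bound :: "real \<Rightarrow> real" where
  "moment_bound T0 = exp (p / 2 * (4 * K + 1) * T0 + 1) * ((1 + (norm x0)\<^sup>2) powr (p / 2) + T0 * (p / 2))"

lemma moment_bound_nonneg: "0 \<le> T0 \<Longrightarrow> 0 \<le> moment_bound T0"
  unfolding moment_bound_def using p by simp

text \<open>Replacing x by the Euler sum z costs 2 \<epsilon> |f(x)| in the inner product, and |x|^2
  <= 2 |z|^2 + 2 \<epsilon>^2 on the right turns 2K into 4K. Since |f| <= a on the ball of radius R,
  an \<epsilon> depending on R keeps the total error below the source term 1, and the final bound is
  free of R.\<close>

lemma euler_stopped_moment:
  assumes T: "0 < T" "T \<le> T0" and R: "0 < R"
  obtains \<epsilon> where "0 < \<epsilon>" "\<epsilon> \<le> 1/2"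
    "\<forall>\<^sub>F n in sequentially. (\<integral>\<^sup>+\<omega>. ennreal ((1 + (norm (stopped (euler (T / real n)) (good (T / real n) R \<epsilon>) n \<omega>))\<^sup>2) powr (p / 2)) \<partial>M)
       \<le> ennreal (moment_bound T0)"
proof -
  define a where "a = norm (f 0) + L R * R"
  define b where "b = norm (g 0) + L R * R"
  have LR: "0 < L R" using L_pos R by simp
  have ab: "0 \<le> a" "0 \<le> b" using LR R by (auto simp: a_def b_def)
  define \<epsilon> where "\<epsilon> = min (1/2) (1 / (2 * a + 2 * K))"
  have e0: "0 < \<epsilon>" "\<epsilon> \<le> 1/2" using ab K by (auto simp: \<epsilon>_def)
  have "\<epsilon> * (2 * a + 2 * K) \<le> 1 / (2 * a + 2 * K) * (2 * a + 2 * K)"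
    using ab K by (intro mult_right_mono) (auto simp: \<epsilon>_def)
  then have e1: "2 * \<epsilon> * a + 2 * \<epsilon> * K \<le> 1" using ab K by (simp add: algebra_simps)
  have "4 * K * \<epsilon>\<^sup>2 \<le> 2 * \<epsilon> * K"
    using e0 K mult_left_mono[of "2 * \<epsilon>" 1 "2 * \<epsilon> * K"] by (simp add: power2_eq_square algebra_simps)
  with e1 have e2: "2 * \<epsilon> * a + 4 * K * \<epsilon>\<^sup>2 \<le> 1" by linarith
  let ?r = "p / 2"
  have fin: "(\<integral>\<^sup>+\<omega>. ennreal ((1 + (norm (stopped (euler \<delta>) (good \<delta> R \<epsilon>) n \<omega>))\<^sup>2) powr ?r) \<partial>M)
    \<le> ennreal (exp (real n * growth_rate ?r (4 * K) a b \<delta>)) *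
       (ennreal ((1 + (norm x0)\<^sup>2) powr ?r) + (\<Sum>i<n. ennreal (\<delta> * ?r) * (\<integral>\<^sup>+\<omega>. ennreal (1 powr ?r) \<partial>M)))"
    if d: "0 < \<delta>" for \<delta> n
  proof (rule stopped_moment_bound[OF d, where a = "\<lambda>i \<omega>. f (x (real i * \<delta>) \<omega>)" and b = "\<lambda>i \<omega>. g (x (real i * \<delta>) \<omega>)"])
    have t0: "0 \<le> real i * \<delta>" for i using d by simp
    show "(\<lambda>\<omega>. f (x (real i * \<delta>) \<omega>)) \<in> borel_measurable (F (real i * \<delta>))"
         "(\<lambda>\<omega>. g (x (real i * \<delta>) \<omega>)) \<in> borel_measurable (F (real i * \<delta>))" for i
      using x_F[OF t0[of i]] by measurable
    show "{\<omega> \<in> space M. good \<delta> R \<epsilon> i \<omega>} \<in> sets (F (real i * \<delta>))" for i by (rule good_F[OF d])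
    fix i \<omega> assume G: "\<And>j. j \<le> i \<Longrightarrow> good \<delta> R \<epsilon> j \<omega>"
    let ?x = "x (real i * \<delta>) \<omega>" and ?z = "euler \<delta> i \<omega>"
    from G[of i] have xR: "norm ?x \<le> R" and zx: "norm (?z - ?x) \<le> \<epsilon>" by (auto simp: good_def)
    have fa: "norm (f ?x) \<le> a" and gb: "norm (g ?x) \<le> b" using f_bound g_bound xR R by (auto simp: a_def b_def)
    have s1: "1 \<le> sqrt (1 + (norm ?z)\<^sup>2)" by simp
    show "norm (f ?x) \<le> a * sqrt (1 + (norm ?z)\<^sup>2)" using fa mult_left_mono[OF s1 ab(1)] by linarith
    show "norm (g ?x) \<le> b * sqrt (1 + (norm ?z)\<^sup>2)" using gb mult_left_mono[OF s1 ab(2)] by linarith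
    have "inner (?z - ?x) (f ?x) \<le> norm (?z - ?x) * norm (f ?x)" by (rule norm_cauchy_schwarz)
    also have "\<dots> \<le> \<epsilon> * a" using zx fa e0 by (intro mult_mono) auto
    finally have i1: "inner ?z (f ?x) \<le> inner ?x (f ?x) + \<epsilon> * a" by (simp add: inner_diff_left)
    have "norm ?x \<le> norm ?z + norm (?z - ?x)" by (metis norm_minus_commute norm_triangle_sub)
    then have "(norm ?x)\<^sup>2 \<le> (norm ?z + \<epsilon>)\<^sup>2" using zx by (intro power_mono) auto
    also have "\<dots> \<le> 2 * (norm ?z)\<^sup>2 + 2 * \<epsilon>\<^sup>2"
      using zero_le_power2[of "norm ?z - \<epsilon>"] unfolding power2_diff power2_sum by linarith
    finally have "K * (norm ?x)\<^sup>2 \<le> K * (2 * (norm ?z)\<^sup>2 + 2 * \<epsilon>\<^sup>2)" using K by (intro mult_left_mono) auto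
    moreover have "2 * inner ?x (f ?x) + (p - 1) * (norm (g ?x))\<^sup>2 \<le> 2 * K * (1 + (norm ?x)\<^sup>2)"
      using coercive[of ?x] by (simp add: field_simps)
    ultimately show "2 * inner ?z (f ?x) + (2 * (p/2) - 1) * (norm (g ?x))\<^sup>2 \<le> 4 * K * (1 + (norm ?z)\<^sup>2) + 1"
      using i1 e2 K by (simp add: algebra_simps)
  qed (use p ab K in \<open>auto simp: euler_def algebra_simps\<close>)
  have "(\<lambda>n. real n * growth_rate ?r (4 * K) a b (T / real n)) \<longlonglongrightarrow> ?r * (4 * K + 1) * T"
    by (rule growth_rate_tendsto[OF T(1)])
  then have "\<forall>\<^sub>F n in sequentially. real n * growth_rate ?r (4 * K) a b (T / real n) < ?r * (4 * K + 1) * T + 1"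
    by (rule order_tendstoD(2)) simp
  then have "\<forall>\<^sub>F n in sequentially. (\<integral>\<^sup>+\<omega>. ennreal ((1 + (norm (stopped (euler (T / real n)) (good (T / real n) R \<epsilon>) n \<omega>))\<^sup>2) powr ?r) \<partial>M)
       \<le> ennreal (moment_bound T0)"
    using eventually_gt_at_top[of 0]
  proof eventually_elim
    case (elim n)
    have d: "0 < T / real n" using T elim by simp
    have nd: "real n * (T / real n) = T" using elim by simp
    note fin[OF d, of n]
    also have "(\<Sum>i<n. ennreal (T / real n * ?r) * (\<integral>\<^sup>+\<omega>. ennreal (1 powr ?r) \<partial>M)) = ennreal (T * ?r)"
      using nd emeasure_space_1 d p
      by (simp add: ennreal_of_nat_eq_real_of_nat ennreal_mult'[symmetric] mult.assoc[symmetric] del: times_divide_eq_right times_divide_eq_left)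
    also have "ennreal (exp (real n * growth_rate ?r (4 * K) a b (T / real n))) * (ennreal ((1 + (norm x0)\<^sup>2) powr ?r) + ennreal (T * ?r)) =
       ennreal (exp (real n * growth_rate ?r (4 * K) a b (T / real n)) * ((1 + (norm x0)\<^sup>2) powr ?r + T * ?r))"
      using T p by (simp add: ennreal_mult' ennreal_plus)
    also have "\<dots> \<le> ennreal (moment_bound T0)"
    proof (rule ennreal_leI)
      have "?r * (4 * K + 1) * T \<le> ?r * (4 * K + 1) * T0" using T K p by (intro mult_left_mono) auto
      then have "real n * growth_rate ?r (4 * K) a b (T / real n) \<le> ?r * (4 * K + 1) * T0 + 1" using elim(1) by linarith
      moreover have "T * ?r \<le> T0 * ?r" using T p by (intro mult_right_mono) auto
      ultimately show "exp (real n * growth_rate ?r (4 * K) a b (T / real n)) * ((1 + (norm x0)\<^sup>2) powr ?r + T * ?r) \<le> moment_bound T0"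
        unfolding moment_bound_def using T p by (intro mult_mono) auto
    qed
    finally show ?case .
  qed
  then show ?thesis using that e0 by blast
qed

lemma exceed_grid:
  assumes T: "0 < T" "T \<le> T0" and R: "1 \<le> R"
  shows "\<forall>\<^sub>F n in sequentially. measure M {\<omega>\<in>space M. \<exists>i\<le>n. R < norm (x (real i * (T / real n)) \<omega>)} \<le> (1 + 64 * moment_bound T0) / R powr p"
proof -
  have R0: "0 < R" using R by simp
  obtain \<epsilon> where e: "0 < \<epsilon>" "\<epsilon> \<le> 1/2" and ev:
    "\<forall>\<^sub>F n in sequentially. (\<integral>\<^sup>+\<omega>. ennreal ((1 + (norm (stopped (euler (T / real n)) (good (T / real n) R \<epsilon>) n \<omega>))\<^sup>2) powr (p / 2)) \<partial>M)
       \<le> ennreal (moment_bound T0)"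
    using euler_stopped_moment[OF T R0] by blast
  have "\<forall>\<^sub>F n in sequentially. measure M {\<omega>\<in>space M. \<exists>i\<le>n. \<epsilon> < norm (euler (T / real n) i \<omega> - x (real i * (T / real n)) \<omega>)} < 1 / R powr p"
    using order_tendstoD(2)[OF euler_uniformly_close[OF T(1) e(1)]] R by simp
  with ev show ?thesis
    using eventually_gt_at_top[of 0]
  proof eventually_elim
    case (elim n)
    let ?d = "T / real n"
    have d: "0 < ?d" using T elim by simp
    define U where "U = {\<omega>\<in>space M. \<exists>i\<le>n. \<epsilon> < norm (euler ?d i \<omega> - x (real i * ?d) \<omega>)}"
    define X where "X = {\<omega>\<in>space M. \<exists>i\<le>n. R < norm (x (real i * ?d) \<omega>)}"
    note [measurable] = euler_M[OF less_imp_le[OF d]] grid_M[OF less_imp_le[OF d]]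
    have U: "U \<in> sets M" unfolding U_def by measurable
    have X: "X \<in> sets M" unfolding X_def by measurable
    have "measure M (X - U) \<le> moment_bound T0 / (R powr p / 64)"
    proof (rule measure_le_of_nn_integral[OF sets.Diff[OF X U] _ moment_bound_nonneg elim(1)])
      fix \<omega> assume \<omega>: "\<omega> \<in> X - U"
      then obtain i where i: "i \<le> n" "R < norm (x (real i * ?d) \<omega>)" unfolding X_def by blast
      have U': "norm (euler ?d j \<omega> - x (real j * ?d) \<omega>) \<le> \<epsilon>" if j: "j \<le> n" for j
      proof (rule ccontr)
        assume "\<not> norm (euler ?d j \<omega> - x (real j * ?d) \<omega>) \<le> \<epsilon>"
        then have "\<epsilon> < norm (euler ?d j \<omega> - x (real j * ?d) \<omega>)" by (rule not_le_imp_less)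
        then show False using \<omega> j unfolding U_def X_def by blast
      qed
      obtain j where j: "j \<le> n" "stopped (euler ?d) (good ?d R \<epsilon>) n \<omega> = euler ?d j \<omega>"
        "\<And>k. k < j \<Longrightarrow> good ?d R \<epsilon> k \<omega>" "j = n \<or> \<not> good ?d R \<epsilon> j \<omega>"
        using stopped_cases[where n = n and y = "euler ?d" and Q = "good ?d R \<epsilon>" and \<omega> = \<omega>] by blast
      have "\<not> good ?d R \<epsilon> i \<omega>" using i unfolding good_def by linarith
      then have "\<not> good ?d R \<epsilon> j \<omega>" using j i by (metis le_less_trans le_neq_implies_less le_less)
      then have "R < norm (x (real j * ?d) \<omega>)" using U'[OF j(1)] unfolding good_def by linarith
      then have "R - \<epsilon> \<le> norm (euler ?d j \<omega>)" using U'[OF j(1)] norm_triangle_sub[of "x (real j * ?d) \<omega>" "euler ?d j \<omega>"]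
        by (simp add: norm_minus_commute)
      then have "R / 2 \<le> norm (euler ?d j \<omega>)" using e R by linarith
      then have "(R / 2)\<^sup>2 \<le> (norm (euler ?d j \<omega>))\<^sup>2" using R by (intro power_mono) auto
      then have "(R / 2)\<^sup>2 \<le> 1 + (norm (euler ?d j \<omega>))\<^sup>2" by linarith
      then have "((R / 2)\<^sup>2) powr (p/2) \<le> (1 + (norm (euler ?d j \<omega>))\<^sup>2) powr (p/2)" using p by (intro powr_mono2) auto
      moreover have "((R / 2)\<^sup>2) powr (p/2) = (R/2) powr p" using R by (simp add: powr_powr flip: powr_numeral)
      moreover have "R powr p / 64 \<le> (R / 2) powr p"
      proof -
        have "2 powr p \<le> 2 powr 6" using p by (intro powr_mono) auto
        then have "2 powr p \<le> (64::real)" by simp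
        then have "R powr p / 64 \<le> R powr p / 2 powr p" by (intro divide_left_mono) auto
        then show ?thesis using R by (simp add: powr_divide)
      qed
      ultimately show "ennreal (R powr p / 64) \<le> ennreal ((1 + (norm (stopped (euler ?d) (good ?d R \<epsilon>) n \<omega>))\<^sup>2) powr (p / 2))"
        unfolding j(2) by (intro ennreal_leI) linarith
    qed (use R T in auto)
    moreover have "measure M X \<le> measure M (X - U) + measure M U"
    proof -
      have "measure M X \<le> measure M ((X - U) \<union> U)" by (rule finite_measure_mono) (use X U in \<open>auto intro: sets.Un sets.Diff\<close>)
      also have "\<dots> \<le> measure M (X - U) + measure M U" by (rule measure_Un_le[OF sets.Diff[OF X U] U])
      finally show ?thesis .
    qed
    moreover have "1 / R powr p + moment_bound T0 / (R powr p / 64) = (1 + 64 * moment_bound T0) / R powr p"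
      using R by (simp add: field_simps)
    ultimately show ?case using elim(2) unfolding U_def X_def by linarith
  qed
qed

text \<open>Truncation serves because \<open>x\<close> can be replaced by an Euler sum only off an
  event of small probability, and on that event a bounded integrand is needed.\<close>

lemma nn_integral_le_of_truncations:
  fixes X :: "'a \<Rightarrow> real"
  assumes [measurable]: "X \<in> borel_measurable M" and le: "\<And>m. 1 \<le> m \<Longrightarrow> (\<integral>\<^sup>+\<omega>. ennreal (min (X \<omega>) m) \<partial>M) \<le> C"
  shows "(\<integral>\<^sup>+\<omega>. ennreal (X \<omega>) \<partial>M) \<le> C"
proof -
  have "(SUP m. ennreal (min a (real (Suc m)))) = ennreal a" for a
  proof (rule antisym)
    show "(SUP m. ennreal (min a (real (Suc m)))) \<le> ennreal a" by (intro SUP_least ennreal_leI) simp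
    have "ennreal a = ennreal (min a (real (Suc (nat \<lceil>a\<rceil>))))" by (intro arg_cong[of _ _ ennreal]) linarith
    also have "\<dots> \<le> (SUP m. ennreal (min a (real (Suc m))))" by (rule SUP_upper) simp
    finally show "ennreal a \<le> (SUP m. ennreal (min a (real (Suc m))))" .
  qed
  then have "(\<integral>\<^sup>+\<omega>. ennreal (X \<omega>) \<partial>M) = (\<integral>\<^sup>+\<omega>. (SUP m. ennreal (min (X \<omega>) (real (Suc m)))) \<partial>M)" by simp
  also have "\<dots> = (SUP m. \<integral>\<^sup>+\<omega>. ennreal (min (X \<omega>) (real (Suc m))) \<partial>M)"
    by (rule nn_integral_monotone_convergence_SUP) (auto simp: incseq_def le_fun_def intro!: ennreal_leI min.mono)
  also have "\<dots> \<le> C" by (intro SUP_least le) simp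
  finally show ?thesis .
qed

lemma solution_moment:
  assumes T: "0 < T" "T \<le> T0"
  shows "(\<integral>\<^sup>+\<omega>. ennreal (norm (x T \<omega>) powr p) \<partial>M) \<le> ennreal (8 * moment_bound T0 + 1)"
proof (rule nn_integral_le_of_truncations)
  show xm: "(\<lambda>\<omega>. norm (x T \<omega>) powr p) \<in> borel_measurable M"
    by (intro powr_real_measurable borel_measurable_const measurable_compose[OF x_M[OF less_imp_le[OF T(1)]] borel_measurable_norm])
  fix m :: real assume m: "1 \<le> m"
  define C where "C = 1 + 64 * moment_bound T0"
  have C: "1 \<le> C" using moment_bound_nonneg[of T0] T by (simp add: C_def)
  \<comment> \<open>With this radius the exit probability is at most C/R^p <= C/R = 1/(2m). Together
    with 1/(2m) for the deviation of the Euler sum, the integrand truncated at m contributes at most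
    1 on the exceptional set.\<close>
  define R where "R = 2 * m * C"
  have R: "1 \<le> R" using m C mult_mono[of 1 m 1 C] by (simp add: R_def)
  have R0: "0 < R" using R by simp
  obtain \<epsilon> where e: "0 < \<epsilon>" "\<epsilon> \<le> 1/2" and ev:
    "\<forall>\<^sub>F n in sequentially. (\<integral>\<^sup>+\<omega>. ennreal ((1 + (norm (stopped (euler (T / real n)) (good (T / real n) R \<epsilon>) n \<omega>))\<^sup>2) powr (p / 2)) \<partial>M)
       \<le> ennreal (moment_bound T0)"
    using euler_stopped_moment[OF T R0] by blast
  have "\<forall>\<^sub>F n in sequentially. measure M {\<omega>\<in>space M. \<exists>i\<le>n. \<epsilon> < norm (euler (T / real n) i \<omega> - x (real i * (T / real n)) \<omega>)} < 1 / (2 * m)"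
    using order_tendstoD(2)[OF euler_uniformly_close[OF T(1) e(1)]] m by simp
  with ev exceed_grid[OF T R] have "\<forall>\<^sub>F n in sequentially. (\<integral>\<^sup>+\<omega>. ennreal (min (norm (x T \<omega>) powr p) m) \<partial>M) \<le> ennreal (8 * moment_bound T0 + 1)"
    using eventually_gt_at_top[of 0]
  proof eventually_elim
    case (elim n)
    let ?d = "T / real n"
    have d: "0 < ?d" using T elim by simp
    have nd: "real n * ?d = T" using elim by simp
    define U where "U = {\<omega>\<in>space M. \<exists>i\<le>n. \<epsilon> < norm (euler ?d i \<omega> - x (real i * ?d) \<omega>)}"
    define X where "X = {\<omega>\<in>space M. \<exists>i\<le>n. R < norm (x (real i * ?d) \<omega>)}"
    note [measurable] = euler_M[OF less_imp_le[OF d]] grid_M[OF less_imp_le[OF d]]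
    have U: "U \<in> sets M" unfolding U_def by measurable
    have X: "X \<in> sets M" unfolding X_def by measurable
    let ?S = "stopped (euler ?d) (good ?d R \<epsilon>) n"
    have "measure M X \<le> C / R powr p" using elim(2) unfolding C_def X_def .
    also have "\<dots> \<le> C / R powr 1" using R C p by (intro divide_left_mono powr_mono) auto
    also have "\<dots> = 1 / (2 * m)" using R0 C m by (simp add: R_def)
    finally have "measure M X + measure M U \<le> 1 / m" using elim(3) unfolding U_def[symmetric] using m by (simp add: field_simps)
    then have XU: "measure M (X \<union> U) \<le> 1 / m" using measure_Un_le[OF X U] by linarith
    have goodM: "{\<omega>\<in>space M. good ?d R \<epsilon> j \<omega>} \<in> sets M" for j
      by (rule sets_F_M[OF mult_nonneg_nonneg[OF _ less_imp_le[OF d]] good_F[OF d]]) simp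
    have Sm: "?S \<in> borel_measurable M"
      by (rule stopped_measurable[OF euler_M[OF less_imp_le[OF d]] goodM])
    have "(\<integral>\<^sup>+\<omega>. ennreal (min (norm (x T \<omega>) powr p) m) \<partial>M)
       \<le> (\<integral>\<^sup>+\<omega>. ennreal 8 * ennreal ((1 + (norm (?S \<omega>))\<^sup>2) powr (p / 2)) + ennreal m * indicator (X \<union> U) \<omega> \<partial>M)"
    proof (rule nn_integral_mono)
      fix \<omega> assume \<omega>: "\<omega> \<in> space M"
      show "ennreal (min (norm (x T \<omega>) powr p) m) \<le> ennreal 8 * ennreal ((1 + (norm (?S \<omega>))\<^sup>2) powr (p / 2)) + ennreal m * indicator (X \<union> U) \<omega>"
      proof (cases "\<omega> \<in> X \<union> U")
        case True
        then have "ennreal (min (norm (x T \<omega>) powr p) m) \<le> ennreal m * indicator (X \<union> U) \<omega>"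
          by (simp add: ennreal_leI)
        then show ?thesis by (rule order_trans) (rule add_increasing, auto)
      next
        case False
        have g: "good ?d R \<epsilon> j \<omega>" if j: "j \<le> n" for j
        proof (rule ccontr)
          assume "\<not> good ?d R \<epsilon> j \<omega>"
          then have "R < norm (x (real j * ?d) \<omega>) \<or> \<epsilon> < norm (euler ?d j \<omega> - x (real j * ?d) \<omega>)"
            unfolding good_def by linarith
          then have "\<omega> \<in> X \<union> U" unfolding X_def U_def using \<omega> j by blast
          then show False using False by blast
        qed
        have S: "?S \<omega> = euler ?d n \<omega>" by (rule stopped_eq) (use g in auto)
        have "norm (euler ?d n \<omega> - x T \<omega>) \<le> 1" using g[of n] e nd unfolding good_def by simp
        then have "norm (x T \<omega>) \<le> norm (?S \<omega>) + 1" unfolding S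
          using norm_triangle_sub[of "x T \<omega>" "euler ?d n \<omega>"] by (simp add: norm_minus_commute)
        then have "(norm (x T \<omega>))\<^sup>2 \<le> (norm (?S \<omega>) + 1)\<^sup>2" by (intro power_mono) auto
        also have "\<dots> \<le> 2 * (1 + (norm (?S \<omega>))\<^sup>2)"
          using zero_le_power2[of "norm (?S \<omega>) - 1"] unfolding power2_diff power2_sum by simp
        finally have "((norm (x T \<omega>))\<^sup>2) powr (p/2) \<le> (2 * (1 + (norm (?S \<omega>))\<^sup>2)) powr (p/2)" using p by (intro powr_mono2) auto
        also have "\<dots> = 2 powr (p/2) * (1 + (norm (?S \<omega>))\<^sup>2) powr (p/2)" by (rule powr_mult)
        also have "\<dots> \<le> 2 powr 3 * (1 + (norm (?S \<omega>))\<^sup>2) powr (p/2)" using p by (intro mult_right_mono powr_mono) auto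
        also have "((norm (x T \<omega>))\<^sup>2) powr (p/2) = norm (x T \<omega>) powr p"
          by (rule norm_sq_powr_half)
        finally have "min (norm (x T \<omega>) powr p) m \<le> 8 * (1 + (norm (?S \<omega>))\<^sup>2) powr (p/2)" by simp
        then have "ennreal (min (norm (x T \<omega>) powr p) m) \<le> ennreal 8 * ennreal ((1 + (norm (?S \<omega>))\<^sup>2) powr (p / 2))"
          by (subst ennreal_mult[symmetric]) (auto intro: ennreal_leI)
        then show ?thesis using False by simp
      qed
    qed
    also have "\<dots> = ennreal 8 * (\<integral>\<^sup>+\<omega>. ennreal ((1 + (norm (?S \<omega>))\<^sup>2) powr (p / 2)) \<partial>M) + ennreal m * emeasure M (X \<union> U)"
      using Sm sets.Un[OF X U] by (subst nn_integral_add) (auto simp: nn_integral_cmult nn_integral_cmult_indicator)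
    also have "\<dots> \<le> ennreal 8 * ennreal (moment_bound T0) + ennreal m * ennreal (1 / m)"
      using elim(1) XU by (intro add_mono mult_left_mono) (auto simp: emeasure_eq_measure intro: ennreal_leI)
    also have "\<dots> = ennreal (8 * moment_bound T0 + 1)"
    proof -
      have mb: "0 \<le> moment_bound T0" using T by (intro moment_bound_nonneg) simp
      have "ennreal 8 * ennreal (moment_bound T0) = ennreal (8 * moment_bound T0)" by (rule ennreal_mult[symmetric]) (use mb in auto)
      moreover have "ennreal m * ennreal (1 / m) = ennreal 1" using m by (subst ennreal_mult[symmetric]) auto
      moreover have "ennreal (8 * moment_bound T0) + ennreal 1 = ennreal (8 * moment_bound T0 + 1)"
        by (rule ennreal_plus[symmetric]) (use mb in auto)
      ultimately show ?thesis by (simp only:)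
    qed
    finally show ?case .
  qed
  then show "(\<integral>\<^sup>+\<omega>. ennreal (min (norm (x T \<omega>) powr p) m) \<partial>M) \<le> ennreal (8 * moment_bound T0 + 1)"
    by simp
qed

end

section \<open>The modified truncated scheme\<close>

lemma (in brownian) nn_integral_increment_powr:
  assumes st: "0 \<le> s" "s \<le> t" and z: "0 < z" "z \<le> 6" and xi: "\<xi> \<in> borel_measurable (F s)"
  shows "(\<integral>\<^sup>+\<omega>. \<xi> \<omega> * ennreal (norm (B t \<omega> - B s \<omega>) powr z) \<partial>M) \<le> ennreal (gk * sqrt (t - s) powr z) * (\<integral>\<^sup>+\<omega>. \<xi> \<omega> \<partial>M)"
proof (cases "s = t")
  case True
  then show ?thesis using z by simp
next
  case False
  then have st': "0 \<le> s" "s < t" using st by auto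
  interpret law: prob_space "law s t" using st by (intro prob_space_law) auto
  have xiM: "\<xi> \<in> borel_measurable M" using measurable_F_M[OF xi] st by simp
  note [measurable] = xi
  have "(\<integral>\<^sup>+\<omega>. \<xi> \<omega> * ennreal (norm (B t \<omega> - B s \<omega>) powr z) \<partial>M) = (\<integral>\<^sup>+\<omega>. \<integral>\<^sup>+w. \<xi> \<omega> * ennreal (norm w powr z) \<partial>law s t \<partial>M)"
    by (rule nn_integral_indep[OF st', where \<Phi> = "\<lambda>\<omega> w. \<xi> \<omega> * ennreal (norm w powr z)"]) measurable
  also have "\<dots> = (\<integral>\<^sup>+\<omega>. (\<integral>\<^sup>+w. ennreal (norm w powr z) \<partial>law s t) * \<xi> \<omega> \<partial>M)"
    by (intro nn_integral_cong) (simp add: nn_integral_cmult mult.commute)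
  also have "\<dots> = (\<integral>\<^sup>+w. ennreal (norm w powr z) \<partial>law s t) * (\<integral>\<^sup>+\<omega>. \<xi> \<omega> \<partial>M)"
    using xiM by (rule nn_integral_cmult)
  also have "\<dots> \<le> ennreal (gk * sqrt (t - s) powr z) * (\<integral>\<^sup>+\<omega>. \<xi> \<omega> \<partial>M)"
    using norm_moment[OF st', of z] z
    by (intro mult_right_mono) (simp_all add: nn_integral_eq_integral ennreal_leI)
  finally show ?thesis .
qed

lemma mtrunc_measurable [measurable]:
  fixes \<phi> :: "real^'d \<Rightarrow> 'w::{real_normed_vector, second_countable_topology}"
  assumes [measurable]: "\<phi> \<in> borel_measurable borel"
  shows "mtrunc H \<phi> \<in> borel_measurable borel"
  unfolding mtrunc_def[abs_def] by measurable

text \<open>One step size \<Delta> is fixed, and \<open>h\<close> is the number h(\<Delta>). The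
  constants \<open>cF\<close>, \<open>cG\<close>, \<open>scheme_bound\<close>,
  \<open>incr_const\<close>, \<open>err_const\<close> and \<open>final_const\<close> built from here
  on mention neither \<open>h\<close> nor \<Delta>; this is what makes the final bounds
  uniform.\<close>

locale mtem_scheme = coercive_sde +
  fixes h \<Delta> :: real
  assumes h: "1 \<le> h" and Lh: "1 \<le> L h" and D: "0 < \<Delta>" and LD: "L h ^ 4 * \<Delta> \<le> 1"
begin

abbreviation "fD \<equiv> mtrunc h f"
abbreviation "gD \<equiv> mtrunc h g"
abbreviation "X \<equiv> mtem f g h \<Delta> x0 B"

section \<open>Growth and coercivity of the truncated coefficients\<close>

definition cF :: real where "cF = 2 * (norm (f 0) + 1)"
definition cG :: real where "cG = 2 * sqrt (K + cF)"

lemma cF: "2 \<le> cF" and cG: "0 \<le> cG"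
  using K by (auto simp: cF_def cG_def)

lemma f_growth:
  assumes "norm y \<le> h"
  shows "norm (f y) \<le> cF / 2 * L h * (1 + norm y)"
proof -
  have "norm (f y) \<le> norm (f 0) + norm (f y - f 0)" by (metis add.commute norm_triangle_sub)
  also have "norm (f y - f 0) \<le> L h * norm (y - 0)" using assms h by (intro f_lip) auto
  also have "norm (f 0) \<le> L h * norm (f 0)" using Lh mult_right_mono[of 1 "L h" "norm (f 0)"] by simp
  finally have "norm (f y) \<le> L h * norm (f 0) + L h * norm y" by simp
  also have "\<dots> \<le> cF / 2 * L h * (1 + norm y)"
    using Lh by (simp add: cF_def algebra_simps)
  finally show ?thesis .
qed

lemma norm_le_sqrt: "norm y \<le> sqrt (1 + (norm y)\<^sup>2)" "1 \<le> sqrt (1 + (norm y)\<^sup>2)"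
  by (auto intro: real_le_rsqrt)

text \<open>Coercivity bounds |g|^2 through -<y, f(y)>, hence with only the first power of L(h),
  where the Lipschitz bound on g would give L(h)^2. The saved power is decisive in
  \<open>growth_rate_le\<close>.\<close>

lemma g_growth:
  assumes y: "norm y \<le> h"
  shows "(norm (g y))\<^sup>2 \<le> 2 * (K + cF) * L h * (1 + (norm y)\<^sup>2)"
proof -
  have "- inner y (f y) \<le> norm y * norm (f y)" using norm_cauchy_schwarz[of "-y" "f y"] by simp
  also have "\<dots> \<le> norm y * (cF / 2 * L h * (1 + norm y))" by (intro mult_left_mono f_growth y) auto
  also have "\<dots> = cF / 2 * L h * (norm y * (1 + norm y))" by simp
  also have "\<dots> \<le> cF / 2 * L h * (2 * (1 + (norm y)\<^sup>2))"
  proof (intro mult_left_mono)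
    show "norm y * (1 + norm y) \<le> 2 * (1 + (norm y)\<^sup>2)"
    proof -
      have "2 * norm y \<le> 1 + (norm y)\<^sup>2" using zero_le_power2[of "norm y - 1"] unfolding power2_diff by simp
      moreover have "0 \<le> (norm y)\<^sup>2" "norm y * (1 + norm y) = norm y + (norm y)\<^sup>2" by (simp_all add: power2_eq_square algebra_simps)
      ultimately show ?thesis by argo
    qed
  qed (use cF Lh in auto)
  also have "\<dots> = cF * L h * (1 + (norm y)\<^sup>2)" by simp
  finally have 1: "- inner y (f y) \<le> cF * L h * (1 + (norm y)\<^sup>2)" .
  have "K * (1 + (norm y)\<^sup>2) \<le> K * L h * (1 + (norm y)\<^sup>2)"
    using K Lh by (intro mult_right_mono) auto
  moreover have "(norm (g y))\<^sup>2 / 2 \<le> (p - 1) / 2 * (norm (g y))\<^sup>2" using p mult_right_mono[of 1 "p - 1" "(norm (g y))\<^sup>2"] by simp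
  ultimately have "(norm (g y))\<^sup>2 / 2 \<le> K * L h * (1 + (norm y)\<^sup>2) + cF * L h * (1 + (norm y)\<^sup>2)"
    using 1 coercive[of y] by linarith
  then show ?thesis by (simp add: algebra_simps)
qed

lemma norm_scaled_to_radius:
  assumes "h < norm y"
  shows "norm ((h / norm y) *\<^sub>R y) = h"
proof -
  have "0 < norm y" using assms h by linarith
  then show ?thesis using h by simp
qed

text \<open>Outside the ball the truncation is homogeneous of degree 1: the bound on the sphere of
  radius h is multiplied by |y|/h, and h >= 1 gives 1 + h <= 2h. \<open>gD_growth\<close> follows
  the same pattern.\<close>

lemma fD_growth: "norm (fD y) \<le> cF * L h * sqrt (1 + (norm y)\<^sup>2)"
proof (cases "norm y \<le> h")
  case True
  then have "norm (fD y) \<le> cF / 2 * L h * (1 + norm y)" using f_growth by (simp add: mtrunc_def)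
  also have "\<dots> \<le> cF / 2 * L h * (2 * sqrt (1 + (norm y)\<^sup>2))"
  proof (intro mult_left_mono)
    show "1 + norm y \<le> 2 * sqrt (1 + (norm y)\<^sup>2)" using norm_le_sqrt[of y] by linarith
  qed (use cF Lh in auto)
  finally show ?thesis by simp
next
  case False
  then have y: "h < norm y" by simp
  have "norm (fD y) = norm y / h * norm (f ((h / norm y) *\<^sub>R y))" using False h by (simp add: mtrunc_def)
  also have "\<dots> \<le> norm y / h * (cF / 2 * L h * (1 + h))"
    using f_growth[of "(h / norm y) *\<^sub>R y"] norm_scaled_to_radius[OF y] h by (intro mult_left_mono) auto
  also have "\<dots> \<le> norm y / h * (cF / 2 * L h * (2 * h))"
    using h cF Lh by (intro mult_left_mono) auto
  also have "\<dots> = cF * L h * norm y" using h by simp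
  also have "\<dots> \<le> cF * L h * sqrt (1 + (norm y)\<^sup>2)" using norm_le_sqrt[of y] cF Lh by (intro mult_left_mono) auto
  finally show ?thesis .
qed

lemma gD_growth: "norm (gD y) \<le> cG * sqrt (L h) * sqrt (1 + (norm y)\<^sup>2)"
proof -
  have KcF: "0 \<le> K + cF" using K cF by linarith
  have "(norm (gD y))\<^sup>2 \<le> 4 * (K + cF) * L h * (1 + (norm y)\<^sup>2)"
  proof (cases "norm y \<le> h")
    case True
    then have "(norm (gD y))\<^sup>2 \<le> 2 * (K + cF) * L h * (1 + (norm y)\<^sup>2)" using g_growth by (simp add: mtrunc_def)
    also have "\<dots> \<le> 4 * (K + cF) * L h * (1 + (norm y)\<^sup>2)" using KcF Lh by (intro mult_right_mono) auto
    finally show ?thesis .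
  next
    case False
    then have y: "h < norm y" by simp
    have "(norm (gD y))\<^sup>2 = (norm y / h)\<^sup>2 * (norm (g ((h / norm y) *\<^sub>R y)))\<^sup>2" using False h by (simp add: mtrunc_def power_mult_distrib power_divide)
    also have "\<dots> \<le> (norm y / h)\<^sup>2 * (2 * (K + cF) * L h * (1 + h\<^sup>2))"
      using g_growth[of "(h / norm y) *\<^sub>R y"] norm_scaled_to_radius[OF y] by (intro mult_left_mono) auto
    also have "\<dots> \<le> (norm y / h)\<^sup>2 * (2 * (K + cF) * L h * (2 * h\<^sup>2))"
      using h KcF Lh power_mono[OF h, of 2] by (intro mult_left_mono mult_nonneg_nonneg) auto
    also have "\<dots> = 4 * (K + cF) * L h * (norm y)\<^sup>2" using h by (simp add: power_divide)
    also have "\<dots> \<le> 4 * (K + cF) * L h * (1 + (norm y)\<^sup>2)" using KcF Lh by (intro mult_left_mono) auto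
    finally show ?thesis .
  qed
  also have "\<dots> = (cG * sqrt (L h) * sqrt (1 + (norm y)\<^sup>2))\<^sup>2"
    using KcF Lh by (simp add: cG_def power_mult_distrib)
  finally show ?thesis by (rule power2_le_imp_le) (use cG Lh in auto)
qed

text \<open>Both terms on the left are homogeneous of degree 2 outside the ball, so coercivity at
  the projected point v scales by (|y|/h)^2, and 1 + h^2 <= 2 h^2 costs a factor 2. This is the
  merit of continuing the coefficients linearly beyond the radius.\<close>

lemma coercive_trunc: "2 * inner y (fD y) + (p - 1) * (norm (gD y))\<^sup>2 \<le> 4 * K * (1 + (norm y)\<^sup>2)"
proof (cases "norm y \<le> h")
  case True
  have "2 * inner y (f y) + (p - 1) * (norm (g y))\<^sup>2 \<le> 2 * (K * (1 + (norm y)\<^sup>2))"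
    using coercive[of y] by (simp add: field_simps)
  also have "\<dots> \<le> 4 * K * (1 + (norm y)\<^sup>2)" using K by simp
  finally show ?thesis using True by (simp add: mtrunc_def)
next
  case False
  define v where "v = (h / norm y) *\<^sub>R y"
  define c where "c = norm y / h"
  have "0 < norm y" using False h by linarith
  then have c: "0 < c" using h by (simp add: c_def)
  have y: "y = c *\<^sub>R v" using False h by (auto simp: v_def c_def)
  have nv: "norm v = h" unfolding v_def using False by (intro norm_scaled_to_radius) simp
  have fg: "fD y = c *\<^sub>R f v" "gD y = c *\<^sub>R g v" using False by (auto simp: mtrunc_def v_def c_def)
  have "2 * inner y (fD y) + (p - 1) * (norm (gD y))\<^sup>2 = c\<^sup>2 * (2 * inner v (f v) + (p - 1) * (norm (g v))\<^sup>2)"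
    unfolding fg using c by (subst y) (simp add: power_mult_distrib power2_eq_square algebra_simps)
  also have "\<dots> \<le> c\<^sup>2 * (2 * (K * (1 + h\<^sup>2)))"
    using coercive[of v] nv by (intro mult_left_mono) (auto simp: field_simps)
  also have "\<dots> \<le> c\<^sup>2 * (2 * (K * (2 * h\<^sup>2)))"
    using K power_mono[OF h, of 2] by (intro mult_left_mono) auto
  also have "\<dots> = 4 * K * (norm y)\<^sup>2" using h by (simp add: c_def power_divide)
  also have "\<dots> \<le> 4 * K * (1 + (norm y)\<^sup>2)" using K by simp
  finally show ?thesis .
qed

section \<open>Moments, exit probability and increments of the scheme\<close>

lemma X_F: "X k \<in> borel_measurable (F (real k * \<Delta>))"
proof (induction k)
  case 0 then show ?case by (simp add: mtem.simps(1)[abs_def])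
next
  case (Suc i)
  have t0: "0 \<le> real j * \<Delta>" for j using D by simp
  have ts: "real i * \<Delta> \<le> real (Suc i) * \<Delta>" using D by simp
  note up = measurable_F_mono[OF _ t0 ts]
  note [measurable] = up[OF Suc] up[OF B_F[OF t0]] B_F[OF t0[of "Suc i"]]
  show ?case unfolding mtem.simps(2)[abs_def] by measurable
qed

lemma X_M: "X k \<in> borel_measurable M"
  by (rule measurable_F_M[OF X_F]) (use D in simp)

definition scheme_rate :: real where
  "scheme_rate = p / 2 * (4 * K + 1) + 153600 * gk * ((cF + cG)\<^sup>2 + (cF + cG) ^ 3 + (cF + cG) ^ 6)"

lemma LD_le: "L h * \<Delta> \<le> 1" "L h ^ 3 * \<Delta> \<le> 1" "\<Delta> \<le> 1"
proof -
  have "L h ^ k * \<Delta> \<le> L h ^ 4 * \<Delta>" if "k \<le> 4" for k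
    using Lh D that by (intro mult_right_mono power_increasing) auto
  from this[of 1] this[of 3] this[of 0] LD show "L h * \<Delta> \<le> 1" "L h ^ 3 * \<Delta> \<le> 1" "\<Delta> \<le> 1" by auto
qed

text \<open>In terms of s = sqrt(L(h) \<Delta>) the remainder is at most a constant times s^3,
  because \<theta> <= c s and s <= 1, and s^3 <= \<Delta> amounts to L(h)^3 \<Delta> <= 1. A
  diffusion growing like L(h) would require L(h)^6 \<Delta> <= 1, which L(h)^4 \<Delta> <= 1 does
  not give.\<close>

lemma growth_rate_le: "growth_rate (p / 2) (4 * K) (cF * L h) (cG * sqrt (L h)) \<Delta> \<le> scheme_rate * \<Delta>"
proof -
  define s where "s = sqrt (L h * \<Delta>)"
  define c where "c = cF + cG"
  have LDn: "0 \<le> L h * \<Delta>" using Lh D by simp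
  have s0: "0 \<le> s" "s \<le> 1" "s\<^sup>2 = L h * \<Delta>" using LDn LD_le by (auto simp: s_def)
  have c0: "0 \<le> c" "cF \<le> c" "0 \<le> cF" "cG \<le> c" using cF cG by (auto simp: c_def)
  have s3: "s ^ 3 \<le> \<Delta>"
  proof (rule power2_le_imp_le)
    have "(s ^ 3)\<^sup>2 = (s\<^sup>2) ^ 3" by (simp flip: power_mult)
    also have "\<dots> = (L h ^ 3 * \<Delta>) * \<Delta>\<^sup>2" unfolding s0 by (simp add: power_mult_distrib power3_eq_cube power2_eq_square)
    also have "\<dots> \<le> 1 * \<Delta>\<^sup>2" using LD_le D by (intro mult_right_mono) auto
    finally show "(s ^ 3)\<^sup>2 \<le> \<Delta>\<^sup>2" by simp
  qed (use D in simp)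
  have s6: "s ^ 6 \<le> s ^ 3" using s0 by (intro power_decreasing) auto
  define A where "A = cF * L h * \<Delta>"
  define \<theta> where "\<theta> = cF * L h * \<Delta> + cG * sqrt (L h) * sqrt \<Delta>"
  have A: "A = cF * s\<^sup>2" unfolding s0 A_def by simp
  have ss: "s\<^sup>2 \<le> s" using s0 mult_left_mono[of s 1 s] by (simp add: power2_eq_square)
  have "cG * sqrt (L h) * sqrt \<Delta> = cG * s" by (simp add: s_def real_sqrt_mult)
  then have "\<theta> = cF * s\<^sup>2 + cG * s" unfolding \<theta>_def s0 by simp
  also have "\<dots> \<le> cF * s + cG * s" using ss c0 by (intro add_right_mono mult_left_mono) auto
  finally have th: "\<theta> \<le> c * s" by (simp add: c_def algebra_simps)
  have th0: "0 \<le> \<theta>" unfolding \<theta>_def using cF cG Lh D by (intro add_nonneg_nonneg mult_nonneg_nonneg) auto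
  have "A * \<theta> + \<theta> ^ 3 + \<theta> ^ 6 \<le> (c * s\<^sup>2) * (c * s) + (c * s) ^ 3 + (c * s) ^ 6"
    unfolding A using th th0 c0 s0(1) by (intro add_mono mult_mono power_mono) auto
  also have "\<dots> = c\<^sup>2 * s ^ 3 + c ^ 3 * s ^ 3 + c ^ 6 * s ^ 6"
    by (simp add: power_mult_distrib power2_eq_square power3_eq_cube)
  also have "\<dots> \<le> c\<^sup>2 * \<Delta> + c ^ 3 * \<Delta> + c ^ 6 * \<Delta>"
    using s3 s6 c0 by (intro add_mono mult_left_mono) auto
  finally have "153600 * gk * (A * \<theta> + \<theta> ^ 3 + \<theta> ^ 6) \<le> 153600 * gk * (c\<^sup>2 * \<Delta> + c ^ 3 * \<Delta> + c ^ 6 * \<Delta>)"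
    using gk_ge_1 by (intro mult_left_mono) auto
  then show ?thesis unfolding growth_rate_def scheme_rate_def \<theta>_def[symmetric] c_def[symmetric]
    unfolding A_def by (simp add: algebra_simps)
qed

definition scheme_bound :: "real \<Rightarrow> real" where
  "scheme_bound T = exp (scheme_rate * T) * (1 + (norm x0)\<^sup>2) powr (p / 2)"

lemma scheme_bound_nonneg: "0 \<le> scheme_bound T"
  by (simp add: scheme_bound_def)

text \<open>\<open>Q\<close> is left free: the condition that always holds yields the moments of the
  scheme, and staying in the ball of radius h yields the exit probability. There is no source term
  because coercivity is applied at the chain's own state.\<close>

lemma stopped_scheme_moment:
  assumes N: "real N * \<Delta> \<le> T" and Qm: "\<And>k. {\<omega>\<in>space M. Q k \<omega>} \<in> sets (F (real k * \<Delta>))"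
  shows "(\<integral>\<^sup>+\<omega>. ennreal ((1 + (norm (stopped X Q N \<omega>))\<^sup>2) powr (p / 2)) \<partial>M) \<le> ennreal (scheme_bound T)"
proof -
  have "(\<integral>\<^sup>+\<omega>. ennreal ((1 + (norm (stopped X Q N \<omega>))\<^sup>2) powr (p / 2)) \<partial>M)
    \<le> ennreal (exp (real N * growth_rate (p / 2) (4 * K) (cF * L h) (cG * sqrt (L h)) \<Delta>)) *
       (ennreal ((1 + (norm x0)\<^sup>2) powr (p / 2)) + (\<Sum>i<N. ennreal (\<Delta> * (p / 2)) * (\<integral>\<^sup>+\<omega>. ennreal (0 powr (p / 2)) \<partial>M)))"
  proof (rule stopped_moment_bound[OF D, where a = "\<lambda>k \<omega>. fD (X k \<omega>)" and b = "\<lambda>k \<omega>. gD (X k \<omega>)"])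
    show "(\<lambda>\<omega>. fD (X i \<omega>)) \<in> borel_measurable (F (real i * \<Delta>))" "(\<lambda>\<omega>. gD (X i \<omega>)) \<in> borel_measurable (F (real i * \<Delta>))" for i
      using X_F[of i] by measurable
    show "2 * inner (X i \<omega>) (fD (X i \<omega>)) + (2 * (p / 2) - 1) * (norm (gD (X i \<omega>)))\<^sup>2 \<le> 4 * K * (1 + (norm (X i \<omega>))\<^sup>2) + 0" for i \<omega>
      using coercive_trunc[of "X i \<omega>"] by simp
  qed (use p K cF cG Lh Qm fD_growth gD_growth in auto)
  also have "\<dots> = ennreal (exp (real N * growth_rate (p / 2) (4 * K) (cF * L h) (cG * sqrt (L h)) \<Delta>) * (1 + (norm x0)\<^sup>2) powr (p / 2))"
    by (simp add: ennreal_mult')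
  also have "\<dots> \<le> ennreal (scheme_bound T)"
    unfolding scheme_bound_def
  proof (intro ennreal_leI mult_right_mono)
    have sr: "0 \<le> scheme_rate" unfolding scheme_rate_def using p K gk_ge_1 cF cG by (intro add_nonneg_nonneg mult_nonneg_nonneg) auto
    have "real N * growth_rate (p / 2) (4 * K) (cF * L h) (cG * sqrt (L h)) \<Delta> \<le> real N * (scheme_rate * \<Delta>)"
      by (intro mult_left_mono growth_rate_le) auto
    also have "\<dots> = scheme_rate * (real N * \<Delta>)" by simp
    also have "\<dots> \<le> scheme_rate * T" using N sr by (intro mult_left_mono)
    finally show "exp (real N * growth_rate (p / 2) (4 * K) (cF * L h) (cG * sqrt (L h)) \<Delta>) \<le> exp (scheme_rate * T)" by simp
  qed auto
  finally show ?thesis .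
qed

lemma scheme_moment:
  assumes N: "real N * \<Delta> \<le> T"
  shows "(\<integral>\<^sup>+\<omega>. ennreal ((1 + (norm (X N \<omega>))\<^sup>2) powr (p / 2)) \<partial>M) \<le> ennreal (scheme_bound T)"
proof -
  have "{\<omega>\<in>space M. True} \<in> sets (F (real k * \<Delta>))" for k
    using sets.top[of "F (real k * \<Delta>)"] space_F[of "real k * \<Delta>"] D by simp
  from stopped_scheme_moment[OF N this] show ?thesis by (simp add: stopped_eq)
qed

lemma scheme_exceed:
  assumes N: "real N * \<Delta> \<le> T"
  shows "measure M {\<omega>\<in>space M. \<exists>k\<le>N. h < norm (X k \<omega>)} \<le> scheme_bound T / h powr p"
proof -
  define A where "A = {\<omega>\<in>space M. \<exists>k\<le>N. h < norm (X k \<omega>)}"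
  define Q where "Q = (\<lambda>k \<omega>. norm (X k \<omega>) \<le> h)"
  note [measurable] = X_M
  have AM: "A \<in> sets M" unfolding A_def by measurable
  have Qm: "{\<omega>\<in>space M. Q k \<omega>} \<in> sets (F (real k * \<Delta>))" for k
  proof -
    have t0: "0 \<le> real k * \<Delta>" using D by simp
    note [measurable] = X_F[of k]
    have "{\<omega>\<in>space (F (real k * \<Delta>)). Q k \<omega>} \<in> sets (F (real k * \<Delta>))" unfolding Q_def by measurable
    then show ?thesis unfolding space_F[OF t0] .
  qed
  have "measure M A \<le> scheme_bound T / h powr p"
  proof (rule measure_le_of_nn_integral[OF AM _ scheme_bound_nonneg stopped_scheme_moment[OF N Qm]])
    fix \<omega> assume "\<omega> \<in> A"
    then obtain i where i: "i \<le> N" "h < norm (X i \<omega>)" unfolding A_def by blast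
    obtain j where j: "j \<le> N" "stopped X Q N \<omega> = X j \<omega>" "\<And>k. k < j \<Longrightarrow> Q k \<omega>" "j = N \<or> \<not> Q j \<omega>"
      using stopped_cases[where n = N and y = X and Q = Q and \<omega> = \<omega>] by blast
    have "\<not> Q i \<omega>" using i unfolding Q_def by linarith
    then have "\<not> Q j \<omega>" using j i by (metis le_less_trans le_neq_implies_less le_less)
    then have "h \<le> norm (X j \<omega>)" unfolding Q_def by linarith
    then have "h\<^sup>2 \<le> (norm (X j \<omega>))\<^sup>2" using h by (intro power_mono) auto
    then have "h\<^sup>2 \<le> 1 + (norm (X j \<omega>))\<^sup>2" by linarith
    then have "(h\<^sup>2) powr (p/2) \<le> (1 + (norm (X j \<omega>))\<^sup>2) powr (p/2)" using p h by (intro powr_mono2) auto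
    moreover have "(h\<^sup>2) powr (p/2) = h powr p" using h by (simp add: powr_powr flip: powr_numeral)
    ultimately show "ennreal (h powr p) \<le> ennreal ((1 + (norm (stopped X Q N \<omega>))\<^sup>2) powr (p / 2))"
      unfolding j(2) by (intro ennreal_leI) linarith
  qed (use h in auto)
  then show ?thesis unfolding A_def .
qed

definition incr where
  "incr k t \<omega> = (t - real k * \<Delta>) *\<^sub>R fD (X k \<omega>) + gD (X k \<omega>) *v (B t \<omega> - B (real k * \<Delta>) \<omega>)"

definition incr_const :: "real \<Rightarrow> real" where
  "incr_const T = 128 * (cF + cG) ^ 6 * gk * scheme_bound T"

lemma incr_const_nonneg: "0 \<le> incr_const T"
  unfolding incr_const_def using cF cG gk_ge_1 scheme_bound_nonneg[of T] by (intro mult_nonneg_nonneg) auto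

text \<open>Drift and noise are bounded by c L(h) sqrt(u) times sqrt(\<Delta>) and |W| respectively,
  with u = 1 + |X k|^2; the Brownian increment is independent of u, so the expectations separate. As
  u >= 1, u^(z/2) is raised to u^(p/2), and the single moment \<open>scheme_bound\<close> serves
  both exponents q and p.\<close>

lemma incr_moment:
  assumes k: "real k * \<Delta> \<le> T" and t: "real k * \<Delta> \<le> t" "t \<le> real (Suc k) * \<Delta>" and z: "2 \<le> z" "z \<le> p"
  shows "(\<integral>\<^sup>+\<omega>. ennreal (norm (incr k t \<omega>) powr z) \<partial>M) \<le> ennreal (incr_const T * (L h powr z * \<Delta> powr (z / 2)))"
proof -
  let ?s = "real k * \<Delta>"
  define u where "u = (\<lambda>\<omega>. 1 + (norm (X k \<omega>))\<^sup>2)"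
  define c where "c = cF + cG"
  have c: "1 \<le> c" "cF \<le> c" "0 \<le> cF" "cG \<le> c" "0 \<le> cG" using cF cG by (auto simp: c_def)
  have t0: "0 \<le> ?s" using D by simp
  have u1: "1 \<le> u \<omega>" for \<omega> by (simp add: u_def)
  define lz where "lz = L h powr z * \<Delta> powr (z / 2)"
  have cz: "c powr z \<le> c ^ 6" using powr_mono[of z 6 c] c z p by (simp add: powr_numeral)
  have sD: "sqrt \<Delta> powr z = \<Delta> powr (z / 2)" using D by (simp add: powr_half_sqrt[symmetric] powr_powr)
  define W where "W = (\<lambda>\<omega>. norm (B t \<omega> - B ?s \<omega>))"
  have pw: "norm (incr k t \<omega>) powr z \<le> 64 * c ^ 6 * (lz * u \<omega> powr (p / 2)) + 64 * c ^ 6 * L h powr z * (u \<omega> powr (p / 2) * W \<omega> powr z)" for \<omega>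
  proof -
    have su: "1 \<le> sqrt (u \<omega>)" using u1 by simp
    have A: "norm ((t - ?s) *\<^sub>R fD (X k \<omega>)) \<le> c * L h * sqrt \<Delta> * sqrt (u \<omega>)"
    proof -
      have "norm ((t - ?s) *\<^sub>R fD (X k \<omega>)) \<le> \<Delta> * (cF * L h * sqrt (u \<omega>))"
        unfolding norm_scaleR using t D fD_growth[of "X k \<omega>"] by (intro mult_mono) (auto simp: u_def algebra_simps)
      also have "\<dots> \<le> sqrt \<Delta> * (c * L h * sqrt (u \<omega>))"
      proof (intro mult_mono)
        have "\<Delta> = sqrt \<Delta> * sqrt \<Delta>" using D by simp
        also have "\<dots> \<le> sqrt \<Delta> * 1" using LD_le D by (intro mult_left_mono) auto
        finally show "\<Delta> \<le> sqrt \<Delta>" by simp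
      qed (use c Lh u1[of \<omega>] D in auto)
      finally show ?thesis by (simp add: mult_ac)
    qed
    have Bd: "norm (gD (X k \<omega>) *v (B t \<omega> - B ?s \<omega>)) \<le> c * L h * sqrt (u \<omega>) * W \<omega>"
    proof -
      have "norm (gD (X k \<omega>) *v (B t \<omega> - B ?s \<omega>)) \<le> norm (gD (X k \<omega>)) * W \<omega>"
        unfolding W_def by (rule norm_matrix_vector_le)
      also have "\<dots> \<le> (cG * sqrt (L h) * sqrt (u \<omega>)) * W \<omega>"
        using gD_growth[of "X k \<omega>"] by (intro mult_right_mono) (auto simp: u_def W_def)
      also have "\<dots> \<le> (c * L h * sqrt (u \<omega>)) * W \<omega>"
      proof (intro mult_right_mono mult_mono)
        show "sqrt (L h) \<le> L h" using Lh by (intro real_le_lsqrt) (auto simp: power2_eq_square)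
      qed (use c Lh u1[of \<omega>] in \<open>auto simp: W_def\<close>)
      finally show ?thesis .
    qed
    have W0: "0 \<le> W \<omega>" by (simp add: W_def)
    have a0: "0 \<le> c * L h * sqrt \<Delta> * sqrt (u \<omega>)" "0 \<le> c * L h * sqrt (u \<omega>) * W \<omega>" using c Lh D u1[of \<omega>] W0 by auto
    define m where "m = max (c * L h * sqrt \<Delta> * sqrt (u \<omega>)) (c * L h * sqrt (u \<omega>) * W \<omega>)"
    have "norm (incr k t \<omega>) \<le> 2 * m"
      unfolding incr_def using A Bd norm_triangle_ineq[of "(t - ?s) *\<^sub>R fD (X k \<omega>)" "gD (X k \<omega>) *v (B t \<omega> - B ?s \<omega>)"] by (simp add: m_def)
    then have "norm (incr k t \<omega>) powr z \<le> (2 * m) powr z" using z by (intro powr_mono2) auto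
    also have "\<dots> = 2 powr z * m powr z" using a0 by (simp add: powr_mult m_def)
    also have "2 powr z \<le> 2 powr 6" using z p by (intro powr_mono) auto
    also have "m powr z \<le> (c * L h * sqrt \<Delta> * sqrt (u \<omega>)) powr z + (c * L h * sqrt (u \<omega>) * W \<omega>) powr z"
      by (simp add: m_def max_def)
    also have "(c * L h * sqrt \<Delta> * sqrt (u \<omega>)) powr z = c powr z * L h powr z * sqrt \<Delta> powr z * sqrt (u \<omega>) powr z"
      using c Lh D u1[of \<omega>] by (simp add: powr_mult)
    also have "(c * L h * sqrt (u \<omega>) * W \<omega>) powr z = c powr z * L h powr z * sqrt (u \<omega>) powr z * W \<omega> powr z"
      using c Lh W0 u1[of \<omega>] by (simp add: powr_mult)
    finally have "norm (incr k t \<omega>) powr z \<le> 64 * (c powr z * (lz * sqrt (u \<omega>) powr z + L h powr z * (sqrt (u \<omega>) powr z * W \<omega> powr z)))"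
      by (simp add: sD lz_def algebra_simps mult_right_mono)
    also have "\<dots> \<le> 64 * (c ^ 6 * (lz * u \<omega> powr (p / 2) + L h powr z * (u \<omega> powr (p / 2) * W \<omega> powr z)))"
    proof -
      have "sqrt (u \<omega>) powr z = u \<omega> powr (z / 2)" using u1[of \<omega>] by (simp add: powr_half_sqrt[symmetric] powr_powr)
      also have "\<dots> \<le> u \<omega> powr (p / 2)" using u1[of \<omega>] z by (intro powr_mono) auto
      finally have "sqrt (u \<omega>) powr z \<le> u \<omega> powr (p / 2)" .
      then show ?thesis using cz c by (intro mult_left_mono mult_mono add_mono mult_right_mono) (auto simp: lz_def)
    qed
    finally show ?thesis by (simp add: algebra_simps)
  qed
  have [measurable]: "X k \<in> borel_measurable M" by (rule X_M)
  have Wm [measurable]: "W \<in> borel_measurable M"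
  proof -
    note [measurable] = B_M[OF t0] B_M[OF order_trans[OF t0 t(1)]]
    show ?thesis unfolding W_def by measurable
  qed
  have um [measurable]: "u \<in> borel_measurable M" unfolding u_def by measurable
  have up: "(\<lambda>\<omega>. ennreal (u \<omega> powr (p / 2))) \<in> borel_measurable (F ?s)" unfolding u_def using X_F[of k] by measurable
  let ?I = "\<integral>\<^sup>+\<omega>. ennreal (u \<omega> powr (p / 2)) \<partial>M"
  have I: "?I \<le> ennreal (scheme_bound T)" unfolding u_def by (rule scheme_moment[OF k])
  have "(\<integral>\<^sup>+\<omega>. ennreal (norm (incr k t \<omega>) powr z) \<partial>M) \<le>
    (\<integral>\<^sup>+\<omega>. ennreal (64 * c ^ 6 * lz) * ennreal (u \<omega> powr (p / 2)) + ennreal (64 * c ^ 6 * L h powr z) * (ennreal (u \<omega> powr (p / 2)) * ennreal (W \<omega> powr z)) \<partial>M)"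
  proof (rule nn_integral_mono)
    fix \<omega>
    have "ennreal (norm (incr k t \<omega>) powr z) \<le> ennreal ((64 * c ^ 6 * lz) * u \<omega> powr (p / 2) + (64 * c ^ 6 * L h powr z) * (u \<omega> powr (p / 2) * W \<omega> powr z))"
      using pw[of \<omega>] by (intro ennreal_leI) (simp add: mult.assoc)
    also have "\<dots> = ennreal (64 * c ^ 6 * lz) * ennreal (u \<omega> powr (p / 2)) + ennreal (64 * c ^ 6 * L h powr z) * (ennreal (u \<omega> powr (p / 2)) * ennreal (W \<omega> powr z))"
      using c by (simp add: ennreal_plus ennreal_mult lz_def)
    finally show "ennreal (norm (incr k t \<omega>) powr z) \<le> \<dots>" .
  qed
  also have "\<dots> = ennreal (64 * c ^ 6 * lz) * ?I + ennreal (64 * c ^ 6 * L h powr z) * (\<integral>\<^sup>+\<omega>. ennreal (u \<omega> powr (p / 2)) * ennreal (W \<omega> powr z) \<partial>M)"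
    by (subst nn_integral_add) (auto simp: nn_integral_cmult)
  also have "\<dots> \<le> ennreal (64 * c ^ 6 * lz) * ?I + ennreal (64 * c ^ 6 * L h powr z) * (ennreal (gk * sqrt (t - ?s) powr z) * ?I)"
    unfolding W_def using z p by (intro add_left_mono mult_left_mono nn_integral_increment_powr t0 t up) auto
  also have "\<dots> \<le> ennreal (64 * c ^ 6 * lz) * ennreal (scheme_bound T) + ennreal (64 * c ^ 6 * L h powr z) * (ennreal (gk * \<Delta> powr (z / 2)) * ennreal (scheme_bound T))"
  proof (intro add_mono mult_mono I ennreal_leI order_refl)
    have "sqrt (t - ?s) powr z \<le> sqrt \<Delta> powr z" using t z by (intro powr_mono2) (auto simp: algebra_simps)
    then show "sqrt (t - ?s) powr z \<le> \<Delta> powr (z / 2)" using sD by simp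
  qed (use gk_ge_1 in \<open>auto simp: lz_def\<close>)
  also have "\<dots> = ennreal (64 * c ^ 6 * lz * scheme_bound T + 64 * c ^ 6 * L h powr z * (gk * \<Delta> powr (z / 2) * scheme_bound T))"
    using c gk_ge_1 scheme_bound_nonneg[of T] by (simp add: ennreal_plus ennreal_mult lz_def)
  also have "\<dots> \<le> ennreal (incr_const T * lz)"
  proof (rule ennreal_leI)
    have "0 \<le> 64 * c ^ 6 * lz * scheme_bound T" using c scheme_bound_nonneg[of T] by (simp add: lz_def)
    from mult_right_mono[OF gk_ge_1 this]
    show "64 * c ^ 6 * lz * scheme_bound T + 64 * c ^ 6 * L h powr z * (gk * \<Delta> powr (z / 2) * scheme_bound T) \<le> incr_const T * lz"
      unfolding incr_const_def c_def[symmetric] by (simp add: lz_def algebra_simps)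
  qed
  finally show ?thesis unfolding lz_def .
qed

end

section \<open>The strong error\<close>

lemma norm_add_powr_le:
  assumes z: "0 \<le> z" "z \<le> 6"
  shows "norm (a + b) powr z \<le> 64 * (norm a powr z + norm b powr z)"
proof -
  define m where "m = max (norm a) (norm b)"
  have "norm (a + b) \<le> 2 * m" using norm_triangle_ineq[of a b] by (simp add: m_def)
  then have "norm (a + b) powr z \<le> (2 * m) powr z" using z by (intro powr_mono2) auto
  also have "\<dots> = 2 powr z * m powr z" by (rule powr_mult)
  also have "\<dots> \<le> 2 powr 6 * m powr z" using z by (intro mult_right_mono powr_mono) auto
  also have "\<dots> \<le> 64 * (norm a powr z + norm b powr z)" by (simp add: m_def max_def)
  finally show ?thesis .
qed

text \<open>The number e^(-1/(p-q)) is the level at which e a^p equals a^q: above it the p-th power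
  dominates, below it a^q is bounded by the level. For e equal to the target error
  \<open>err\<close>, this level is exactly the lower bound that \<open>h_large\<close> imposes on
  h.\<close>

lemma powr_interpolate:
  fixes a e p q :: real
  assumes "0 \<le> a" "0 < e" "q < p" "0 < q"
  shows "a powr q \<le> e * a powr p + (e powr (- 1 / (p - q))) powr q"
proof (cases "a \<le> e powr (- 1 / (p - q))")
  case True
  then have "a powr q \<le> (e powr (- 1 / (p - q))) powr q" using assms by (intro powr_mono2) auto
  moreover have "0 \<le> e * a powr p" using assms by simp
  ultimately show ?thesis by linarith
next
  case False
  then have a: "0 < a" using less_le_trans[OF _ less_imp_le] powr_ge_zero[of e "- 1 / (p - q)"] by linarith
  have "(e powr (- 1 / (p - q))) powr (p - q) \<le> a powr (p - q)" using assms False by (intro powr_mono2) auto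
  moreover have "(e powr (- 1 / (p - q))) powr (p - q) = 1 / e"
  proof -
    have "- 1 / (p - q) * (p - q) = - 1" using assms by simp
    then show ?thesis using assms unfolding powr_powr by (simp only: powr_minus_divide powr_one)
  qed
  ultimately have "1 / e \<le> a powr (p - q)" by (simp only:)
  then have "1 \<le> e * a powr (p - q)" using assms by (simp add: field_simps)
  then have "1 * a powr q \<le> e * a powr (p - q) * a powr q" by (intro mult_right_mono) auto
  also have "\<dots> = e * a powr p" by (simp add: powr_add[symmetric] mult.assoc)
  finally show ?thesis using powr_ge_zero[of "e powr (- 1 / (p - q))" q] by linarith
qed

locale mtem_error = mtem_scheme +
  fixes q H :: real
  assumes q: "2 < q" "q < p" and H: "0 < H"
    and monot: "inner (y - z) (f y - f z) + (q - 1) / 2 * (norm (g y - g z))\<^sup>2 \<le> H * (norm (y - z))\<^sup>2"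
    and h_large: "(L h powr (2 * q) * \<Delta> powr (q / 2)) powr (- 1 / (p - q)) \<le> h"
begin

definition "err = L h powr (2 * q) * \<Delta> powr (q / 2)"
text \<open>The order of one increment of the scheme in L^q. Errors caused by the auxiliary grid can
  be pushed below any level, and this one suffices since its q-th power is at most
  \<open>err\<close>.\<close>

definition "tol = L h * sqrt \<Delta>"

lemma err_pos: "0 < err" and tol_pos: "0 < tol"
  using Lh D by (auto simp: err_def tol_def)

lemma tol_powr: "tol powr q = L h powr q * \<Delta> powr (q / 2)"
  using Lh D by (simp add: tol_def powr_mult powr_half_sqrt[symmetric] powr_powr)

lemma tol_powr_le: "L h powr q * \<Delta> powr (q / 2) \<le> err"
  unfolding err_def using Lh q by (intro mult_right_mono powr_mono) auto

lemma err_eq: "err = L h powr q * (L h powr q * \<Delta> powr (q / 2))"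
  unfolding err_def by (simp add: mult.assoc[symmetric] powr_add[symmetric])

text \<open>Chosen so that its power q/2 is exactly \<open>err\<close>: the gap starts at 0, and its
  regularised initial moment is then one target error.\<close>

definition "\<eta> = L h ^ 4 * \<Delta>"

lemma eta_pos: "0 < \<eta>" using Lh D by (auto simp: \<eta>_def)

lemma eta_powr: "\<eta> powr (q / 2) = err"
proof -
  have "(L h ^ 4) powr (q / 2) = L h powr (2 * q)" using Lh by (simp add: powr_powr flip: powr_numeral)
  then show ?thesis by (simp add: \<eta>_def err_def powr_mult)
qed

text \<open>The continuous scheme at time i \<Delta>/N, with \<open>i div N\<close> the scheme step
  containing it. On the refined grid it is a chain with coefficients frozen over blocks, like
  \<open>coarse\<close>.\<close>

definition interp :: "nat \<Rightarrow> nat \<Rightarrow> 'a \<Rightarrow> _" where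
  "interp N i \<omega> = X (i div N) \<omega> + incr (i div N) (real i * (\<Delta> / real N)) \<omega>"

lemma incr_full: "X k \<omega> + incr k (real (Suc k) * \<Delta>) \<omega> = X (Suc k) \<omega>"
  by (simp add: incr_def algebra_simps)

lemma incr_diff: "incr k t \<omega> - incr k s \<omega> = (t - s) *\<^sub>R fD (X k \<omega>) + gD (X k \<omega>) *v (B t \<omega> - B s \<omega>)"
  by (simp add: incr_def algebra_simps)

text \<open>At the last fine step of a block \<open>i div N\<close> jumps. There the old scheme
  value plus its full increment is the new scheme value, so the recursion crosses the block boundary
  unchanged.\<close>

lemma interp_Suc:
  assumes N: "0 < N"
  shows "interp N (Suc i) \<omega> = interp N i \<omega> + (\<Delta> / real N) *\<^sub>R fD (X (i div N) \<omega>)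
     + gD (X (i div N) \<omega>) *v (B (real (Suc i) * (\<Delta> / real N)) \<omega> - B (real i * (\<Delta> / real N)) \<omega>)"
proof -
  define k where "k = i div N"
  have "interp N (Suc i) \<omega> = X k \<omega> + incr k (real (Suc i) * (\<Delta> / real N)) \<omega>"
  proof (cases "Suc i mod N = 0")
    case False
    then have "Suc i div N = k" using div_Suc[of i N] by (simp add: k_def)
    then show ?thesis by (simp add: interp_def)
  next
    case True
    then have k: "Suc i div N = Suc k" using div_Suc[of i N] by (simp add: k_def)
    then have "Suc i = Suc k * N" using True by (metis div_mult_mod_eq add_0_right)
    then have "real (Suc i) = real (Suc k) * real N" by (metis of_nat_mult)
    then have t: "real (Suc i) * (\<Delta> / real N) = real (Suc k) * \<Delta>" using N by simp
    show ?thesis unfolding interp_def k t incr_full by (simp add: incr_def)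
  qed
  then have "interp N (Suc i) \<omega> = interp N i \<omega> + (incr k (real (Suc i) * (\<Delta> / real N)) \<omega> - incr k (real i * (\<Delta> / real N)) \<omega>)"
    by (simp add: interp_def k_def)
  moreover have "real (Suc i) * (\<Delta> / real N) - real i * (\<Delta> / real N) = \<Delta> / real N"
    unfolding left_diff_distrib[symmetric] by simp
  ultimately show ?thesis unfolding incr_diff k_def[symmetric] by simp
qed

text \<open>The first two conditions put both arguments into the ball of radius h, where the
  truncation is inactive and L(h) is a Lipschitz constant. The third allows \<open>x\<close> to be
  replaced by its Euler sum at the cost of \<open>tol\<close>.\<close>

definition "agree N i \<omega> \<longleftrightarrow> norm (x (real i * (\<Delta> / real N)) \<omega>) \<le> h \<and> norm (X (i div N) \<omega>) \<le> h
    \<and> norm (euler (\<Delta> / real N) i \<omega> - x (real i * (\<Delta> / real N)) \<omega>) \<le> tol"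

definition "gap N i \<omega> = euler (\<Delta> / real N) i \<omega> - interp N i \<omega>"

lemma coarse_time: "real (i div N) * \<Delta> \<le> real i * (\<Delta> / real N)" "0 < N \<Longrightarrow> real i * (\<Delta> / real N) \<le> real (Suc (i div N)) * \<Delta>"
proof -
  show "real (i div N) * \<Delta> \<le> real i * (\<Delta> / real N)"
  proof (cases "N = 0")
    case False
    have "real (i div N) \<le> real i / real N" by (rule of_nat_div_le_of_nat)
    then show ?thesis using mult_right_mono[of "real (i div N)" "real i / real N" \<Delta>] D by simp
  qed simp
  assume N: "0 < N"
  have "i < Suc (i div N) * N" using N by (metis dividend_less_div_times mult.commute mult_Suc add.commute)
  then have "real i \<le> real (Suc (i div N)) * real N" by (metis less_imp_le of_nat_le_iff of_nat_mult)
  then have "real i / real N \<le> real (Suc (i div N))" using N by (simp add: pos_divide_le_eq)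
  from mult_right_mono[OF this less_imp_le[OF D]] show "real i * (\<Delta> / real N) \<le> real (Suc (i div N)) * \<Delta>" by simp
qed

lemma X_F_interp: "X (i div N) \<in> borel_measurable (F (real i * (\<Delta> / real N)))"
  by (rule measurable_F_mono[OF X_F _ coarse_time(1)]) (use D in simp)

definition err_const :: "real \<Rightarrow> real" where
  "err_const T = exp (q / 2 * (4 * H + 2) * T + 1) * (1 + T * (q / 2) * ((4 * H + 3) powr (q / 2) * 64 * (incr_const T + 1)))"

lemma err_const_nonneg: "0 \<le> T \<Longrightarrow> 0 \<le> err_const T"
  unfolding err_const_def using q H incr_const_nonneg[of T] by (intro mult_nonneg_nonneg add_nonneg_nonneg) auto

lemma incr_M: "0 \<le> t \<Longrightarrow> incr k t \<in> borel_measurable M"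
proof -
  assume t: "0 \<le> t"
  have t0: "0 \<le> real k * \<Delta>" using D by simp
  note [measurable] = X_M[of k] B_M[OF t] B_M[OF t0]
  show ?thesis unfolding incr_def[abs_def] by measurable
qed

text \<open>The one-sided condition holds for x minus the step process, whereas the chain is e, the
  Euler sum minus the continuous scheme; the two differ by at most D' = |increment| +
  \<open>tol\<close>. Moving the inner product costs 2 D' L(h) (|e| + D') <= |e|^2 + 3 (L(h) D')^2,
  so the source is of size (L(h) D')^2. As D' is of order L(h) sqrt(\<Delta>) in L^q, this is where
  L(h)^(2q) arises. The coefficient bound \<open>a\<close> grows with h but enters only through
  \<open>growth_rate\<close> on the refined grid.\<close>

lemma stopped_gap_moment:
  assumes N: "0 < N" and i: "real i * (\<Delta> / real N) \<le> T"
  defines "a \<equiv> 2 * h * L h / sqrt \<eta>"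
  shows "(\<integral>\<^sup>+\<omega>. ennreal ((\<eta> + (norm (stopped (gap N) (agree N) i \<omega>))\<^sup>2) powr (q / 2)) \<partial>M)
    \<le> ennreal (exp (real i * growth_rate (q / 2) (4 * H + 1) a a (\<Delta> / real N))
        * (1 + T * (q / 2) * ((4 * H + 3) powr (q / 2) * 64 * (incr_const T + 1))) * err)"
proof -
  let ?d = "\<Delta> / real N" and ?r = "q / 2"
  let ?t = "\<lambda>j. real j * ?d"
  have d: "0 < ?d" using D N by simp
  have t0: "0 \<le> ?t j" for j by (rule mult_nonneg_nonneg[OF _ less_imp_le[OF d]]) simp
  define ic where "ic = (\<lambda>j. incr (j div N) (?t j))"
  define \<zeta> where "\<zeta> = (\<lambda>j \<omega>. if j < i then (4 * H + 3) * (L h * (norm (ic j \<omega>) + tol))\<^sup>2 else 0)"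
  define af where "af = (\<lambda>j \<omega>. f (x (?t j) \<omega>) - fD (X (j div N) \<omega>))"
  define bf where "bf = (\<lambda>j \<omega>. g (x (?t j) \<omega>) - gD (X (j div N) \<omega>))"
  have icM [measurable]: "ic j \<in> borel_measurable M" for j unfolding ic_def by (rule incr_M[OF t0])
  have a0: "0 \<le> a" using h Lh eta_pos by (simp add: a_def)
  have "(\<integral>\<^sup>+\<omega>. ennreal ((\<eta> + (norm (stopped (gap N) (agree N) i \<omega>))\<^sup>2) powr ?r) \<partial>M)
    \<le> ennreal (exp (real i * growth_rate ?r (4 * H + 1) a a ?d)) *
       (ennreal ((\<eta> + (norm (0 :: real^'c))\<^sup>2) powr ?r) + (\<Sum>j<i. ennreal (?d * ?r) * (\<integral>\<^sup>+\<omega>. ennreal (\<zeta> j \<omega> powr ?r) \<partial>M)))"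
  proof (rule stopped_moment_bound[OF d, where a = af and b = bf])
    show "gap N (Suc j) \<omega> = gap N j \<omega> + ?d *\<^sub>R af j \<omega> + bf j \<omega> *v (B (?t (Suc j)) \<omega> - B (?t j) \<omega>)" for j \<omega>
      unfolding gap_def interp_Suc[OF N] af_def bf_def by (simp add: euler_def algebra_simps)
    show "gap N 0 \<omega> = 0" if "\<omega> \<in> space M" for \<omega> by (simp add: gap_def interp_def euler_def incr_def)
    show "af j \<in> borel_measurable (F (?t j))" "bf j \<in> borel_measurable (F (?t j))" for j
      using x_F[OF t0[of j]] X_F_interp[of j N] unfolding af_def bf_def by measurable
    show "{\<omega>\<in>space M. agree N j \<omega>} \<in> sets (F (?t j))" for j
    proof -
      note [measurable] = x_F[OF t0[of j]] X_F_interp[of j N] euler_F[OF d, of j]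
      have "{\<omega>\<in>space (F (?t j)). agree N j \<omega>} \<in> sets (F (?t j))" unfolding agree_def by measurable
      then show ?thesis unfolding space_F[OF t0[of j]] .
    qed
    show "\<zeta> j \<in> borel_measurable M" for j unfolding \<zeta>_def by measurable
    show "0 \<le> \<zeta> j \<omega>" for j \<omega> using H by (simp add: \<zeta>_def)
    fix j \<omega> assume j: "j < i" and "\<And>l. l \<le> j \<Longrightarrow> agree N l \<omega>"
    then have "agree N j \<omega>" by simp
    let ?x = "x (?t j) \<omega>" and ?X = "X (j div N) \<omega>" and ?e = "gap N j \<omega>"
    from \<open>agree N j \<omega>\<close> have xh: "norm ?x \<le> h" and Xh: "norm ?X \<le> h" and zx: "norm (euler ?d j \<omega> - ?x) \<le> tol"
      by (auto simp: agree_def)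
    have af': "af j \<omega> = f ?x - f ?X" and bf': "bf j \<omega> = g ?x - g ?X" using Xh by (auto simp: af_def bf_def mtrunc_def)
    have la: "norm (af j \<omega>) \<le> L h * norm (?x - ?X)" "norm (bf j \<omega>) \<le> L h * norm (?x - ?X)"
      unfolding af' bf' using xh Xh h by (intro f_lip g_lip; simp)+
    have "norm (?x - ?X) \<le> 2 * h" using norm_triangle_ineq4[of ?x ?X] xh Xh by linarith
    then have "L h * norm (?x - ?X) \<le> L h * (2 * h)" using Lh by (intro mult_left_mono) auto
    \<comment> \<open>Inside the ball the coefficients have merely the absolute bound 2 h L(h); the
      shift \<eta> converts it into the relative bound that the chain estimate asks for.\<close>
    also have "\<dots> = a * sqrt \<eta>" using eta_pos by (simp add: a_def)
    also have "\<dots> \<le> a * sqrt (\<eta> + (norm ?e)\<^sup>2)" using a0 by (intro mult_left_mono) auto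
    finally show "norm (af j \<omega>) \<le> a * sqrt (\<eta> + (norm ?e)\<^sup>2)" "norm (bf j \<omega>) \<le> a * sqrt (\<eta> + (norm ?e)\<^sup>2)"
      using la by linarith+
    define D' where "D' = norm (ic j \<omega>) + tol"
    have D0: "0 \<le> D'" using tol_pos by (simp add: D'_def)
    have ex: "norm (?e - (?x - ?X)) \<le> D'"
    proof -
      have eq: "?e - (?x - ?X) = (euler ?d j \<omega> - ?x) - ic j \<omega>" by (simp add: gap_def interp_def ic_def)
      show ?thesis unfolding eq D'_def using norm_triangle_ineq4[of "euler ?d j \<omega> - ?x" "ic j \<omega>"] zx by linarith
    qed
    have xe: "norm (?x - ?X) \<le> norm ?e + D'"
      using norm_triangle_sub[of "?x - ?X" ?e] ex by (simp add: norm_minus_commute)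
    have m: "2 * inner (?x - ?X) (af j \<omega>) + (q - 1) * (norm (bf j \<omega>))\<^sup>2 \<le> 2 * H * (norm (?x - ?X))\<^sup>2"
      using monot[of ?x ?X] unfolding af' bf' by (simp add: field_simps)
    have "inner (?e - (?x - ?X)) (af j \<omega>) \<le> norm (?e - (?x - ?X)) * norm (af j \<omega>)" by (rule norm_cauchy_schwarz)
    also have "\<dots> \<le> D' * (L h * (norm ?e + D'))"
    proof (intro mult_mono ex)
      show "norm (af j \<omega>) \<le> L h * (norm ?e + D')"
        using la(1) mult_left_mono[OF xe, of "L h"] Lh by linarith
    qed (use D0 in auto)
    finally have i2: "2 * inner ?e (af j \<omega>) \<le> 2 * inner (?x - ?X) (af j \<omega>) + 2 * (D' * (L h * (norm ?e + D')))"
      by (simp add: inner_diff_left)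
    have x2: "2 * H * (norm (?x - ?X))\<^sup>2 \<le> 2 * H * (2 * (norm ?e)\<^sup>2 + 2 * D'\<^sup>2)"
    proof (intro mult_left_mono)
      have "(norm (?x - ?X))\<^sup>2 \<le> (norm ?e + D')\<^sup>2" using xe by (intro power_mono) auto
      also have "\<dots> \<le> 2 * (norm ?e)\<^sup>2 + 2 * D'\<^sup>2"
        using zero_le_power2[of "norm ?e - D'"] unfolding power2_diff power2_sum by linarith
      finally show "(norm (?x - ?X))\<^sup>2 \<le> 2 * (norm ?e)\<^sup>2 + 2 * D'\<^sup>2" .
    qed (use H in simp)
    have cr: "2 * (D' * (L h * (norm ?e + D'))) \<le> (norm ?e)\<^sup>2 + 3 * (L h * D')\<^sup>2"
    proof -
      have "2 * (L h * D') * norm ?e \<le> (norm ?e)\<^sup>2 + (L h * D')\<^sup>2"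
        using zero_le_power2[of "norm ?e - L h * D'"] unfolding power2_diff by (simp add: algebra_simps)
      moreover have "L h * D' * D' \<le> L h * D' * (L h * D')" using Lh D0 mult_right_mono[of 1 "L h" D'] by (intro mult_left_mono) auto
      ultimately show ?thesis by (simp add: algebra_simps power2_eq_square)
    qed
    have DL: "4 * H * D'\<^sup>2 \<le> 4 * H * (L h * D')\<^sup>2"
      using Lh D0 H mult_right_mono[of 1 "L h" D'] by (intro mult_left_mono power_mono) auto
    have "2 * inner ?e (af j \<omega>) + (q - 1) * (norm (bf j \<omega>))\<^sup>2 \<le> (4 * H + 1) * (norm ?e)\<^sup>2 + (4 * H + 3) * (L h * D')\<^sup>2"
      using i2 m x2 cr DL by (simp add: algebra_simps)
    also have "\<dots> \<le> (4 * H + 1) * (\<eta> + (norm ?e)\<^sup>2) + \<zeta> j \<omega>"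
      using H eta_pos j by (simp add: \<zeta>_def D'_def)
    finally show "2 * inner ?e (af j \<omega>) + (2 * (q / 2) - 1) * (norm (bf j \<omega>))\<^sup>2 \<le> (4 * H + 1) * (\<eta> + (norm ?e)\<^sup>2) + \<zeta> j \<omega>"
      by simp
  qed (use q p H eta_pos a0 in auto)
  also have "\<dots> \<le> ennreal (exp (real i * growth_rate ?r (4 * H + 1) a a ?d)) *
       (ennreal err + (\<Sum>j<i. ennreal (?d * ?r) * ennreal ((4 * H + 3) powr ?r * 64 * (incr_const T + 1) * err)))"
  proof (intro mult_left_mono add_mono sum_mono)
    show "ennreal ((\<eta> + (norm (0 :: real^'c))\<^sup>2) powr ?r) \<le> ennreal err" using eta_powr by simp
    fix j assume "j \<in> {..<i}"
    then have j: "j < i" by simp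
    have jt: "?t j \<le> T" using i j d by (meson less_imp_le mult_right_mono of_nat_mono order_trans)
    let ?c = "(4 * H + 3) powr ?r * L h powr q * 64"
    have "(\<integral>\<^sup>+\<omega>. ennreal (\<zeta> j \<omega> powr ?r) \<partial>M) \<le> (\<integral>\<^sup>+\<omega>. ennreal ?c * (ennreal (norm (ic j \<omega>) powr q) + ennreal (tol powr q)) \<partial>M)"
    proof (rule nn_integral_mono)
      fix \<omega>
      have t: "0 \<le> norm (ic j \<omega>) + tol" using tol_pos by simp
      have "\<zeta> j \<omega> powr ?r = (4 * H + 3) powr ?r * ((L h * (norm (ic j \<omega>) + tol))\<^sup>2) powr ?r"
        using j by (simp add: \<zeta>_def powr_mult)
      also have "((L h * (norm (ic j \<omega>) + tol))\<^sup>2) powr ?r = (L h * (norm (ic j \<omega>) + tol)) powr q"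
        using t Lh tol_pos by (simp add: powr_powr add_nonneg_pos flip: powr_numeral)
      also have "\<dots> = L h powr q * norm (norm (ic j \<omega>) + tol) powr q" using t by (simp add: powr_mult)
      also have "norm (norm (ic j \<omega>) + tol) powr q \<le> 64 * (norm (norm (ic j \<omega>)) powr q + norm tol powr q)"
        using q p by (intro norm_add_powr_le) auto
      finally have "\<zeta> j \<omega> powr ?r \<le> ?c * (norm (ic j \<omega>) powr q + tol powr q)"
        using tol_pos by (simp add: mult_left_mono mult.assoc)
      then have "ennreal (\<zeta> j \<omega> powr ?r) \<le> ennreal (?c * (norm (ic j \<omega>) powr q + tol powr q))" by (rule ennreal_leI)
      also have "\<dots> = ennreal ?c * (ennreal (norm (ic j \<omega>) powr q) + ennreal (tol powr q))"
        by (simp add: ennreal_mult ennreal_plus)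
      finally show "ennreal (\<zeta> j \<omega> powr ?r) \<le> ennreal ?c * (ennreal (norm (ic j \<omega>) powr q) + ennreal (tol powr q))" .
    qed
    also have "\<dots> = ennreal ?c * ((\<integral>\<^sup>+\<omega>. ennreal (norm (ic j \<omega>) powr q) \<partial>M) + ennreal (tol powr q))"
      using emeasure_space_1 by (simp add: nn_integral_cmult nn_integral_add)
    also have "\<dots> \<le> ennreal ?c * (ennreal (incr_const T * (L h powr q * \<Delta> powr (q / 2))) + ennreal (L h powr q * \<Delta> powr (q / 2)))"
      unfolding tol_powr ic_def using coarse_time[where i = j and N = N] N jt q
      by (intro mult_left_mono add_right_mono incr_moment) auto
    also have "\<dots> = ennreal (?c * (incr_const T * (L h powr q * \<Delta> powr (q / 2)) + L h powr q * \<Delta> powr (q / 2)))"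
      using incr_const_nonneg[of T] by (simp add: ennreal_mult ennreal_plus)
    also have "?c * (incr_const T * (L h powr q * \<Delta> powr (q / 2)) + L h powr q * \<Delta> powr (q / 2)) = (4 * H + 3) powr ?r * 64 * (incr_const T + 1) * err"
      unfolding err_eq by (simp add: algebra_simps)
    finally show "(\<integral>\<^sup>+\<omega>. ennreal (\<zeta> j \<omega> powr ?r) \<partial>M) \<le> ennreal ((4 * H + 3) powr ?r * 64 * (incr_const T + 1) * err)" .
  qed auto
  also have "\<dots> \<le> ennreal (exp (real i * growth_rate ?r (4 * H + 1) a a ?d)
        * (1 + T * ?r * ((4 * H + 3) powr ?r * 64 * (incr_const T + 1))) * err)"
  proof -
    define k where "k = (4 * H + 3) powr ?r * 64 * (incr_const T + 1)"
    define E where "E = exp (real i * growth_rate ?r (4 * H + 1) a a ?d)"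
    have k0: "0 \<le> k" using incr_const_nonneg[of T] by (simp add: k_def)
    have p0: "0 \<le> ?d * ?r" "0 \<le> k * err" using less_imp_le[OF d] q k0 err_pos by (intro mult_nonneg_nonneg; simp)+
    have "(\<Sum>j<i. ennreal (?d * ?r) * ennreal (k * err)) = (\<Sum>j<i. ennreal (?d * ?r * (k * err)))"
      using ennreal_mult[OF p0] by simp
    also have "\<dots> = ennreal (\<Sum>j<i. ?d * ?r * (k * err))"
      by (rule sum_ennreal) (use mult_nonneg_nonneg[OF p0] in simp)
    also have "(\<Sum>j<i. ?d * ?r * (k * err)) = real i * (?d * ?r * (k * err))" by simp
    finally have "(\<Sum>j<i. ennreal (?d * ?r) * ennreal (k * err)) = ennreal (real i * (?d * ?r * (k * err)))" .
    moreover have z0: "0 \<le> real i * (?d * ?r * (k * err))" by (rule mult_nonneg_nonneg[OF of_nat_0_le_iff mult_nonneg_nonneg[OF p0]])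
    moreover have "ennreal E * ennreal (err + real i * (?d * ?r * (k * err))) = ennreal (E * (err + real i * (?d * ?r * (k * err))))"
      by (rule ennreal_mult[OF _ add_nonneg_nonneg[OF less_imp_le[OF err_pos] z0], symmetric]) (simp add: E_def)
    ultimately have "ennreal E * (ennreal err + (\<Sum>j<i. ennreal (?d * ?r) * ennreal (k * err))) = ennreal (E * (err + real i * (?d * ?r * (k * err))))"
      using ennreal_plus[OF less_imp_le[OF err_pos] z0] by (simp only:)
    also have "\<dots> \<le> ennreal (E * (1 + T * ?r * k) * err)"
    proof (rule ennreal_leI)
      have "real i * (?d * ?r * (k * err)) = (real i * ?d) * (?r * (k * err))" by simp
      also have "\<dots> \<le> T * (?r * (k * err))" using i q k0 err_pos by (intro mult_right_mono) auto
      finally have "E * (err + real i * (?d * ?r * (k * err))) \<le> E * (err + T * (?r * (k * err)))"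
        by (intro mult_left_mono add_left_mono) (auto simp: E_def)
      also have "\<dots> = E * (1 + T * ?r * k) * err" by (simp add: algebra_simps)
      finally show "E * (err + real i * (?d * ?r * (k * err))) \<le> E * (1 + T * ?r * k) * err" .
    qed
    finally show ?thesis unfolding E_def k_def .
  qed
  finally show ?thesis .
qed

end

text \<open>The last fine grid point up to \<open>T\<close> lies in the same scheme step as
  \<open>T\<close>, so the continuous scheme uses the same coefficients at both times.\<close>

lemma floor_div_grid:
  assumes T: "0 \<le> T" and D: "0 < (\<Delta>::real)" and N: "0 < N"
  defines "k \<equiv> nat \<lfloor>T / \<Delta>\<rfloor>" and "i \<equiv> nat \<lfloor>T / (\<Delta> / real N)\<rfloor>"
  shows "real k * \<Delta> \<le> T" "T < real (Suc k) * \<Delta>" "real i * (\<Delta> / real N) \<le> T" "T < real (Suc i) * (\<Delta> / real N)"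
    "i div N = k" "i \<le> Suc k * N"
proof -
  have fl: "real (nat \<lfloor>T / e\<rfloor>) * e \<le> T" "T < real (Suc (nat \<lfloor>T / e\<rfloor>)) * e" if e: "0 < e" for e :: real
  proof -
    have "real (nat \<lfloor>T / e\<rfloor>) = of_int \<lfloor>T / e\<rfloor>" using T e by simp
    moreover have "of_int \<lfloor>T / e\<rfloor> \<le> T / e" "T / e < of_int \<lfloor>T / e\<rfloor> + 1" by linarith+
    ultimately have "real (nat \<lfloor>T / e\<rfloor>) \<le> T / e" "T / e < real (Suc (nat \<lfloor>T / e\<rfloor>))" by linarith+
    then show "real (nat \<lfloor>T / e\<rfloor>) * e \<le> T" "T < real (Suc (nat \<lfloor>T / e\<rfloor>)) * e"
      unfolding pos_le_divide_eq[OF e] pos_divide_less_eq[OF e] by this+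
  qed
  have dp: "0 < \<Delta> / real N" using D N by simp
  show k: "real k * \<Delta> \<le> T" "T < real (Suc k) * \<Delta>" unfolding k_def using fl[OF D] by auto
  show i: "real i * (\<Delta> / real N) \<le> T" "T < real (Suc i) * (\<Delta> / real N)" unfolding i_def using fl[OF dp] by auto
  have "real k * real N * (\<Delta> / real N) < real (Suc i) * (\<Delta> / real N)" using k i N by simp
  then have "real k * real N < real (Suc i)" using dp by (simp only: mult_less_cancel_right_pos)
  then have 1: "N * k \<le> i" by (metis less_Suc_eq_le mult.commute of_nat_less_iff of_nat_mult)
  have "real i * (\<Delta> / real N) < real (Suc k) * real N * (\<Delta> / real N)" using k i N by simp
  then have "real i < real (Suc k) * real N" using dp by (simp only: mult_less_cancel_right_pos)
  then have 2: "i < N * Suc k" by (metis mult.commute of_nat_less_iff of_nat_mult)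
  show "i div N = k" by (rule div_nat_eqI[OF 1 2])
  show "i \<le> Suc k * N" using 2 by (simp add: mult.commute)
qed

section \<open>From the stopped gap to the error at time T\<close>

context mtem_error
begin

text \<open>Four tail bounds in units of h^(-p): 1 each for the deviation of the Euler sum and for
  the oscillation between the last grid point and the final time,
  \<open>1 + 64 * moment_bound T\<close> for the exit of \<open>x\<close>,
  \<open>scheme_bound T\<close> for the exit of the scheme.\<close>

definition tail_const :: "real \<Rightarrow> real" where
  "tail_const T = 3 + 64 * moment_bound T + scheme_bound T"

text \<open>The factor 729 = 3^6 comes from three errors of size \<open>tol\<close>. The bracket is
  the bound on the p-th moment of the error, to which Young's inequality gives the weight
  \<open>err\<close>.\<close>

definition final_const :: "real \<Rightarrow> real" where
  "final_const T = 64 * 729 + 64 * err_const T + (64 * (8 * moment_bound T + 1 + 64 * (scheme_bound T + incr_const T))) + tail_const T"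

lemma incr_continuous: "\<omega> \<in> space M \<Longrightarrow> continuous_on {0..} (\<lambda>t. incr k t \<omega>)"
  unfolding incr_def
  by (intro continuous_intros bounded_linear.continuous_on[OF matrix_vector_mul_bounded_linear] B_cont)

lemma cont_eq: "mtem_cont f g h \<Delta> x0 B T \<omega> = X (nat \<lfloor>T / \<Delta>\<rfloor>) \<omega> + incr (nat \<lfloor>T / \<Delta>\<rfloor>) T \<omega>"
  by (simp add: mtem_cont_def incr_def Let_def add.assoc)

text \<open>A bound uniform in \<Delta> is enough here, since Young's inequality multiplies it by
  \<open>err\<close>; L(h)^2 \<Delta> <= 1 keeps the increment term bounded.\<close>

lemma cont_p_moment:
  assumes T: "0 < T"
  shows "(\<integral>\<^sup>+\<omega>. ennreal (norm (x T \<omega> - mtem_cont f g h \<Delta> x0 B T \<omega>) powr p) \<partial>M)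
     \<le> ennreal (64 * (8 * moment_bound (T + 1) + 1 + 64 * (scheme_bound (T + 1) + incr_const (T + 1))))"
proof -
  define k where "k = nat \<lfloor>T / \<Delta>\<rfloor>"
  note kT = floor_div_grid(1,2)[OF less_imp_le[OF T] D, of 1, folded k_def]
  have xM [measurable]: "x T \<in> borel_measurable M" using T by (intro x_M) simp
  have XM [measurable]: "X k \<in> borel_measurable M" by (rule X_M)
  have iM [measurable]: "incr k T \<in> borel_measurable M" using T by (intro incr_M) simp
  have pw: "norm (x T \<omega> - mtem_cont f g h \<Delta> x0 B T \<omega>) powr p \<le> 64 * (norm (x T \<omega>) powr p + 64 * ((1 + (norm (X k \<omega>))\<^sup>2) powr (p / 2) + norm (incr k T \<omega>) powr p))" for \<omega>
  proof -
    have "norm (x T \<omega> - mtem_cont f g h \<Delta> x0 B T \<omega>) powr p \<le> 64 * (norm (x T \<omega>) powr p + norm (- mtem_cont f g h \<Delta> x0 B T \<omega>) powr p)"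
      using norm_add_powr_le[of p "x T \<omega>" "- mtem_cont f g h \<Delta> x0 B T \<omega>"] p by simp
    moreover have "norm (- mtem_cont f g h \<Delta> x0 B T \<omega>) powr p \<le> 64 * (norm (X k \<omega>) powr p + norm (incr k T \<omega>) powr p)"
      unfolding cont_eq k_def[symmetric] norm_minus_cancel using p by (intro norm_add_powr_le) auto
    moreover have "norm (X k \<omega>) powr p \<le> (1 + (norm (X k \<omega>))\<^sup>2) powr (p / 2)"
    proof -
      have "norm (X k \<omega>) powr p = ((norm (X k \<omega>))\<^sup>2) powr (p / 2)" by (rule norm_sq_powr_half[symmetric])
      also have "\<dots> \<le> (1 + (norm (X k \<omega>))\<^sup>2) powr (p / 2)" using p by (intro powr_mono2) auto
      finally show ?thesis .
    qed
    ultimately show ?thesis by argo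
  qed
  have mb: "0 \<le> moment_bound (T + 1)" using T by (intro moment_bound_nonneg) simp
  have "(\<integral>\<^sup>+\<omega>. ennreal (norm (x T \<omega> - mtem_cont f g h \<Delta> x0 B T \<omega>) powr p) \<partial>M) \<le>
     (\<integral>\<^sup>+\<omega>. ennreal 64 * (ennreal (norm (x T \<omega>) powr p) + ennreal 64 * (ennreal ((1 + (norm (X k \<omega>))\<^sup>2) powr (p / 2)) + ennreal (norm (incr k T \<omega>) powr p))) \<partial>M)"
  proof (rule nn_integral_mono)
    fix \<omega>
    have "ennreal (norm (x T \<omega> - mtem_cont f g h \<Delta> x0 B T \<omega>) powr p) \<le> ennreal (64 * (norm (x T \<omega>) powr p + 64 * ((1 + (norm (X k \<omega>))\<^sup>2) powr (p / 2) + norm (incr k T \<omega>) powr p)))"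
      by (intro ennreal_leI pw)
    also have "\<dots> = ennreal 64 * (ennreal (norm (x T \<omega>) powr p) + ennreal 64 * (ennreal ((1 + (norm (X k \<omega>))\<^sup>2) powr (p / 2)) + ennreal (norm (incr k T \<omega>) powr p)))"
      by (simp add: ennreal_mult ennreal_plus del: ennreal_numeral distrib_left_numeral)
    finally show "ennreal (norm (x T \<omega> - mtem_cont f g h \<Delta> x0 B T \<omega>) powr p) \<le> \<dots>" .
  qed
  also have "\<dots> = ennreal 64 * ((\<integral>\<^sup>+\<omega>. ennreal (norm (x T \<omega>) powr p) \<partial>M) + ennreal 64 * ((\<integral>\<^sup>+\<omega>. ennreal ((1 + (norm (X k \<omega>))\<^sup>2) powr (p / 2)) \<partial>M) + (\<integral>\<^sup>+\<omega>. ennreal (norm (incr k T \<omega>) powr p) \<partial>M)))"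
    by (simp add: nn_integral_cmult nn_integral_add)
  also have "\<dots> \<le> ennreal 64 * (ennreal (8 * moment_bound (T + 1) + 1) + ennreal 64 * (ennreal (scheme_bound (T + 1)) + ennreal (incr_const (T + 1))))"
  proof (intro mult_left_mono add_mono)
    show "(\<integral>\<^sup>+\<omega>. ennreal (norm (x T \<omega>) powr p) \<partial>M) \<le> ennreal (8 * moment_bound (T + 1) + 1)"
      using T by (intro solution_moment) auto
    show "(\<integral>\<^sup>+\<omega>. ennreal ((1 + (norm (X k \<omega>))\<^sup>2) powr (p / 2)) \<partial>M) \<le> ennreal (scheme_bound (T + 1))"
      by (rule scheme_moment) (use kT in simp)
    have "(\<integral>\<^sup>+\<omega>. ennreal (norm (incr k T \<omega>) powr p) \<partial>M) \<le> ennreal (incr_const (T + 1) * (L h powr p * \<Delta> powr (p / 2)))"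
      by (rule incr_moment) (use kT p in auto)
    also have "\<dots> \<le> ennreal (incr_const (T + 1) * 1)"
    proof (intro ennreal_leI mult_left_mono incr_const_nonneg)
      have "(L h)\<^sup>2 * \<Delta> \<le> L h ^ 4 * \<Delta>" using Lh D by (intro mult_right_mono power_increasing) auto
      then have L2: "(L h)\<^sup>2 * \<Delta> \<le> 1" using LD by linarith
      have "L h powr p = ((L h)\<^sup>2) powr (p / 2)" using Lh by (simp add: powr_powr flip: powr_numeral)
      then have "L h powr p * \<Delta> powr (p / 2) = ((L h)\<^sup>2 * \<Delta>) powr (p / 2)" by (simp add: powr_mult)
      also have "\<dots> \<le> 1" using L2 Lh D p by (intro powr_le1) auto
      finally show "L h powr p * \<Delta> powr (p / 2) \<le> 1" .
    qed
    finally show "(\<integral>\<^sup>+\<omega>. ennreal (norm (incr k T \<omega>) powr p) \<partial>M) \<le> ennreal (incr_const (T + 1))" by simp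
  qed auto
  also have "\<dots> = ennreal (64 * (8 * moment_bound (T + 1) + 1 + 64 * (scheme_bound (T + 1) + incr_const (T + 1))))"
    using mb scheme_bound_nonneg[of "T + 1"] incr_const_nonneg[of "T + 1"]
    by (simp add: ennreal_mult ennreal_plus add_nonneg_nonneg del: ennreal_numeral distrib_left_numeral)
  finally show ?thesis .
qed

text \<open>For one fixed \<Delta> the number N of subdivisions is at disposal: it is taken so large
  that the errors of the refined grid exceed \<open>tol\<close> with probability below h^(-p) and
  the growth rate is near its limit. N depends on \<Delta>, the resulting bounds do not. Off the bad
  event the error is the gap plus three terms of size \<open>tol\<close>; on it
  \<open>powr_interpolate\<close> applies.\<close>

lemma strong_error_cont:
  assumes T: "0 < T"
  shows "(\<integral>\<^sup>+\<omega>. ennreal (norm (x T \<omega> - mtem_cont f g h \<Delta> x0 B T \<omega>) powr q) \<partial>M) \<le> ennreal (final_const (T + 1) * err)"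
proof -
  define k where "k = nat \<lfloor>T / \<Delta>\<rfloor>"
  \<comment> \<open>The horizon moves to the first multiple of \<Delta> after \<open>T\<close>, as
    \<open>T\<close> itself need not be a grid time. Cutting [0, T'] into m N pieces gives the step
    \<Delta>/N, and all scheme times up to T' lie on this grid.\<close>
  define m where "m = Suc k"
  define T' where "T' = real m * \<Delta>"
  define I where "I = (\<lambda>N. nat \<lfloor>T / (\<Delta> / real N)\<rfloor>)"
  note kT = floor_div_grid(1,2)[OF less_imp_le[OF T] D, of 1, folded k_def]
  have iT: "real (I N) * (\<Delta> / real N) \<le> T" "T < real (Suc (I N)) * (\<Delta> / real N)" "I N div N = k" "I N \<le> m * N" if "0 < N" for N
    unfolding I_def m_def k_def using floor_div_grid[OF less_imp_le[OF T] D that] by auto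
  have "T' = real k * \<Delta> + \<Delta>" by (simp add: T'_def m_def algebra_simps)
  then have T': "0 < T'" "T' \<le> T + 1" using T D kT LD_le(3) unfolding T'_def m_def by linarith+
  have sm: "filterlim (\<lambda>N. m * N) sequentially sequentially"
    by (intro filterlim_subseq strict_monoI) (auto simp: m_def simp del: mult_Suc)
  have TN: "T' / real (m * N) = \<Delta> / real N" for N
  proof -
    have "real m \<noteq> 0" by (simp add: m_def)
    then show ?thesis by (simp add: T'_def)
  qed
  have h0: "0 < h powr p" using h by simp
  define P1 where "P1 = (\<lambda>N. {\<omega>\<in>space M. \<exists>i\<le>m * N. tol < norm (euler (\<Delta> / real N) i \<omega> - x (real i * (\<Delta> / real N)) \<omega>)})"
  define P2 where "P2 = (\<lambda>N. {\<omega>\<in>space M. \<exists>i\<le>m * N. h < norm (x (real i * (\<Delta> / real N)) \<omega>)})"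
  define P3 where "P3 = {\<omega>\<in>space M. \<exists>j\<le>m. h < norm (X j \<omega>)}"
  define P4 where "P4 = (\<lambda>N. {\<omega>\<in>space M. tol < norm (x T \<omega> - x (real (I N) * (\<Delta> / real N)) \<omega>) \<or> tol < norm (incr k (real (I N) * (\<Delta> / real N)) \<omega> - incr k T \<omega>)})"
  have d0: "0 \<le> \<Delta> / real N" for N using D by simp
  have g0: "0 \<le> real i * (\<Delta> / real N)" for i N by (rule mult_nonneg_nonneg[OF _ d0]) simp
  have T0: "0 \<le> T" using T by simp
  note [measurable] = grid_M[OF d0] euler_M[OF d0] X_M x_M[OF T0] incr_M[OF T0] incr_M[OF g0]
  have PM: "P1 N \<in> sets M" "P2 N \<in> sets M" "P3 \<in> sets M" "P4 N \<in> sets M" for N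
    unfolding P1_def P2_def P3_def P4_def by measurable
  have e1: "\<forall>\<^sub>F N in sequentially. measure M (P1 N) < 1 / h powr p"
  proof -
    have "(\<lambda>N. measure M (P1 N)) \<longlonglongrightarrow> 0"
      using filterlim_compose[OF euler_uniformly_close[OF T'(1) tol_pos] sm] unfolding TN P1_def .
    then show ?thesis by (rule order_tendstoD(2)) (use h0 in simp)
  qed
  have e2: "\<forall>\<^sub>F N in sequentially. measure M (P2 N) \<le> (1 + 64 * moment_bound (T + 1)) / h powr p"
    using eventually_compose_filterlim[OF exceed_grid[OF T' h] sm] unfolding TN P2_def .
  have e3: "measure M P3 \<le> scheme_bound (T + 1) / h powr p"
    unfolding P3_def by (rule scheme_exceed) (use T' in \<open>simp add: T'_def\<close>)
  have e4: "\<forall>\<^sub>F N in sequentially. measure M (P4 N) < 1 / h powr p"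
  proof -
    have "(\<lambda>N. measure M (P4 N)) \<longlonglongrightarrow> 0"
    proof (rule measure_tendsto_0_pointwise[OF PM(4)])
      fix \<omega> assume \<omega>: "\<omega> \<in> space M"
      have c1: "continuous_on {0..T} (\<lambda>s. x s \<omega>)" using x_cont[OF \<omega>] by (rule continuous_on_subset) auto
      have c2: "continuous_on {0..T} (\<lambda>s. incr k s \<omega>)" using incr_continuous[OF \<omega>] by (rule continuous_on_subset) auto
      obtain d1 where d1: "0 < d1" "\<And>s t. s \<in> {0..T} \<Longrightarrow> t \<in> {0..T} \<Longrightarrow> \<bar>t - s\<bar> < d1 \<Longrightarrow> dist (x t \<omega>) (x s \<omega>) < tol"
        using uniform_osc[OF c1 tol_pos] by blast
      obtain d2 where d2: "0 < d2" "\<And>s t. s \<in> {0..T} \<Longrightarrow> t \<in> {0..T} \<Longrightarrow> \<bar>t - s\<bar> < d2 \<Longrightarrow> dist (incr k t \<omega>) (incr k s \<omega>) < tol"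
        using uniform_osc[OF c2 tol_pos] by blast
      from step_small[OF d1(1), of \<Delta>] step_small[OF d2(1), of \<Delta>] eventually_gt_at_top[of 0]
      show "\<forall>\<^sub>F N in sequentially. \<omega> \<notin> P4 N"
      proof eventually_elim
        case (elim N)
        let ?s = "real (I N) * (\<Delta> / real N)"
        have "T < ?s + \<Delta> / real N" using iT(2)[OF elim(3)] by (simp only: of_nat_Suc distrib_right mult_1 add.commute)
        then have "\<bar>T - ?s\<bar> < d1" "\<bar>T - ?s\<bar> < d2" using elim iT(1)[OF elim(3)] by linarith+
        moreover have "?s \<in> {0..T}" "T \<in> {0..T}" using iT(1)[OF elim(3)] g0 T0 by (simp_all only: atLeastAtMost_iff order_refl simp_thms)
        ultimately have "dist (x T \<omega>) (x ?s \<omega>) < tol" "dist (incr k T \<omega>) (incr k ?s \<omega>) < tol" using d1 d2 by blast+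
        then show ?case unfolding P4_def dist_norm by (simp add: norm_minus_commute)
      qed
    qed
    then show ?thesis by (rule order_tendstoD(2)) (use h0 in simp)
  qed
  define a where "a = 2 * h * L h / sqrt \<eta>"
  have a0: "0 \<le> a" using h Lh eta_pos by (simp add: a_def)
  have e5: "\<forall>\<^sub>F N in sequentially. real (m * N) * growth_rate (q / 2) (4 * H + 1) a a (\<Delta> / real N) < q / 2 * (4 * H + 1 + 1) * T' + 1"
  proof -
    have "(\<lambda>N. real (m * N) * growth_rate (q / 2) (4 * H + 1) a a (T' / real (m * N))) \<longlonglongrightarrow> q / 2 * (4 * H + 1 + 1) * T'"
      by (rule filterlim_compose[OF growth_rate_tendsto[OF T'(1)] sm])
    then show ?thesis unfolding TN by (rule order_tendstoD(2)) simp
  qed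
  have "\<forall>\<^sub>F N in sequentially. measure M (P1 N) < 1 / h powr p \<and> measure M (P2 N) \<le> (1 + 64 * moment_bound (T + 1)) / h powr p
     \<and> measure M (P4 N) < 1 / h powr p \<and> real (m * N) * growth_rate (q / 2) (4 * H + 1) a a (\<Delta> / real N) < q / 2 * (4 * H + 1 + 1) * T' + 1 \<and> 0 < N"
    using e1 e2 e4 e5 eventually_gt_at_top[of 0] by eventually_elim (intro conjI)
  then obtain N where N: "measure M (P1 N) < 1 / h powr p" "measure M (P2 N) \<le> (1 + 64 * moment_bound (T + 1)) / h powr p"
     "measure M (P4 N) < 1 / h powr p" "real (m * N) * growth_rate (q / 2) (4 * H + 1) a a (\<Delta> / real N) < q / 2 * (4 * H + 1 + 1) * T' + 1" "0 < N"
    using eventually_happens'[OF sequentially_bot] by blast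
  let ?d = "\<Delta> / real N" and ?s = "real (I N) * (\<Delta> / real N)"
  have d: "0 < ?d" using D N by simp
  define bad where "bad = P1 N \<union> (P2 N \<union> (P3 \<union> P4 N))"
  have badM [measurable]: "bad \<in> sets M" unfolding bad_def using PM by (intro sets.Un)
  have bad: "measure M bad \<le> tail_const (T + 1) / h powr p"
  proof -
    have "measure M bad \<le> measure M (P1 N) + (measure M (P2 N) + (measure M P3 + measure M (P4 N)))"
      unfolding bad_def using PM by (intro order_trans[OF measure_Un_le] add_left_mono order_refl sets.Un)
    also have "\<dots> \<le> 1 / h powr p + ((1 + 64 * moment_bound (T + 1)) / h powr p + (scheme_bound (T + 1) / h powr p + 1 / h powr p))"
      using N e3 by (intro add_mono) auto
    also have "\<dots> = tail_const (T + 1) / h powr p" by (simp add: tail_const_def add_divide_distrib)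
    finally show ?thesis .
  qed
  let ?S = "stopped (gap N) (agree N) (I N)"
  have S_bound: "(\<integral>\<^sup>+\<omega>. ennreal ((\<eta> + (norm (?S \<omega>))\<^sup>2) powr (q / 2)) \<partial>M) \<le> ennreal (err_const (T + 1) * err)"
  proof -
    have le: "?s \<le> T + 1" using iT(1)[OF N(5)] by linarith
    have "(\<integral>\<^sup>+\<omega>. ennreal ((\<eta> + (norm (?S \<omega>))\<^sup>2) powr (q / 2)) \<partial>M)
      \<le> ennreal (exp (real (I N) * growth_rate (q / 2) (4 * H + 1) a a ?d)
        * (1 + (T + 1) * (q / 2) * ((4 * H + 3) powr (q / 2) * 64 * (incr_const (T + 1) + 1))) * err)"
      unfolding a_def by (rule stopped_gap_moment[OF N(5) le])
    also have "\<dots> \<le> ennreal (err_const (T + 1) * err)"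
      unfolding err_const_def
    proof (intro ennreal_leI mult_right_mono)
      have "real (I N) * growth_rate (q / 2) (4 * H + 1) a a ?d \<le> real (m * N) * growth_rate (q / 2) (4 * H + 1) a a ?d"
        using iT(4)[OF N(5)] q H a0 d by (intro mult_right_mono growth_rate_nonneg) (auto simp del: of_nat_mult)
      also have "\<dots> \<le> q / 2 * (4 * H + 1 + 1) * T' + 1" using N by simp
      also have "\<dots> \<le> q / 2 * (4 * H + 2) * (T + 1) + 1"
      proof -
        have "q / 2 * (4 * H + 2) * T' \<le> q / 2 * (4 * H + 2) * (T + 1)" using T' q H by (intro mult_left_mono) auto
        moreover have "4 * H + 1 + 1 = 4 * H + 2" by simp
        ultimately show ?thesis by (simp only: add_le_cancel_right)
      qed
      finally show "exp (real (I N) * growth_rate (q / 2) (4 * H + 1) a a ?d) \<le> exp (q / 2 * (4 * H + 2) * (T + 1) + 1)" by simp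
    qed (use T q H incr_const_nonneg[of "T + 1"] err_pos in \<open>auto intro!: add_nonneg_nonneg mult_nonneg_nonneg\<close>)
    finally show ?thesis .
  qed
  define E where "E = (\<lambda>\<omega>. norm (x T \<omega> - mtem_cont f g h \<Delta> x0 B T \<omega>))"
  have EM [measurable]: "E \<in> borel_measurable M"
    unfolding E_def cont_eq k_def[symmetric] by measurable
  \<comment> \<open>The level of \<open>powr_interpolate\<close> for e = \<open>err\<close>;
    \<open>h_large\<close> says that it is at most h.\<close>
  define kk where "kk = err powr (- 1 / (p - q))"
  have kk: "0 < kk" "kk \<le> h" using h_large err_pos by (auto simp: kk_def err_def)
  have SM [measurable]: "?S \<in> borel_measurable M"
  proof -
    have gM [measurable]: "gap N j \<in> borel_measurable M" for j
      unfolding gap_def[abs_def] interp_def by measurable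
    have qM: "{\<omega>\<in>space M. agree N j \<omega>} \<in> sets M" for j
      unfolding agree_def by measurable
    show ?thesis by (rule stopped_measurable[OF gM qM])
  qed
  have pw: "E \<omega> powr q \<le> 64 * (729 * err) + 64 * (\<eta> + (norm (?S \<omega>))\<^sup>2) powr (q / 2) + err * E \<omega> powr p + kk powr q * indicator bad \<omega>"
    if \<omega>: "\<omega> \<in> space M" for \<omega>
  proof (cases "\<omega> \<in> bad")
    case True
    have "E \<omega> powr q \<le> err * E \<omega> powr p + kk powr q"
      unfolding kk_def using q err_pos by (intro powr_interpolate) (auto simp: E_def)
    moreover have "0 \<le> 64 * (729 * err)" "0 \<le> 64 * (\<eta> + (norm (?S \<omega>))\<^sup>2) powr (q / 2)" using err_pos by auto
    moreover have "kk powr q * indicator bad \<omega> = kk powr q" using True by simp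
    ultimately show ?thesis by linarith
  next
    case False
    then have nb: "\<omega> \<notin> P1 N" "\<omega> \<notin> P2 N" "\<omega> \<notin> P3" "\<omega> \<notin> P4 N" unfolding bad_def by blast+
    have ag: "agree N j \<omega>" if j: "j \<le> I N" for j
    proof -
      have jm: "j \<le> m * N" using j iT(4)[OF N(5)] by linarith
      then have "j div N \<le> m * N div N" by (rule div_le_mono)
      then have jd: "j div N \<le> m" using N by simp
      have "\<not> tol < norm (euler ?d j \<omega> - x (real j * ?d) \<omega>)" using nb(1) \<omega> jm unfolding P1_def by blast
      moreover have "\<not> h < norm (x (real j * ?d) \<omega>)" using nb(2) \<omega> jm unfolding P2_def by blast
      moreover have "\<not> h < norm (X (j div N) \<omega>)" using nb(3) \<omega> jd unfolding P3_def by blast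
      ultimately show ?thesis unfolding agree_def by linarith
    qed
    have S: "?S \<omega> = gap N (I N) \<omega>" by (rule stopped_eq) (use ag in auto)
    have n4: "norm (x T \<omega> - x ?s \<omega>) \<le> tol" "norm (incr k ?s \<omega> - incr k T \<omega>) \<le> tol"
      using nb(4) \<omega> unfolding P4_def by (auto simp only: mem_Collect_eq not_less simp_thms de_Morgan_disj)
    have n1: "norm (euler ?d (I N) \<omega> - x ?s \<omega>) \<le> tol" using ag[of "I N"] by (simp only: agree_def order_refl simp_thms)
    have dec: "x T \<omega> - mtem_cont f g h \<Delta> x0 B T \<omega> = ((x T \<omega> - x ?s \<omega>) - (euler ?d (I N) \<omega> - x ?s \<omega>) + (incr k ?s \<omega> - incr k T \<omega>)) + gap N (I N) \<omega>"
      unfolding cont_eq k_def[symmetric] gap_def interp_def iT(3)[OF N(5)] by simp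
    let ?A = "(x T \<omega> - x ?s \<omega>) - (euler ?d (I N) \<omega> - x ?s \<omega>) + (incr k ?s \<omega> - incr k T \<omega>)"
    have "norm ?A \<le> norm (x T \<omega> - x ?s \<omega>) + norm (euler ?d (I N) \<omega> - x ?s \<omega>) + norm (incr k ?s \<omega> - incr k T \<omega>)"
      using norm_triangle_ineq[of "(x T \<omega> - x ?s \<omega>) - (euler ?d (I N) \<omega> - x ?s \<omega>)" "incr k ?s \<omega> - incr k T \<omega>"]
        norm_triangle_ineq4[of "x T \<omega> - x ?s \<omega>" "euler ?d (I N) \<omega> - x ?s \<omega>"] by linarith
    then have "norm ?A \<le> 3 * tol" using n1 n4 by linarith
    then have "norm ?A powr q \<le> (3 * tol) powr q" using q by (intro powr_mono2) auto
    also have "\<dots> = 3 powr q * tol powr q" by (rule powr_mult)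
    also have "\<dots> \<le> 3 powr 6 * tol powr q" using q p by (intro mult_right_mono powr_mono) auto
    also have "\<dots> \<le> 729 * err" using tol_powr tol_powr_le by simp
    finally have A: "norm ?A powr q \<le> 729 * err" .
    have G: "norm (gap N (I N) \<omega>) powr q \<le> (\<eta> + (norm (?S \<omega>))\<^sup>2) powr (q / 2)"
    proof -
      have "norm (gap N (I N) \<omega>) powr q = ((norm (gap N (I N) \<omega>))\<^sup>2) powr (q / 2)" by (rule norm_sq_powr_half[symmetric])
      also have "\<dots> \<le> (\<eta> + (norm (gap N (I N) \<omega>))\<^sup>2) powr (q / 2)" using q eta_pos by (intro powr_mono2) auto
      finally show ?thesis unfolding S .
    qed
    have "E \<omega> powr q \<le> 64 * (norm ?A powr q + norm (gap N (I N) \<omega>) powr q)"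
      unfolding E_def dec using q p by (intro norm_add_powr_le) auto
    then have "E \<omega> powr q \<le> 64 * (729 * err) + 64 * (\<eta> + (norm (?S \<omega>))\<^sup>2) powr (q / 2)" using A G by argo
    moreover have "0 \<le> err * E \<omega> powr p" using err_pos by simp
    moreover have "kk powr q * indicator bad \<omega> = 0" using False by simp
    ultimately show ?thesis by linarith
  qed
  let ?Cp = "64 * (8 * moment_bound (T + 1) + 1 + 64 * (scheme_bound (T + 1) + incr_const (T + 1)))"
  have mb: "0 \<le> moment_bound (T + 1)" using T by (intro moment_bound_nonneg) simp
  have Cp0: "0 \<le> ?Cp" using mb scheme_bound_nonneg[of "T + 1"] incr_const_nonneg[of "T + 1"] by auto
  have tc0: "0 \<le> tail_const (T + 1)" using mb scheme_bound_nonneg[of "T + 1"] by (simp add: tail_const_def)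
  have ec0: "0 \<le> err_const (T + 1)" using T by (intro err_const_nonneg) simp
  have tail: "kk powr q * measure M bad \<le> tail_const (T + 1) * err"
  proof -
    \<comment> \<open>The level cancels the tail: kk <= h gives kk^q h^(-p) <= kk^(q-p), and the
      exponent in the definition of \<open>kk\<close> makes the right side exactly
      \<open>err\<close>.\<close>
    have "h powr (- p) \<le> kk powr (- p)" using kk p by (intro powr_mono2') auto
    then have "kk powr q * (1 / h powr p) \<le> kk powr q * kk powr (- p)" by (intro mult_left_mono) (auto simp: powr_minus_divide)
    also have "\<dots> = kk powr (q - p)" by (simp add: powr_add[symmetric])
    also have "\<dots> = err"
    proof -
      have "- 1 / (p - q) * (q - p) = 1" using q by (simp add: field_simps)
      then show ?thesis unfolding kk_def powr_powr using err_pos by simp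
    qed
    finally have 1: "kk powr q * (1 / h powr p) \<le> err" .
    have "kk powr q * measure M bad \<le> kk powr q * (tail_const (T + 1) / h powr p)" using bad by (intro mult_left_mono) auto
    also have "\<dots> = tail_const (T + 1) * (kk powr q * (1 / h powr p))" by simp
    also have "\<dots> \<le> tail_const (T + 1) * err" using 1 tc0 by (intro mult_left_mono)
    finally show ?thesis .
  qed
  have "(\<integral>\<^sup>+\<omega>. ennreal (E \<omega> powr q) \<partial>M) \<le> (\<integral>\<^sup>+\<omega>. ennreal (64 * (729 * err)) + (ennreal 64 * ennreal ((\<eta> + (norm (?S \<omega>))\<^sup>2) powr (q / 2))
      + (ennreal err * ennreal (E \<omega> powr p) + ennreal (kk powr q) * indicator bad \<omega>)) \<partial>M)"
  proof (rule nn_integral_mono)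
    fix \<omega> assume "\<omega> \<in> space M"
    from ennreal_leI[OF pw[OF this]]
    have "ennreal (E \<omega> powr q) \<le> ennreal (64 * (729 * err) + (64 * (\<eta> + (norm (?S \<omega>))\<^sup>2) powr (q / 2) + (err * E \<omega> powr p + kk powr q * indicator bad \<omega>)))"
      by (simp add: add.assoc)
    also have "\<dots> = ennreal (64 * (729 * err)) + (ennreal 64 * ennreal ((\<eta> + (norm (?S \<omega>))\<^sup>2) powr (q / 2))
      + (ennreal err * ennreal (E \<omega> powr p) + ennreal (kk powr q) * ennreal (indicator bad \<omega>)))"
      using err_pos by (simp add: ennreal_mult ennreal_plus add_nonneg_nonneg del: ennreal_numeral distrib_left_numeral)
    also have "ennreal (indicator bad \<omega>) = indicator bad \<omega>" by (rule ennreal_indicator)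
    finally show "ennreal (E \<omega> powr q) \<le> ennreal (64 * (729 * err)) + (ennreal 64 * ennreal ((\<eta> + (norm (?S \<omega>))\<^sup>2) powr (q / 2))
      + (ennreal err * ennreal (E \<omega> powr p) + ennreal (kk powr q) * indicator bad \<omega>))" .
  qed
  also have "\<dots> = ennreal (64 * (729 * err)) + (ennreal 64 * (\<integral>\<^sup>+\<omega>. ennreal ((\<eta> + (norm (?S \<omega>))\<^sup>2) powr (q / 2)) \<partial>M)
      + (ennreal err * (\<integral>\<^sup>+\<omega>. ennreal (E \<omega> powr p) \<partial>M) + ennreal (kk powr q) * emeasure M bad))"
    using emeasure_space_1 by (simp add: nn_integral_cmult nn_integral_add nn_integral_cmult_indicator del: ennreal_numeral distrib_left_numeral)
  also have "\<dots> \<le> ennreal (64 * (729 * err)) + (ennreal 64 * ennreal (err_const (T + 1) * err)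
      + (ennreal err * ennreal ?Cp + ennreal (tail_const (T + 1) * err)))"
  proof (intro add_mono mult_left_mono order_refl S_bound)
    show "(\<integral>\<^sup>+\<omega>. ennreal (E \<omega> powr p) \<partial>M) \<le> ennreal ?Cp" unfolding E_def by (rule cont_p_moment[OF T])
    show "ennreal (kk powr q) * emeasure M bad \<le> ennreal (tail_const (T + 1) * err)"
      using tail by (simp add: emeasure_eq_measure ennreal_mult[symmetric] ennreal_leI)
  qed auto
  also have "\<dots> = ennreal (64 * (729 * err) + (64 * (err_const (T + 1) * err) + (err * ?Cp + tail_const (T + 1) * err)))"
    using err_pos Cp0 tc0 ec0 by (simp add: ennreal_mult[symmetric] ennreal_plus[symmetric] del: ennreal_plus ennreal_numeral distrib_left_numeral)
  also have "64 * (729 * err) + (64 * (err_const (T + 1) * err) + (err * ?Cp + tail_const (T + 1) * err)) = final_const (T + 1) * err"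
    unfolding final_const_def by (simp add: algebra_simps)
  finally show ?thesis unfolding E_def .
qed

lemma final_const_nonneg: "0 \<le> T \<Longrightarrow> 0 \<le> final_const T"
  unfolding final_const_def tail_const_def
  using moment_bound_nonneg[of T] scheme_bound_nonneg[of T] incr_const_nonneg[of T] err_const_nonneg[of T] by auto

text \<open>The step process differs from the continuous one by the increment within the current
  step, whose q-th moment is of order L(h)^q \<Delta>^(q/2). This is at most \<open>err\<close> in
  order because L(h) >= 1.\<close>

lemma strong_error_step:
  assumes T: "0 < T"
  shows "(\<integral>\<^sup>+\<omega>. ennreal (norm (x T \<omega> - mtem_step f g h \<Delta> x0 B T \<omega>) powr q) \<partial>M)
    \<le> ennreal (64 * (final_const (T + 1) + incr_const (T + 1)) * err)"
proof -
  define k where "k = nat \<lfloor>T / \<Delta>\<rfloor>"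
  note kT = floor_div_grid(1,2)[OF less_imp_le[OF T] D, of 1, folded k_def]
  have T0: "0 \<le> T" using T by simp
  note [measurable] = x_M[OF T0] X_M incr_M[OF T0]
  define E where "E = (\<lambda>\<omega>. norm (x T \<omega> - mtem_cont f g h \<Delta> x0 B T \<omega>))"
  have EM [measurable]: "E \<in> borel_measurable M"
    unfolding E_def cont_eq by measurable
  have "(\<integral>\<^sup>+\<omega>. ennreal (norm (x T \<omega> - mtem_step f g h \<Delta> x0 B T \<omega>) powr q) \<partial>M)
    \<le> (\<integral>\<^sup>+\<omega>. ennreal 64 * (ennreal (E \<omega> powr q) + ennreal (norm (incr k T \<omega>) powr q)) \<partial>M)"
  proof (rule nn_integral_mono)
    fix \<omega>
    have eq: "x T \<omega> - mtem_step f g h \<Delta> x0 B T \<omega> = (x T \<omega> - mtem_cont f g h \<Delta> x0 B T \<omega>) + incr k T \<omega>"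
      by (simp add: cont_eq mtem_step_def k_def)
    have "norm (x T \<omega> - mtem_step f g h \<Delta> x0 B T \<omega>) powr q \<le> 64 * (E \<omega> powr q + norm (incr k T \<omega>) powr q)"
      unfolding E_def eq using q p by (intro norm_add_powr_le) auto
    then have "ennreal (norm (x T \<omega> - mtem_step f g h \<Delta> x0 B T \<omega>) powr q) \<le> ennreal (64 * (E \<omega> powr q + norm (incr k T \<omega>) powr q))"
      by (rule ennreal_leI)
    also have "\<dots> = ennreal 64 * (ennreal (E \<omega> powr q) + ennreal (norm (incr k T \<omega>) powr q))"
      by (simp add: ennreal_mult ennreal_plus del: ennreal_numeral distrib_left_numeral)
    finally show "ennreal (norm (x T \<omega> - mtem_step f g h \<Delta> x0 B T \<omega>) powr q) \<le> ennreal 64 * (ennreal (E \<omega> powr q) + ennreal (norm (incr k T \<omega>) powr q))" .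
  qed
  also have "\<dots> = ennreal 64 * ((\<integral>\<^sup>+\<omega>. ennreal (E \<omega> powr q) \<partial>M) + (\<integral>\<^sup>+\<omega>. ennreal (norm (incr k T \<omega>) powr q) \<partial>M))"
    by (simp add: nn_integral_cmult nn_integral_add del: ennreal_numeral distrib_left_numeral)
  also have "\<dots> \<le> ennreal 64 * (ennreal (final_const (T + 1) * err) + ennreal (incr_const (T + 1) * err))"
  proof (intro mult_left_mono add_mono)
    show "(\<integral>\<^sup>+\<omega>. ennreal (E \<omega> powr q) \<partial>M) \<le> ennreal (final_const (T + 1) * err)"
      unfolding E_def by (rule strong_error_cont[OF T])
    have "(\<integral>\<^sup>+\<omega>. ennreal (norm (incr k T \<omega>) powr q) \<partial>M) \<le> ennreal (incr_const (T + 1) * (L h powr q * \<Delta> powr (q / 2)))"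
      by (rule incr_moment) (use kT q in auto)
    also have "\<dots> \<le> ennreal (incr_const (T + 1) * err)"
      by (intro ennreal_leI mult_left_mono tol_powr_le incr_const_nonneg)
    finally show "(\<integral>\<^sup>+\<omega>. ennreal (norm (incr k T \<omega>) powr q) \<partial>M) \<le> ennreal (incr_const (T + 1) * err)" .
  qed auto
  also have "\<dots> = ennreal (64 * (final_const (T + 1) + incr_const (T + 1)) * err)"
    using final_const_nonneg[of "T + 1"] T incr_const_nonneg[of "T + 1"] err_pos
    by (simp add: ennreal_mult[symmetric] ennreal_plus[symmetric] algebra_simps del: ennreal_plus ennreal_numeral distrib_left_numeral)
  finally show ?thesis .
qed

end

theorem theorem2p3:
  fixes M :: "'a measure" and F :: "real \<Rightarrow> 'a measure"
    and B :: "real \<Rightarrow> 'a \<Rightarrow> real^'m::finite"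
    and f :: "real^'d::finite \<Rightarrow> real^'d" and g :: "real^'d \<Rightarrow> real^'m^'d"
    and x0 :: "real^'d" and x :: "real \<Rightarrow> 'a \<Rightarrow> real^'d"
    and L :: "real \<Rightarrow> real" and h :: "real \<Rightarrow> real"
    and \<Delta>star p q H K :: real
  assumes prob: "prob_space M"
    and filt: "usual_filtration M F"
    and BM: "std_brownian_motion M F B"
    and f_meas: "f \<in> borel_measurable borel" and g_meas: "g \<in> borel_measurable borel"
    and sol: "sde_solution M F B f g x0 x"
    \<comment> \<open>(2.2)\<close>
    and L_pos: "\<forall>R>0. L R > 0"
    and L_lip: "\<forall>R>0. \<forall>y z. norm y \<le> R \<and> norm z \<le> R \<longrightarrow>
                   norm (f y - f z) \<le> L R * norm (y - z) \<and> norm (g y - g z) \<le> L R * norm (y - z)"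
    and L_mono: "\<forall>R1 R2. 0 < R1 \<and> R1 \<le> R2 \<longrightarrow> L R1 \<le> L R2"
    and L_inf: "filterlim L at_top at_top"
    \<comment> \<open>(2.3)\<close>
    and Dstar: "\<Delta>star > 0"
    and h_pos: "\<forall>\<Delta>. 0 < \<Delta> \<and> \<Delta> \<le> \<Delta>star \<longrightarrow> h \<Delta> > 0"
    and h_decr: "\<forall>\<Delta>1 \<Delta>2. 0 < \<Delta>1 \<and> \<Delta>1 \<le> \<Delta>2 \<and> \<Delta>2 \<le> \<Delta>star \<longrightarrow> h \<Delta>2 \<le> h \<Delta>1"
    and h_lim: "filterlim h at_top (at_right 0)"
    and Lh_lim: "((\<lambda>\<Delta>. L (h \<Delta>) ^ 4 * \<Delta>) \<longlongrightarrow> 0) (at_right 0)"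
    \<comment> \<open>(2.9) with p in (2,6]\<close>
    and p: "2 < p" "p \<le> 6"
    and K: "K > 0"
    and khas: "\<forall>y. inner y (f y) + (p - 1) / 2 * norm (g y) ^ 2 \<le> K * (1 + norm y ^ 2)"
    \<comment> \<open>(2.8) with 2 < q < p\<close>
    and q: "2 < q" "q < p"
    and H: "H > 0"
    and monot: "\<forall>y z. inner (y - z) (f y - f z) + (q - 1) / 2 * norm (g y - g z) ^ 2
                     \<le> H * norm (y - z) ^ 2"
    \<comment> \<open>(2.10)\<close>
    and cond210: "\<exists>\<Delta>0. 0 < \<Delta>0 \<and> \<Delta>0 \<le> \<Delta>star \<and>
        (\<forall>\<Delta>. 0 < \<Delta> \<and> \<Delta> \<le> \<Delta>0 \<longrightarrow>
           h \<Delta> \<ge> (L (h \<Delta>) powr (2 * q) * \<Delta> powr (q / 2)) powr (- 1 / (p - q)))"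
  shows "\<forall>T>0. \<exists>C1 C2. \<exists>\<Delta>1>0. \<forall>\<Delta>. 0 < \<Delta> \<and> \<Delta> \<le> \<Delta>1 \<longrightarrow>
            (\<integral>\<^sup>+ \<omega>. ennreal (norm (x T \<omega> - mtem_cont f g (h \<Delta>) \<Delta> x0 B T \<omega>) powr q) \<partial>M)
              \<le> ennreal (C1 * L (h \<Delta>) powr (2 * q) * \<Delta> powr (q / 2)) \<and>
            (\<integral>\<^sup>+ \<omega>. ennreal (norm (x T \<omega> - mtem_step f g (h \<Delta>) \<Delta> x0 B T \<omega>) powr q) \<partial>M)
              \<le> ennreal (C2 * L (h \<Delta>) powr (2 * q) * \<Delta> powr (q / 2))"
proof (intro allI impI)
  fix T :: real assume T: "0 < T"
  obtain \<Delta>0 where D0: "0 < \<Delta>0" and c210: "\<And>\<Delta>. 0 < \<Delta> \<Longrightarrow> \<Delta> \<le> \<Delta>0 \<Longrightarrow>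
      (L (h \<Delta>) powr (2 * q) * \<Delta> powr (q / 2)) powr (- 1 / (p - q)) \<le> h \<Delta>"
    using cond210 by blast
  have "\<forall>\<^sub>F \<Delta> in at_right 0. 1 \<le> h \<Delta> \<and> 1 \<le> L (h \<Delta>) \<and> L (h \<Delta>) ^ 4 * \<Delta> < 1 \<and> \<Delta> < \<Delta>0"
  proof (intro eventually_conj)
    show "\<forall>\<^sub>F \<Delta> in at_right 0. 1 \<le> h \<Delta>"
      using h_lim unfolding filterlim_at_top by blast
    show "\<forall>\<^sub>F \<Delta> in at_right 0. 1 \<le> L (h \<Delta>)"
      using filterlim_compose[OF L_inf h_lim] unfolding filterlim_at_top by blast
    show "\<forall>\<^sub>F \<Delta> in at_right 0. L (h \<Delta>) ^ 4 * \<Delta> < 1"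
      by (rule order_tendstoD(2)[OF Lh_lim]) simp
    show "\<forall>\<^sub>F \<Delta> in at_right 0. \<Delta> < \<Delta>0"
      using D0 unfolding eventually_at_right_field by blast
  qed
  then obtain b where b: "0 < b" "\<And>\<Delta>. 0 < \<Delta> \<Longrightarrow> \<Delta> < b \<Longrightarrow>
      1 \<le> h \<Delta> \<and> 1 \<le> L (h \<Delta>) \<and> L (h \<Delta>) ^ 4 * \<Delta> < 1 \<and> \<Delta> < \<Delta>0"
    unfolding eventually_at_right_field by blast
  interpret prob_space M by (rule prob)
  have scheme: "mtem_error M F B f g x0 x L p K (h \<Delta>) \<Delta> q H" if D: "0 < \<Delta>" "\<Delta> \<le> b / 2" for \<Delta>
  proof -
    have "\<Delta> < b" using D b(1) by simp
    from b(2)[OF D(1) this] have small: "1 \<le> h \<Delta>" "1 \<le> L (h \<Delta>)" "L (h \<Delta>) ^ 4 * \<Delta> \<le> 1" "\<Delta> \<le> \<Delta>0" by auto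
    show ?thesis
      by unfold_locales (use filt BM sol L_pos L_lip p K khas q H monot small D c210[OF D(1) small(4)] in blast)+
  qed
  have b2: "0 < b / 2" "b / 2 \<le> b / 2" using b(1) by auto
  \<comment> \<open>The instance at b/2 serves to name the constants. Their definitions involve
    neither \<open>h\<close> nor \<Delta>, so \<open>E.final_const\<close> and
    \<open>E.incr_const\<close> are the same numbers for every step size up to b/2.\<close>
  interpret E: mtem_error M F B f g x0 x L p K "h (b / 2)" "b / 2" q H by (rule scheme[OF b2])
  show "\<exists>C1 C2. \<exists>\<Delta>1>0. \<forall>\<Delta>. 0 < \<Delta> \<and> \<Delta> \<le> \<Delta>1 \<longrightarrow>
      (\<integral>\<^sup>+ \<omega>. ennreal (norm (x T \<omega> - mtem_cont f g (h \<Delta>) \<Delta> x0 B T \<omega>) powr q) \<partial>M)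
        \<le> ennreal (C1 * L (h \<Delta>) powr (2 * q) * \<Delta> powr (q / 2)) \<and>
      (\<integral>\<^sup>+ \<omega>. ennreal (norm (x T \<omega> - mtem_step f g (h \<Delta>) \<Delta> x0 B T \<omega>) powr q) \<partial>M)
        \<le> ennreal (C2 * L (h \<Delta>) powr (2 * q) * \<Delta> powr (q / 2))"
  proof (rule exI[of _ "E.final_const (T + 1)"], rule exI[of _ "64 * (E.final_const (T + 1) + E.incr_const (T + 1))"],
      rule exI[of _ "b / 2"], intro conjI allI impI b2)
    fix \<Delta> assume "0 < \<Delta> \<and> \<Delta> \<le> b / 2"
    then interpret D: mtem_error M F B f g x0 x L p K "h \<Delta>" \<Delta> q H using scheme by blast
    show "(\<integral>\<^sup>+ \<omega>. ennreal (norm (x T \<omega> - mtem_cont f g (h \<Delta>) \<Delta> x0 B T \<omega>) powr q) \<partial>M)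
        \<le> ennreal (E.final_const (T + 1) * L (h \<Delta>) powr (2 * q) * \<Delta> powr (q / 2))"
      using D.strong_error_cont[OF T] unfolding D.err_def mult.assoc .
    show "(\<integral>\<^sup>+ \<omega>. ennreal (norm (x T \<omega> - mtem_step f g (h \<Delta>) \<Delta> x0 B T \<omega>) powr q) \<partial>M)
        \<le> ennreal (64 * (E.final_const (T + 1) + E.incr_const (T + 1)) * L (h \<Delta>) powr (2 * q) * \<Delta> powr (q / 2))"
      using D.strong_error_step[OF T] unfolding D.err_def mult.assoc .
  qed
qed

end
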